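(* Let $d\ge1$, let $F$ be a $d$-dimensional square-integrable centered random vector with invertible covariance matrix $C$ and differentiable density $f$ on $\mathbb{R}^d$, and let $Z$ be a $d$-dimensional centered Gaussian vector with the same covariance matrix $C$ and density $\phi$, independent of $F$. Then $$D(F\|Z)\le\|C\|_{op}\times\frac12\,\mathrm{tr}\big(C^{-1}J_{st}(F)\big)=\|C\|_{op}\times\frac12\Big(\mathrm{tr}(J(F))-\mathrm{tr}(J(Z))\Big).$$ As a consequence, $$\|f-\phi\|^2_{L^1(\mathbb{R}^d)}=4\,(d_{TV}(F,Z))^2\le2D(F\|Z)\le\|C\|_{op}\,\mathrm{tr}\big(C^{-1}J_{st}(F)\big).$$
   Context: $\|\cdot\|_{op}$ is the operator norm. $D(F\|Z)=\int_{\mathbb{R}^d}f(\mathbf{x})\log\frac{f(\mathbf{x})}{\phi(\mathbf{x})}\,d\mathbf{x}$ is the relative entropy (with $0\log0=0$). $d_{TV}(F,Z)=\sup_{A\in\mathcal{B}(\mathbb{R}^d)}|P(F\in A)-P(Z\in A)|$. The score of a random vector $F$ with differentiable density $f$ is $\rho_F=\nabla\log f:\mathbb{R}^d\to\mathbb{R}^d$; it is characterized by $E[\rho_F(F)g(F)]=-E[\nabla g(F)]$ for all test functions $g:\mathbb{R}^d\to\mathbb{R}$. The Fisher information matrix is $J(F)=E[\rho_F(F)\rho_F(F)^T]$ and its standardised version is $$J_{st}(F)=C\,E\big[(\rho_F(F)+C^{-1}F)(\rho_F(F)+C^{-1}F)^T\big]=C\,(J(F)-C^{-1}).$$ For the Gaussian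 vector $Z$, $J(Z)=C^{-1}$. *)

theory Defs
  imports "HOL-Probability.Probability"
begin

definition second_moment_matrix :: "'a measure \<Rightarrow> ('a \<Rightarrow> real^'n) \<Rightarrow> real^'n^'n" where
  "second_moment_matrix M X = (\<chi> i j. LINT \<omega>|M. X \<omega> $ i * X \<omega> $ j)"

definition covariance_matrix :: "'a measure \<Rightarrow> ('a \<Rightarrow> real^'n) \<Rightarrow> real^'n^'n" where
  "covariance_matrix M X = second_moment_matrix M (\<lambda>\<omega>. X \<omega> - (LINT \<omega>'|M. X \<omega>'))"

text \<open>Density of the centered Gaussian vector with (positive definite) covariance \<open>C\<close>.\<close>

definition gaussian_density :: "real^'n^'n \<Rightarrow> real^'n \<Rightarrow> real" where
  "gaussian_density C x =
     exp (- (x \<bullet> (matrix_inv C *v x)) / 2) / sqrt ((2 * pi) ^ CARD('n) * det C)"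

definition centered_gaussian_vector :: "'a measure \<Rightarrow> real^'n^'n \<Rightarrow> ('a \<Rightarrow> real^'n) \<Rightarrow> bool" where
  "centered_gaussian_vector M C Z \<longleftrightarrow>
     distributed M lborel Z (\<lambda>x. ennreal (gaussian_density C x))"

text \<open>
  The integral of \<open>f log (f/g)\<close> as an extended real, namely the integral of the positive part
  minus that of the negative part. For probability densities the latter is finite (because
  \<open>f log (f/g) \<ge> f - g\<close>), so no \<open>\<infinity> - \<infinity>\<close> arises. The convention \<open>0 log 0 = 0\<close> is
  automatic, since the factor \<open>f x = 0\<close> annihilates the logarithm.
\<close>

definition relative_entropy :: "(real^'n \<Rightarrow> real) \<Rightarrow> (real^'n \<Rightarrow> real) \<Rightarrow> ereal" where
  "relative_entropy f g =
     enn2ereal (\<integral>\<^sup>+x. ennreal (f x * ln (f x / g x)) \<partial>lborel)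
     - enn2ereal (\<integral>\<^sup>+x. ennreal (- (f x * ln (f x / g x))) \<partial>lborel)"

definition d_TV :: "'a measure \<Rightarrow> ('a \<Rightarrow> real^'n) \<Rightarrow> ('a \<Rightarrow> real^'n) \<Rightarrow> real" where
  "d_TV M X Y =
     (SUP A\<in>sets borel. \<bar>measure M {\<omega>\<in>space M. X \<omega> \<in> A} - measure M {\<omega>\<in>space M. Y \<omega> \<in> A}\<bar>)"

text \<open>
  The gradient of \<open>log f\<close>. It makes sense only where \<open>f > 0\<close>, which is where a vector with
  density \<open>f\<close> lies almost surely; the value \<open>0\<close> elsewhere is an arbitrary choice.
\<close>

definition score :: "(real^'n \<Rightarrow> real) \<Rightarrow> real^'n \<Rightarrow> real^'n" where
  "score f x = (if f x > 0 then (THE D. GDERIV (\<lambda>y. ln (f y)) x :> D) else 0)"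

definition fisher_matrix ::
    "'a measure \<Rightarrow> ('a \<Rightarrow> real^'n) \<Rightarrow> (real^'n \<Rightarrow> real) \<Rightarrow> real^'n^'n" where
  "fisher_matrix M X f = second_moment_matrix M (\<lambda>\<omega>. score f (X \<omega>))"

definition standardised_fisher_matrix ::
    "'a measure \<Rightarrow> ('a \<Rightarrow> real^'n) \<Rightarrow> (real^'n \<Rightarrow> real) \<Rightarrow> real^'n^'n" where
  "standardised_fisher_matrix M X f =
     covariance_matrix M X **
     second_moment_matrix M
       (\<lambda>\<omega>. score f (X \<omega>) + matrix_inv (covariance_matrix M X) *v X \<omega>)"

definition square_integrable :: "'a measure \<Rightarrow> ('a \<Rightarrow> real^'n) \<Rightarrow> bool" where
  "square_integrable M X \<longleftrightarrow> X \<in> borel_measurable M \<and> integrable M (\<lambda>\<omega>. (norm (X \<omega>))\<^sup>2)"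

text \<open>
  The entries of the Fisher matrices are finite exactly when the score is square integrable.
  Otherwise the traces of \<open>J(X)\<close> and of \<open>C\<^sup>-\<^sup>1 J\<^sub>s\<^sub>t(X)\<close>, being the expectations of the squared norms
  of the score and of the score plus \<open>C\<^sup>-\<^sup>1 X\<close> (\<open>X\<close> being square integrable), are infinite.
\<close>

definition trace_J :: "'a measure \<Rightarrow> ('a \<Rightarrow> real^'n) \<Rightarrow> (real^'n \<Rightarrow> real) \<Rightarrow> ereal" where
  "trace_J M X f =
     (if square_integrable M (\<lambda>\<omega>. score f (X \<omega>))
      then ereal (trace (fisher_matrix M X f)) else \<infinity>)"

definition trace_Cinv_Jst :: "'a measure \<Rightarrow> ('a \<Rightarrow> real^'n) \<Rightarrow> (real^'n \<Rightarrow> real) \<Rightarrow> ereal" where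
  "trace_Cinv_Jst M X f =
     (if square_integrable M (\<lambda>\<omega>. score f (X \<omega>))
      then ereal (trace (matrix_inv (covariance_matrix M X) ** standardised_fisher_matrix M X f))
      else \<infinity>)"

lemma second_moment_integrable:
  fixes X :: "'a \<Rightarrow> real^'n"
  assumes "square_integrable M X"
  shows "integrable M (\<lambda>\<omega>. X \<omega> $ i * X \<omega> $ j)"
proof (rule Bochner_Integration.integrable_bound)
  have X: "X \<in> borel_measurable M"
    using assms by (simp add: square_integrable_def)
  show "integrable M (\<lambda>\<omega>. (norm (X \<omega>))\<^sup>2)"
    using assms by (simp add: square_integrable_def)
  have "(\<lambda>\<omega>. X \<omega> $ k) \<in> borel_measurable M" for k
    by (rule measurable_compose[OF X]) (intro borel_measurable_continuous_onI continuous_intros)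
  then show "(\<lambda>\<omega>. X \<omega> $ i * X \<omega> $ j) \<in> borel_measurable M"
    by (intro borel_measurable_times)
  have "\<bar>X \<omega> $ i\<bar> * \<bar>X \<omega> $ j\<bar> \<le> norm (X \<omega>) * norm (X \<omega>)" for \<omega>
    by (intro mult_mono component_le_norm_cart) auto
  then show "AE \<omega> in M. norm (X \<omega> $ i * X \<omega> $ j) \<le> norm ((norm (X \<omega>))\<^sup>2)"
    by (simp add: abs_mult power2_eq_square)
qed

lemma trace_second_moment_matrix:
  fixes X :: "'a \<Rightarrow> real^'n"
  assumes "square_integrable M X"
  shows "trace (second_moment_matrix M X) = (LINT \<omega>|M. (norm (X \<omega>))\<^sup>2)"
proof -
  have "(LINT \<omega>|M. (norm (X \<omega>))\<^sup>2) = (LINT \<omega>|M. (\<Sum>i\<in>UNIV. X \<omega> $ i * X \<omega> $ i))"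
    by (simp only: power2_norm_eq_inner inner_vec_def inner_real_def)
  also have "\<dots> = (\<Sum>i\<in>UNIV. LINT \<omega>|M. X \<omega> $ i * X \<omega> $ i)"
    by (rule Bochner_Integration.integral_sum) (rule second_moment_integrable[OF assms])
  finally show ?thesis
    by (simp only: trace_def second_moment_matrix_def vec_lambda_beta)
qed

lemma trace_J_eq_nn_integral:
  assumes "(\<lambda>\<omega>. score f (X \<omega>)) \<in> borel_measurable M"
  shows "trace_J M X f = enn2ereal (\<integral>\<^sup>+\<omega>. ennreal ((norm (score f (X \<omega>)))\<^sup>2) \<partial>M)"
proof (cases "square_integrable M (\<lambda>\<omega>. score f (X \<omega>))")
  case True
  then have int: "integrable M (\<lambda>\<omega>. (norm (score f (X \<omega>)))\<^sup>2)"
    by (simp only: square_integrable_def)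
  have "(\<integral>\<^sup>+\<omega>. ennreal ((norm (score f (X \<omega>)))\<^sup>2) \<partial>M)
      = ennreal (LINT \<omega>|M. (norm (score f (X \<omega>)))\<^sup>2)"
    by (rule nn_integral_eq_integral[OF int]) (rule AE_I2, rule zero_le_power2)
  moreover have "0 \<le> (LINT \<omega>|M. (norm (score f (X \<omega>)))\<^sup>2)"
    by (rule Bochner_Integration.integral_nonneg) (rule zero_le_power2)
  ultimately show ?thesis
    using True
    by (simp only: trace_J_def fisher_matrix_def trace_second_moment_matrix if_True
        enn2ereal_ennreal)
next
  case False
  then have nint: "\<not> integrable M (\<lambda>\<omega>. (norm (score f (X \<omega>)))\<^sup>2)"
    using assms by (simp only: square_integrable_def simp_thms)
  have meas: "(\<lambda>\<omega>. (norm (score f (X \<omega>)))\<^sup>2) \<in> borel_measurable M"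
    by (intro borel_measurable_power measurable_compose[OF assms] borel_measurable_norm)
  have "(\<integral>\<^sup>+\<omega>. ennreal ((norm (score f (X \<omega>)))\<^sup>2) \<partial>M) = \<infinity>"
  proof (rule ccontr)
    assume "(\<integral>\<^sup>+\<omega>. ennreal ((norm (score f (X \<omega>)))\<^sup>2) \<partial>M) \<noteq> \<infinity>"
    then have "(\<integral>\<^sup>+\<omega>. ennreal ((norm (score f (X \<omega>)))\<^sup>2) \<partial>M) < \<infinity>"
      by (simp only: less_top infinity_ennreal_def)
    then have "integrable M (\<lambda>\<omega>. (norm (score f (X \<omega>)))\<^sup>2)"
      by (rule integrableI_nonneg[OF meas, rotated]) (rule AE_I2, rule zero_le_power2)
    with nint show False ..
  qed
  with False show ?thesis
    by (simp only: trace_J_def if_False infinity_ennreal_def enn2ereal_top)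
qed

end

theory Submission
  imports Defs
begin

text \<open>
  The first inequality is the logarithmic Sobolev inequality for the Gaussian measure with density
  \<open>\<phi>\<close>, applied to \<open>h = f / \<phi>\<close>. Indeed \<open>\<nabla>h / h = \<rho>\<^sub>F + C\<^sup>-\<^sup>1 x\<close>, so that it reads
  \<open>D(F\<parallel>Z) \<le> 1/2 E[(\<rho>\<^sub>F + C\<^sup>-\<^sup>1 F) \<bullet> C (\<rho>\<^sub>F + C\<^sup>-\<^sup>1 F)]\<close>, and the quadratic form \<open>C\<close> is at most
  \<open>\<parallel>C\<parallel> \<bar>v\<bar>\<^sup>2\<close>. The identity of the two right-hand sides is obtained by expanding the square and
  integrating \<open>E[\<rho>\<^sub>F \<bullet> C\<^sup>-\<^sup>1 F] = - tr C\<^sup>-\<^sup>1\<close> by parts. The remaining claims are Pinsker's inequality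
  and the fact that the total variation distance is half the \<open>L\<^sup>1\<close> distance of the densities.

  The logarithmic Sobolev inequality is proved by a central-limit type argument, without
  diagonalising \<open>C\<close>. Under the Gaussian measure shrunk by a small factor \<open>r\<close>, a function with bounded
  and Lipschitz gradient is nearly affine and its entropy is at most \<open>r\<^sup>2/2\<close> times the Fisher
  information, up to an error \<open>O(r\<^sup>3)\<close> (\<open>Ent_small_scale\<close>). A Gaussian at scale \<open>sqrt 2 * r\<close> is the
  sum of two independent ones at scale \<open>r\<close>, and entropy is subadditive over independent variables
  (\<open>Ent_tensorization\<close>); so the inequality passes from \<open>r\<close> to \<open>sqrt 2 * r\<close> while the error doubles
  (\<open>Ent_doubling\<close>). After \<open>k\<close> doublings the error is \<open>2\<^sup>k O(2\<^sup>-\<^sup>3\<^sup>k\<^sup>/\<^sup>2)\<close>, which tends to \<open>0\<close>.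

  A general \<open>h\<close> is reached in two steps. If \<open>h\<close> takes values in a compact subinterval of the positive
  half-line, the Ornstein-Uhlenbeck semigroup makes it regular, and by convexity does not increase
  the Fisher information (\<open>fisher_mehler_le\<close>, \<open>log_sobolev_bounded\<close>). An unbounded \<open>h\<close> is first
  truncated by a function that does not increase the Fisher information (\<open>log_sobolev\<close>).

  The density is assumed to be differentiable, with a gradient that may be discontinuous. This is
  enough for integration by parts: a function that is differentiable at every point of a segment,
  with integrable derivative, is the integral of its derivative
  (\<open>integral_directional_derivative_eq_0\<close>).
\<close>

section \<open>Calculus of everywhere differentiable functions\<close>

lemma nn_integral_lborel_affine:
  fixes u :: "'a::euclidean_space \<Rightarrow> ennreal"
  assumes [measurable]: "u \<in> borel_measurable borel" and "c \<noteq> 0"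
  shows "(\<integral>\<^sup>+x. u x \<partial>lborel) = ennreal (\<bar>c\<bar> ^ DIM('a)) * (\<integral>\<^sup>+x. u (t + c *\<^sub>R x) \<partial>lborel)"
  by (subst lborel_affine[OF assms(2), of t])
     (simp add: nn_integral_density nn_integral_distr nn_integral_cmult)

lemma integrable_lborel_translate:
  fixes u :: "'a::euclidean_space \<Rightarrow> 'b::{banach, second_countable_topology}"
  assumes "integrable lborel u"
  shows "integrable lborel (\<lambda>x. u (t + x))"
proof -
  have "integrable (distr lborel borel ((+) t)) u"
    using assms by (simp add: lborel_distr_plus)
  then show ?thesis
    by (rule integrable_distr[rotated]) simp
qed

lemma integral_lborel_translate:
  fixes u :: "'a::euclidean_space \<Rightarrow> 'b::{banach, second_countable_topology}"
  assumes [measurable]: "u \<in> borel_measurable borel"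
  shows "(\<integral>x. u (t + x) \<partial>lborel) = (\<integral>x. u x \<partial>lborel)"
proof -
  have "(\<integral>x. u x \<partial>distr lborel borel ((+) t)) = (\<integral>x. u (t + x) \<partial>lborel)"
    by (rule integral_distr) simp_all
  then show ?thesis by (simp add: lborel_distr_plus)
qed

lemma gderiv_exists:
  fixes f :: "'a::euclidean_space \<Rightarrow> real"
  assumes "f differentiable (at x)"
  shows "\<exists>D. GDERIV f x :> D"
proof -
  from assms obtain f' where f': "(f has_derivative f') (at x)"
    by (auto simp: differentiable_def)
  then interpret bounded_linear f' by (rule has_derivative_bounded_linear)
  have "f' = (\<lambda>h. inner h (\<Sum>b\<in>Basis. f' b *\<^sub>R b))"
  proof
    fix h
    have "f' h = f' (\<Sum>b\<in>Basis. (h \<bullet> b) *\<^sub>R b)" by (simp add: euclidean_representation)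
    also have "\<dots> = (\<Sum>b\<in>Basis. (h \<bullet> b) * f' b)" by (simp add: sum scaleR)
    finally show "f' h = inner h (\<Sum>b\<in>Basis. f' b *\<^sub>R b)"
      by (simp add: inner_sum_right mult.commute)
  qed
  then show ?thesis using f' unfolding gderiv_def by metis
qed

lemma gderiv_unique:
  fixes f :: "'a::euclidean_space \<Rightarrow> real"
  assumes "GDERIV f x :> D" "GDERIV f x :> E"
  shows "D = E"
proof -
  have "(\<lambda>h. inner h D) = (\<lambda>h. inner h E)"
    using assms unfolding gderiv_def by (rule has_derivative_unique)
  then show ?thesis by (metis inner_commute vector_eq_ldot)
qed

lemma gderiv_has_vector_derivative_line:
  assumes "GDERIV g (x + t *\<^sub>R v) :> D"
  shows "((\<lambda>t. g (x + t *\<^sub>R v)) has_vector_derivative (D \<bullet> v)) (at t within S)"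
proof -
  have "((\<lambda>t. x + t *\<^sub>R v) has_derivative (\<lambda>s. s *\<^sub>R v)) (at t within S)"
    by (auto intro!: derivative_eq_intros)
  from has_derivative_compose[OF this assms[unfolded gderiv_def]]
  show ?thesis
    by (simp add: has_vector_derivative_def inner_commute)
qed

lemma gderiv_continuous_on:
  assumes "\<And>x. GDERIV f x :> g x"
  shows "continuous_on S f"
  using assms unfolding gderiv_def
  by (meson has_derivative_continuous continuous_at_imp_continuous_on)

text \<open>The gradient of a differentiable function may be discontinuous; it is nevertheless the limit
  of the difference quotients along \<open>1/n\<close>.\<close>

lemma gderiv_measurable:
  fixes f :: "'a::euclidean_space \<Rightarrow> real"
  assumes d: "\<And>x. GDERIV f x :> g x"
  shows "g \<in> borel_measurable borel"
proof (rule borel_measurable_euclidean_space[THEN iffD2], intro ballI)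
  fix b :: 'a assume "b \<in> Basis"
  have [measurable]: "f \<in> borel_measurable borel"
    by (intro borel_measurable_continuous_onI gderiv_continuous_on[OF d])
  show "(\<lambda>x. g x \<bullet> b) \<in> borel_measurable borel"
  proof (rule borel_measurable_LIMSEQ_real)
    show "(\<lambda>n. (f (x + inverse (real (Suc n)) *\<^sub>R b) - f x) / inverse (real (Suc n))) \<longlonglongrightarrow> g x \<bullet> b" for x
    proof -
      have "((\<lambda>t. f (x + t *\<^sub>R b)) has_real_derivative (g x \<bullet> b)) (at 0)"
        using gderiv_has_vector_derivative_line[of f x 0 b "g x" UNIV] d
        by (simp add: has_real_derivative_iff_has_vector_derivative)
      then have "((\<lambda>h. (f (x + h *\<^sub>R b) - f x) / h) \<longlongrightarrow> g x \<bullet> b) (at 0)"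
        by (simp add: DERIV_def)
      moreover have "filterlim (\<lambda>n. inverse (real (Suc n))) (at 0) sequentially"
        by (intro filterlim_atI LIMSEQ_inverse_real_of_nat) auto
      ultimately show ?thesis by (rule filterlim_compose)
    qed
  qed measurable
qed

text \<open>Slicing along the lines parallel to \<open>v\<close> is avoided: for almost every \<open>x\<close> the increment
  \<open>g (x + v) - g x\<close> is the integral of the directional derivative over the segment, and integrating
  this in \<open>x\<close> gives \<open>0\<close> on the left by translation invariance, and the integral of the derivative
  on the right. The fundamental theorem of calculus for the gauge integral needs only
  differentiability at every point.\<close>

lemma integral_directional_derivative_eq_0:
  fixes g :: "'a::euclidean_space \<Rightarrow> real"
  assumes d: "\<And>x. GDERIV g x :> g' x"
    and ig: "integrable lborel g" and iD: "integrable lborel (\<lambda>x. g' x \<bullet> v)"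
  shows "(\<integral>x. g' x \<bullet> v \<partial>lborel) = 0"
proof -
  let ?D = "\<lambda>x. g' x \<bullet> v"
  have [measurable]: "g' \<in> borel_measurable borel" by (rule gderiv_measurable[OF d])
  \<comment> \<open>The directional derivative at \<open>x + t v\<close>, for \<open>t\<close> in the unit interval.\<close>
  define k where "k = (\<lambda>(t::real, x). indicator {0..1} t * ?D (t *\<^sub>R v + x))"
  have km[measurable]: "k \<in> borel_measurable (lborel \<Otimes>\<^sub>M lborel)"
    unfolding k_def by measurable
  have inner: "(\<integral>x. ?D (t *\<^sub>R v + x) \<partial>lborel) = (\<integral>x. ?D x \<partial>lborel)" for t
    by (rule integral_lborel_translate) measurable
  have innern: "(\<integral>x. \<bar>?D (t *\<^sub>R v + x)\<bar> \<partial>lborel) = (\<integral>x. \<bar>?D x\<bar> \<partial>lborel)" for t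
    by (rule integral_lborel_translate) measurable
  have ik: "integrable (lborel \<Otimes>\<^sub>M lborel) k"
  proof (rule lborel_pair.Fubini_integrable[OF km])
    have "integrable lborel (\<lambda>t::real. indicator {0..1} t * (\<integral>x. \<bar>?D x\<bar> \<partial>lborel))"
      by (intro integrable_mult_left) simp
    then show "integrable lborel (\<lambda>t. \<integral>x. norm (k (t, x)) \<partial>lborel)"
      by (simp add: k_def abs_mult innern)
    show "AE t in lborel. integrable lborel (\<lambda>x. k (t, x))"
      using integrable_lborel_translate[OF iD] by (auto simp: k_def)
  qed
  have "(\<integral>x. ?D x \<partial>lborel) = (\<integral>t. \<integral>x. k (t, x) \<partial>lborel \<partial>lborel)"
    by (simp add: k_def inner)
  also have "\<dots> = (\<integral>x. \<integral>t. k (t, x) \<partial>lborel \<partial>lborel)"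
    by (rule lborel_pair.Fubini_integral[symmetric]) (use ik in simp)
  also have "\<dots> = (\<integral>x. g (v + x) - g x \<partial>lborel)"
  proof (rule integral_cong_AE)
    have ik': "integrable (lborel \<Otimes>\<^sub>M lborel) (\<lambda>(x, t). k (t, x))"
      using lborel_pair.integrable_product_swap[OF ik] by simp
    from lborel_pair.AE_integrable_fst'[OF ik']
    show "AE x in lborel. (\<integral>t. k (t, x) \<partial>lborel) = g (v + x) - g x"
    proof eventually_elim
      case (elim x)
      have si: "set_integrable lborel {0..1} (\<lambda>t. ?D (t *\<^sub>R v + x))"
        using elim by (simp add: set_integrable_def k_def)
      have "((\<lambda>t. ?D (x + t *\<^sub>R v)) has_integral (g (x + 1 *\<^sub>R v) - g (x + 0 *\<^sub>R v))) {0..1}"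
        by (rule fundamental_theorem_of_calculus)
           (auto intro!: gderiv_has_vector_derivative_line d)
      then have "integral {0..1} (\<lambda>t. ?D (t *\<^sub>R v + x)) = g (v + x) - g x"
        by (simp add: add.commute integral_unique)
      with set_borel_integral_eq_integral(2)[OF si] show ?case
        by (simp add: set_lebesgue_integral_def k_def)
    qed
  qed (use gderiv_continuous_on[OF d, of UNIV] in \<open>auto intro!: borel_measurable_continuous_onI lborel.borel_measurable_lebesgue_integral continuous_intros continuous_on_compose2[of UNIV g] simp: split_def\<close>)
  also have "\<dots> = (\<integral>x. g (v + x) \<partial>lborel) - (\<integral>x. g x \<partial>lborel)"
    by (intro Bochner_Integration.integral_diff integrable_lborel_translate ig)
  also have "\<dots> = 0"
    using integral_lborel_translate[of g v] borel_measurable_integrable[OF ig] by simp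
  finally show ?thesis .
qed

lemma gderiv_at_zero_of_nonneg:
  fixes h :: "'a::euclidean_space \<Rightarrow> real"
  assumes "\<And>x. 0 \<le> h x" "GDERIV h x :> D" "h x = 0"
  shows "D = 0"
proof -
  have "(h has_derivative (\<lambda>v. inner v D)) (at x)" using assms(2) by (simp add: gderiv_def)
  then have "(\<lambda>v. inner v D) = (\<lambda>v. 0)"
    by (rule has_derivative_local_min) (use assms in \<open>auto intro: always_eventually\<close>)
  then have "inner D D = 0" by metis
  then show ?thesis by simp
qed

section \<open>Centred Gaussian measures\<close>

lemma positive_definite_lower_bound:
  fixes A :: "'a::euclidean_space \<Rightarrow> 'a"
  assumes "linear A" and pos: "\<And>x. x \<noteq> 0 \<Longrightarrow> 0 < x \<bullet> A x"
  obtains \<kappa> where "\<kappa> > 0" "\<And>x. \<kappa> * (norm x)\<^sup>2 \<le> x \<bullet> A x"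
proof -
  interpret linear A by fact
  have cont: "continuous_on (sphere 0 1) (\<lambda>x. x \<bullet> A x)"
    by (intro continuous_intros linear_continuous_on_compose[OF _ \<open>linear A\<close>])
  obtain b :: 'a where "b \<in> Basis" by (meson nonempty_Basis ex_in_conv)
  then have "sphere (0::'a) 1 \<noteq> {}" by (auto intro!: exI[of _ b])
  from continuous_attains_inf[OF compact_sphere this cont]
  obtain p where p: "p \<in> sphere 0 1" and le: "\<And>x. x \<in> sphere 0 1 \<Longrightarrow> p \<bullet> A p \<le> x \<bullet> A x"
    by blast
  show thesis
  proof
    show "0 < p \<bullet> A p" using p by (intro pos) auto
    fix x :: 'a
    show "(p \<bullet> A p) * (norm x)\<^sup>2 \<le> x \<bullet> A x"
    proof (cases "x = 0")
      case False
      have "p \<bullet> A p \<le> (x /\<^sub>R norm x) \<bullet> A (x /\<^sub>R norm x)"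
        using False by (intro le) simp
      also have "\<dots> = (x \<bullet> A x) / (norm x)\<^sup>2"
        by (simp add: scaleR power2_eq_square divide_inverse)
      finally show ?thesis using False by (simp add: field_simps)
    qed (simp add: zero)
  qed
qed

lemma power_le_exp_square:
  fixes s :: real
  assumes "s > 0"
  obtains K where "K > 0" "\<And>t. t \<ge> 0 \<Longrightarrow> t ^ k \<le> K * exp (s * t\<^sup>2)"
proof
  let ?K = "1 + fact k / s ^ k"
  show "?K > 0" using assms by (simp add: add_pos_nonneg)
  fix t :: real assume t: "t \<ge> 0"
  let ?y = "s * t\<^sup>2"
  have y: "?y \<ge> 0" using assms by simp
  have "?y ^ k / fact k \<le> exp ?y"
  proof -
    have "(\<Sum>n\<in>{k}. ?y ^ n /\<^sub>R fact n) \<le> (\<Sum>n. ?y ^ n /\<^sub>R fact n)"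
      by (intro sum_le_suminf summable_exp_generic) (use y in auto)
    then show ?thesis by (simp add: exp_def divide_inverse mult.commute)
  qed
  then have "?y ^ k \<le> fact k * exp ?y" by (simp add: field_simps)
  then have "t ^ (2 * k) \<le> fact k / s ^ k * exp ?y"
    using assms by (simp add: power_mult_distrib power_mult[symmetric] field_simps)
  moreover have "t ^ k \<le> 1 + t ^ (2 * k)"
  proof -
    have "0 \<le> (t ^ k - 1/2)\<^sup>2" by simp
    then have "t ^ k \<le> 1 + t ^ k * t ^ k" by (simp add: power2_eq_square algebra_simps)
    then show ?thesis by (simp add: mult_2 power_add)
  qed
  moreover have "1 \<le> exp ?y" using y by simp
  moreover have "?K * exp ?y = exp ?y + fact k / s ^ k * exp ?y" by (simp add: distrib_right)
  ultimately show "t ^ k \<le> ?K * exp ?y" by linarith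
qed

text \<open>\<open>A\<close> is the inverse of the covariance form \<open>C\<close>; the total mass determines \<open>c\<close>.\<close>

locale centered_gaussian =
  fixes A C :: "'a::euclidean_space \<Rightarrow> 'a" and c :: real
  assumes linear_A: "linear A"
    and symmetric_A: "A x \<bullet> y = x \<bullet> A y"
    and positive_A: "x \<noteq> 0 \<Longrightarrow> 0 < x \<bullet> A x"
    and A_C [simp]: "A (C x) = x" and C_A [simp]: "C (A x) = x"
    and integrable_dens': "integrable lborel (\<lambda>x. c * exp (- (x \<bullet> A x) / 2))"
    and integral_dens': "(\<integral>x. c * exp (- (x \<bullet> A x) / 2) \<partial>lborel) = 1"
begin

definition dens :: "'a \<Rightarrow> real" where "dens x = c * exp (- (x \<bullet> A x) / 2)"

definition gam :: "'a measure" where "gam = density lborel (\<lambda>x. ennreal (dens x))"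

lemmas integrable_dens = integrable_dens'[folded dens_def]
lemmas integral_dens = integral_dens'[folded dens_def]

sublocale A: linear A by (fact linear_A)

lemma c_pos: "c > 0"
proof (rule ccontr)
  assume "\<not> c > 0"
  then have "0 \<le> (\<integral>x. - dens x \<partial>lborel)"
    unfolding dens_def by (intro Bochner_Integration.integral_nonneg) (simp add: mult_nonpos_nonneg)
  then show False using integral_dens by simp
qed

lemma dens_pos [simp]: "dens x > 0"
  using c_pos by (simp add: dens_def)

lemma dens_nonneg [simp]: "dens x \<ge> 0"
  using dens_pos less_imp_le by blast

lemma dens_nonzero [simp]: "dens x \<noteq> 0"
  using c_pos by (simp add: dens_def)

lemma A_bounded_linear: "bounded_linear A"
  using linear_A by (simp add: linear_conv_bounded_linear)

lemma continuous_A [continuous_intros]: "continuous_on S u \<Longrightarrow> continuous_on S (\<lambda>x. A (u x))"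
  by (rule bounded_linear.continuous_on[OF A_bounded_linear])

lemma measurable_A [measurable]: "A \<in> borel_measurable borel"
  by (intro borel_measurable_continuous_onI continuous_intros)

lemma measurable_dens [measurable]: "dens \<in> borel_measurable borel"
  unfolding dens_def[abs_def] by measurable

lemma linear_C: "linear C"
proof (rule linearI)
  show "C (x + y) = C x + C y" for x y
    by (metis A.add A_C C_A)
  show "C (r *\<^sub>R x) = r *\<^sub>R C x" for r x
    by (metis A.scaleR A_C C_A)
qed

sublocale C: linear C by (fact linear_C)

lemma symmetric_C: "C x \<bullet> y = x \<bullet> C y"
  by (metis A_C symmetric_A)

lemma positive_C: "x \<noteq> 0 \<Longrightarrow> 0 < x \<bullet> C x"
  by (metis A.zero A_C inner_commute positive_A)

lemma nonneg_C: "0 \<le> x \<bullet> C x"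
  by (cases "x = 0") (auto simp: C.zero intro: less_imp_le positive_C)

lemma C_bounded_linear: "bounded_linear C"
  using linear_C by (simp add: linear_conv_bounded_linear)

lemma continuous_C [continuous_intros]: "continuous_on S u \<Longrightarrow> continuous_on S (\<lambda>x. C (u x))"
  by (rule bounded_linear.continuous_on[OF C_bounded_linear])

lemma measurable_C [measurable]: "C \<in> borel_measurable borel"
  by (intro borel_measurable_continuous_onI continuous_intros)

lemma space_gam [simp]: "space gam = UNIV" and sets_gam [measurable_cong, simp]: "sets gam = sets borel"
  by (auto simp: gam_def)

sublocale prob_space gam
proof
  have "emeasure gam (space gam) = (\<integral>\<^sup>+x. ennreal (dens x) \<partial>lborel)"
    by (simp add: gam_def emeasure_density)
  also have "\<dots> = ennreal 1"
    using nn_integral_eq_integral[OF integrable_dens] by (simp add: integral_dens)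
  finally show "emeasure gam (space gam) = 1" by simp
qed

lemma integrable_gam:
  fixes u :: "'a \<Rightarrow> 'b::{banach, second_countable_topology}"
  assumes "u \<in> borel_measurable borel"
  shows "integrable gam u \<longleftrightarrow> integrable lborel (\<lambda>x. dens x *\<^sub>R u x)"
  unfolding gam_def using assms by (intro integrable_density) auto

lemma integral_gam:
  fixes u :: "'a \<Rightarrow> 'b::{banach, second_countable_topology}"
  assumes "u \<in> borel_measurable borel"
  shows "(\<integral>x. u x \<partial>gam) = (\<integral>x. dens x *\<^sub>R u x \<partial>lborel)"
  unfolding gam_def using assms by (intro integral_density) auto

lemma nn_integral_gam:
  assumes "u \<in> borel_measurable borel"
  shows "(\<integral>\<^sup>+x. u x \<partial>gam) = (\<integral>\<^sup>+x. ennreal (dens x) * u x \<partial>lborel)"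
  unfolding gam_def using assms by (intro nn_integral_density) auto

lemma gderiv_dens: "GDERIV dens x :> - (dens x *\<^sub>R A x)"
proof -
  have 1: "((\<lambda>x. x \<bullet> A x) has_derivative (\<lambda>h. x \<bullet> A h + h \<bullet> A x)) (at x)"
    by (intro has_derivative_inner has_derivative_ident bounded_linear_imp_has_derivative A_bounded_linear)
  from has_derivative_mult_right[OF has_derivative_exp[OF has_derivative_mult_right[OF 1, of "- 1/2"]], of c]
  have "(dens has_derivative (\<lambda>h. dens x * (- 1/2 * (x \<bullet> A h + h \<bullet> A x)))) (at x)"
    by (simp add: dens_def[abs_def] mult.assoc mult.left_commute mult.commute)
  also have "(\<lambda>h. dens x * (- 1/2 * (x \<bullet> A h + h \<bullet> A x))) = (\<lambda>h. inner h (- (dens x *\<^sub>R A x)))"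
    by (simp add: fun_eq_iff inner_commute[of x] symmetric_A[of _ x])
  finally show ?thesis by (simp add: gderiv_def)
qed

subsection \<open>Moments\<close>

text \<open>Rescaling turns the finite total mass of \<open>dens\<close> into integrability of a Gaussian of any
  width.\<close>

lemma integrable_exp_quadratic:
  assumes "s > 0"
  shows "integrable lborel (\<lambda>x. exp (- s * (x \<bullet> A x)))"
proof -
  let ?r = "sqrt (2 * s)"
  have "(\<integral>\<^sup>+x. ennreal (dens x) \<partial>lborel) < \<infinity>"
    using integrable_dens by (simp add: integrable_iff_bounded)
  also have "(\<integral>\<^sup>+x. ennreal (dens x) \<partial>lborel)
      = ennreal (\<bar>?r\<bar> ^ DIM('a)) * (\<integral>\<^sup>+x. ennreal (dens (0 + ?r *\<^sub>R x)) \<partial>lborel)"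
    using assms by (intro nn_integral_lborel_affine) auto
  finally have "(\<integral>\<^sup>+x. ennreal (dens (?r *\<^sub>R x)) \<partial>lborel) < \<infinity>"
    using assms by (auto simp: ennreal_mult_less_top)
  then have "integrable lborel (\<lambda>x. dens (?r *\<^sub>R x))"
    by (intro integrableI_nonneg) auto
  then have "integrable lborel (\<lambda>x. (1 / c) * dens (?r *\<^sub>R x))"
    by (rule integrable_mult_right)
  moreover have "(1 / c) * dens (?r *\<^sub>R x) = exp (- s * (x \<bullet> A x))" for x
    using c_pos assms by (simp add: dens_def A.scaleR mult.assoc[symmetric])
  ultimately show ?thesis by simp
qed

text \<open>Polynomial factors are absorbed by an arbitrarily small part of the Gaussian exponent.\<close>

lemma norm_power_le_exp_quadratic:
  fixes s :: real
  assumes "s > 0"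
  shows "\<exists>K>0. \<forall>x :: 'a. norm x ^ k \<le> K * exp (s * (x \<bullet> A x))"
proof -
  obtain \<kappa> where \<kappa>: "\<kappa> > 0" "\<And>x. \<kappa> * (norm x)\<^sup>2 \<le> x \<bullet> A x"
    by (rule positive_definite_lower_bound[OF linear_A positive_A]) (auto intro: that)
  obtain K where K: "K > 0" "\<And>t. t \<ge> 0 \<Longrightarrow> t ^ k \<le> K * exp (s * \<kappa> * t\<^sup>2)"
    by (rule power_le_exp_square[OF mult_pos_pos[OF assms \<kappa>(1)]]) (rule that)
  show ?thesis
  proof (intro exI[of _ K] conjI allI)
    fix x :: 'a
    have "norm x ^ k \<le> K * exp (s * \<kappa> * (norm x)\<^sup>2)" using K(2) by simp
    also have "\<dots> \<le> K * exp (s * (x \<bullet> A x))"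
      using K(1) \<kappa>(2)[of x] assms by (simp add: mult.assoc)
    finally show "norm x ^ k \<le> K * exp (s * (x \<bullet> A x))" .
  qed (fact K(1))
qed

lemma integrable_norm_power_dens: "integrable lborel (\<lambda>x. norm x ^ k * dens x)"
proof -
  have "0 < (1/4 :: real)" by simp
  from norm_power_le_exp_quadratic[OF this, of k]
  obtain K where K: "K > 0" and Kx: "\<forall>x. norm x ^ k \<le> K * exp (1/4 * (x \<bullet> A x))"
    by blast
  show ?thesis
  proof (rule Bochner_Integration.integrable_bound)
    show "integrable lborel (\<lambda>x. K * c * exp (- (1/4) * (x \<bullet> A x)))"
      by (intro integrable_mult_right integrable_exp_quadratic) simp
    have "norm x ^ k * dens x \<le> K * c * exp (- (1/4) * (x \<bullet> A x))" for x
    proof -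
      have "norm x ^ k * dens x \<le> (K * exp (1/4 * (x \<bullet> A x))) * dens x"
        by (rule mult_right_mono[OF spec[OF Kx] dens_nonneg])
      also have "\<dots> = K * c * (exp (1/4 * (x \<bullet> A x)) * exp (- (x \<bullet> A x) / 2))"
        unfolding dens_def by (rule mult.assoc[of "K", THEN trans]) (simp only: ac_simps)
      also have "\<dots> = K * c * exp (- (1/4) * (x \<bullet> A x))"
        unfolding exp_add[symmetric] by simp
      finally show ?thesis .
    qed
    then show "AE x in lborel. norm (norm x ^ k * dens x) \<le> norm (K * c * exp (- (1/4) * (x \<bullet> A x)))"
      using K c_pos by (intro AE_I2) (simp add: abs_mult)
  qed measurable
qed

lemma integrable_norm_power: "integrable gam (\<lambda>x. norm x ^ k)"
  using integrable_norm_power_dens[of k] by (simp add: integrable_gam mult.commute)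

lemma integrable_gam_bound:
  fixes u :: "'a \<Rightarrow> 'b::{banach, second_countable_topology}"
  assumes "u \<in> borel_measurable borel" "\<And>x. norm (u x) \<le> K * norm x ^ k"
  shows "integrable gam u"
proof (rule Bochner_Integration.integrable_bound)
  show "integrable gam (\<lambda>x. K * norm x ^ k)"
    by (intro integrable_mult_right integrable_norm_power)
  show "AE x in gam. norm (u x) \<le> norm (K * norm x ^ k)"
    using assms(2) by (auto intro!: AE_I2 order_trans[OF _ abs_ge_self])
qed (use assms in simp)

lemma integrable_second_moment: "integrable gam (\<lambda>x. (x \<bullet> u) * (x \<bullet> v))"
proof (rule integrable_gam_bound)
  show "norm ((x \<bullet> u) * (x \<bullet> v)) \<le> (norm u * norm v) * norm x ^ 2" for x
  proof -
    have "\<bar>x \<bullet> u\<bar> * \<bar>x \<bullet> v\<bar> \<le> (norm x * norm u) * (norm x * norm v)"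
      by (intro mult_mono Cauchy_Schwarz_ineq2) auto
    then show ?thesis by (simp add: abs_mult power2_eq_square ac_simps)
  qed
qed measurable

text \<open>Integration by parts of \<open>(x \<bullet> u) dens x\<close> in the direction \<open>C v\<close>: the drift \<open>A x\<close> of the
  Gaussian turns \<open>C v\<close> back into \<open>v\<close>.\<close>

lemma second_moment: "(\<integral>x. (x \<bullet> u) * (x \<bullet> v) \<partial>gam) = u \<bullet> C v"
proof -
  let ?g' = "\<lambda>x. (x \<bullet> u) *\<^sub>R (- (dens x *\<^sub>R A x)) + dens x *\<^sub>R u"
  have d: "GDERIV (\<lambda>x. (x \<bullet> u) * dens x) x :> ?g' x" for x
  proof (rule GDERIV_mult[OF _ gderiv_dens])
    show "GDERIV (\<lambda>x. x \<bullet> u) x :> u"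
      unfolding gderiv_def by (intro bounded_linear_imp_has_derivative bounded_linear_inner_left)
  qed
  have eq: "?g' x \<bullet> C v = dens x * (u \<bullet> C v) - dens x * ((x \<bullet> u) * (x \<bullet> v))" for x
    by (simp add: inner_add_left inner_diff_left symmetric_A)
  have i2: "integrable lborel (\<lambda>x. dens x * ((x \<bullet> u) * (x \<bullet> v)))"
    using integrable_second_moment[of u v] by (simp add: integrable_gam)
  have i1: "integrable lborel (\<lambda>x. dens x * (u \<bullet> C v))"
    using integrable_dens by simp
  have "integrable gam (\<lambda>x. x \<bullet> u)"
    by (rule integrable_gam_bound[where k=1 and K="norm u"])
       (auto simp: mult.commute Cauchy_Schwarz_ineq2)
  then have "integrable lborel (\<lambda>x. (x \<bullet> u) * dens x)"
    by (simp add: integrable_gam mult.commute)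
  then have "(\<integral>x. ?g' x \<bullet> C v \<partial>lborel) = 0"
    by (rule integral_directional_derivative_eq_0[OF d]) (unfold eq, intro Bochner_Integration.integrable_diff i1 i2)
  then have "(\<integral>x. dens x * ((x \<bullet> u) * (x \<bullet> v)) \<partial>lborel) = u \<bullet> C v"
    unfolding eq using i1 i2 integrable_dens by (simp add: integral_dens)
  then show ?thesis by (subst integral_gam) auto
qed

subsection \<open>Rotation invariance\<close>

text \<open>Writing \<open>y = \<alpha> x + \<beta> z\<close>, the joint density of \<open>x\<close> and \<open>y\<close> is symmetric under exchange of
  \<open>x\<close> and \<open>y\<close>, so that \<open>y\<close> has the same law as \<open>x\<close>.\<close>

lemma nn_integral_rotation:
  assumes ab: "\<alpha>\<^sup>2 + \<beta>\<^sup>2 = 1" and "\<beta> \<noteq> 0" and [measurable]: "u \<in> borel_measurable borel"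
  shows "(\<integral>\<^sup>+x. \<integral>\<^sup>+z. u (\<alpha> *\<^sub>R x + \<beta> *\<^sub>R z) \<partial>gam \<partial>gam) = (\<integral>\<^sup>+y. u y \<partial>gam)"
proof -
  let ?B = "ennreal (\<bar>\<beta>\<bar> ^ DIM('a))"
  let ?k = "\<lambda>x y. dens ((1/\<beta>) *\<^sub>R (y - \<alpha> *\<^sub>R x))"
  have scale: "?B * (\<integral>\<^sup>+z. ennreal (dens z) * w (t + \<beta> *\<^sub>R z) \<partial>lborel)
      = (\<integral>\<^sup>+y. ennreal (dens ((1/\<beta>) *\<^sub>R (y - t))) * w y \<partial>lborel)"
    if [measurable]: "w \<in> borel_measurable borel" for w t
    using \<open>\<beta> \<noteq> 0\<close>
    by (subst (2) nn_integral_lborel_affine[where c=\<beta> and t=t]) simp_all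
  have sym: "dens x * ?k x y = dens y * ?k y x" for x y
  proof -
    have q: "x \<bullet> A x + ((1/\<beta>) *\<^sub>R (y - \<alpha> *\<^sub>R x)) \<bullet> A ((1/\<beta>) *\<^sub>R (y - \<alpha> *\<^sub>R x))
        = ((x \<bullet> A x) * (\<alpha>\<^sup>2 + \<beta>\<^sup>2) + y \<bullet> A y - 2 * \<alpha> * (x \<bullet> A y)) / \<beta>\<^sup>2" for x y
      using \<open>\<beta> \<noteq> 0\<close>
      by (simp add: A.scaleR A.diff inner_diff_left inner_diff_right power2_eq_square field_simps
          inner_commute[of y "A x"] symmetric_A)
    have "x \<bullet> A x + ((1/\<beta>) *\<^sub>R (y - \<alpha> *\<^sub>R x)) \<bullet> A ((1/\<beta>) *\<^sub>R (y - \<alpha> *\<^sub>R x))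
       = y \<bullet> A y + ((1/\<beta>) *\<^sub>R (x - \<alpha> *\<^sub>R y)) \<bullet> A ((1/\<beta>) *\<^sub>R (x - \<alpha> *\<^sub>R y))"
      unfolding q ab by (simp add: inner_commute[of y "A x"] symmetric_A)
    moreover have "dens p * dens r = c * c * exp (- (p \<bullet> A p + r \<bullet> A r) / 2)" for p r
      by (simp add: dens_def exp_add[symmetric] field_simps add_divide_distrib)
    ultimately show ?thesis by metis
  qed
  have "?B * (\<integral>\<^sup>+x. \<integral>\<^sup>+z. u (\<alpha> *\<^sub>R x + \<beta> *\<^sub>R z) \<partial>gam \<partial>gam)
      = (\<integral>\<^sup>+x. ennreal (dens x) * (?B * (\<integral>\<^sup>+z. ennreal (dens z) * u (\<alpha> *\<^sub>R x + \<beta> *\<^sub>R z) \<partial>lborel)) \<partial>lborel)"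
    by (simp add: nn_integral_gam nn_integral_cmult[symmetric] ac_simps)
  also have "\<dots> = (\<integral>\<^sup>+x. ennreal (dens x) * (\<integral>\<^sup>+y. ennreal (?k x y) * u y \<partial>lborel) \<partial>lborel)"
    by (simp add: scale)
  also have "\<dots> = (\<integral>\<^sup>+x. (\<integral>\<^sup>+y. ennreal (dens x * ?k x y) * u y \<partial>lborel) \<partial>lborel)"
    by (simp add: nn_integral_cmult[symmetric] ennreal_mult' mult.assoc)
  also have "\<dots> = (\<integral>\<^sup>+y. (\<integral>\<^sup>+x. ennreal (dens x * ?k x y) * u y \<partial>lborel) \<partial>lborel)"
    by (rule lborel_pair.Fubini') measurable
  also have "\<dots> = (\<integral>\<^sup>+y. (ennreal (dens y) * u y) * (\<integral>\<^sup>+x. ennreal (?k y x) * 1 \<partial>lborel) \<partial>lborel)"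
    by (simp add: sym nn_integral_cmult[symmetric] ennreal_mult' ac_simps)
  also have "\<dots> = (\<integral>\<^sup>+y. (ennreal (dens y) * u y) * ?B \<partial>lborel)"
    using emeasure_space_1 nn_integral_gam[of "\<lambda>_. 1"] by (subst scale[symmetric]) simp_all
  also have "\<dots> = ?B * (\<integral>\<^sup>+y. u y \<partial>gam)"
    by (subst nn_integral_multc) (simp_all add: nn_integral_gam mult.commute[of ?B])
  finally show ?thesis
    using \<open>\<beta> \<noteq> 0\<close> by (simp add: ennreal_mult_cancel_left)
qed

sublocale GG: pair_prob_space gam gam ..

lemma distr_rotation:
  assumes "\<alpha>\<^sup>2 + \<beta>\<^sup>2 = 1" and "\<beta> \<noteq> 0"
  shows "distr (gam \<Otimes>\<^sub>M gam) borel (\<lambda>(x, z). \<alpha> *\<^sub>R x + \<beta> *\<^sub>R z) = gam"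
proof (rule measure_eqI)
  fix X assume "X \<in> sets (distr (gam \<Otimes>\<^sub>M gam) borel (\<lambda>(x, z). \<alpha> *\<^sub>R x + \<beta> *\<^sub>R z))"
  then have [measurable]: "X \<in> sets borel" by simp
  have "emeasure (distr (gam \<Otimes>\<^sub>M gam) borel (\<lambda>(x, z). \<alpha> *\<^sub>R x + \<beta> *\<^sub>R z)) X
     = (\<integral>\<^sup>+y. indicator X y \<partial>distr (gam \<Otimes>\<^sub>M gam) borel (\<lambda>(x, z). \<alpha> *\<^sub>R x + \<beta> *\<^sub>R z))"
    by simp
  also have "\<dots> = (\<integral>\<^sup>+p. indicator X (case p of (x, z) \<Rightarrow> \<alpha> *\<^sub>R x + \<beta> *\<^sub>R z) \<partial>(gam \<Otimes>\<^sub>M gam))"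
    by (rule nn_integral_distr) measurable
  also have "\<dots> = (\<integral>\<^sup>+x. \<integral>\<^sup>+z. indicator X (\<alpha> *\<^sub>R x + \<beta> *\<^sub>R z) \<partial>gam \<partial>gam)"
    by (subst nn_integral_fst[symmetric]) simp_all
  also have "\<dots> = emeasure gam X"
    by (subst nn_integral_rotation[OF assms]) simp_all
  finally show "emeasure (distr (gam \<Otimes>\<^sub>M gam) borel (\<lambda>(x, z). \<alpha> *\<^sub>R x + \<beta> *\<^sub>R z)) X = emeasure gam X" .
qed simp

lemma integral_rotation:
  fixes u :: "'a \<Rightarrow> real"
  assumes "\<alpha>\<^sup>2 + \<beta>\<^sup>2 = 1" and "\<beta> \<noteq> 0" and i: "integrable gam u"
  shows "(\<integral>x. \<integral>z. u (\<alpha> *\<^sub>R x + \<beta> *\<^sub>R z) \<partial>gam \<partial>gam) = (\<integral>y. u y \<partial>gam)"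
    and "AE x in gam. integrable gam (\<lambda>z. u (\<alpha> *\<^sub>R x + \<beta> *\<^sub>R z))"
    and "integrable gam (\<lambda>x. \<integral>z. u (\<alpha> *\<^sub>R x + \<beta> *\<^sub>R z) \<partial>gam)"
proof -
  have [measurable]: "u \<in> borel_measurable borel" using borel_measurable_integrable[OF i] by simp
  have "integrable (gam \<Otimes>\<^sub>M gam) (\<lambda>p. u (case p of (x, z) \<Rightarrow> \<alpha> *\<^sub>R x + \<beta> *\<^sub>R z))"
    by (rule integrable_distr[where M'=borel]) (simp_all add: distr_rotation[OF assms(1,2)] i)
  then have i2: "integrable (gam \<Otimes>\<^sub>M gam) (\<lambda>(x, z). u (\<alpha> *\<^sub>R x + \<beta> *\<^sub>R z))"
    by (simp add: split_def)
  show "AE x in gam. integrable gam (\<lambda>z. u (\<alpha> *\<^sub>R x + \<beta> *\<^sub>R z))"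
    using GG.AE_integrable_fst'[OF i2] by simp
  show "integrable gam (\<lambda>x. \<integral>z. u (\<alpha> *\<^sub>R x + \<beta> *\<^sub>R z) \<partial>gam)"
    using GG.integrable_fst'[OF i2] by simp
  have "(\<integral>y. u y \<partial>distr (gam \<Otimes>\<^sub>M gam) borel (\<lambda>(x, z). \<alpha> *\<^sub>R x + \<beta> *\<^sub>R z))
      = (\<integral>p. u (case p of (x, z) \<Rightarrow> \<alpha> *\<^sub>R x + \<beta> *\<^sub>R z) \<partial>(gam \<Otimes>\<^sub>M gam))"
    by (rule integral_distr) measurable
  then show "(\<integral>x. \<integral>z. u (\<alpha> *\<^sub>R x + \<beta> *\<^sub>R z) \<partial>gam \<partial>gam) = (\<integral>y. u y \<partial>gam)"
    using GG.integral_fst'[OF i2] distr_rotation[OF assms(1,2)] by (simp add: split_def)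
qed

end

section \<open>Entropy and its subadditivity\<close>

text \<open>The mean of \<open>k\<close> is not normalised: slices and truncations of a probability density have other
  means.\<close>

definition Ent :: "'a measure \<Rightarrow> ('a \<Rightarrow> real) \<Rightarrow> real" where
  "Ent M k = (\<integral>x. k x * ln (k x) \<partial>M) - (\<integral>x. k x \<partial>M) * ln (\<integral>x. k x \<partial>M)"

lemma (in prob_space) integrable_bounded:
  fixes u :: "'a \<Rightarrow> real"
  assumes "u \<in> borel_measurable M" "\<And>x. x \<in> space M \<Longrightarrow> \<bar>u x\<bar> \<le> B"
  shows "integrable M u"
  using assms by (intro integrable_const_bound[where B=B]) auto

lemma mult_ln_bounded:
  assumes "0 < (a::real)" "a \<le> u" "u \<le> b"
  shows "\<bar>u * ln u\<bar> \<le> b * (\<bar>ln a\<bar> + \<bar>ln b\<bar>)"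
proof -
  have "ln a \<le> ln u" "ln u \<le> ln b" using assms by auto
  then have "\<bar>ln u\<bar> \<le> \<bar>ln a\<bar> + \<bar>ln b\<bar>" by linarith
  then show ?thesis using assms by (simp add: abs_mult mult_mono)
qed

lemma (in prob_space) integrable_mult_ln:
  fixes k :: "'a \<Rightarrow> real"
  assumes [measurable]: "k \<in> borel_measurable M"
    and "0 < a" "\<And>x. x \<in> space M \<Longrightarrow> a \<le> k x" "\<And>x. x \<in> space M \<Longrightarrow> k x \<le> b"
  shows "integrable M (\<lambda>x. k x * ln (k x))"
  by (rule integrable_bounded[where B="b * (\<bar>ln a\<bar> + \<bar>ln b\<bar>)"])
     (use assms mult_ln_bounded in auto)

lemma (in prob_space) expectation_between:
  fixes k :: "'a \<Rightarrow> real"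
  assumes "k \<in> borel_measurable M"
    and "\<And>x. x \<in> space M \<Longrightarrow> a \<le> k x" "\<And>x. x \<in> space M \<Longrightarrow> k x \<le> b"
  shows "integrable M k" "a \<le> (\<integral>x. k x \<partial>M)" "(\<integral>x. k x \<partial>M) \<le> b"
proof -
  show i: "integrable M k"
    by (rule integrable_bounded[where B="\<bar>a\<bar> + \<bar>b\<bar>"]) (use assms in force)+
  have "(\<integral>x. a \<partial>M) \<le> (\<integral>x. k x \<partial>M)" "(\<integral>x. k x \<partial>M) \<le> (\<integral>x. b \<partial>M)"
    by (intro integral_mono i assms; simp)+
  then show "a \<le> (\<integral>x. k x \<partial>M)" "(\<integral>x. k x \<partial>M) \<le> b" by (simp_all only: lebesgue_integral_const prob_space real_scaleR_def mult_1_left)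
qed

text \<open>The entropy dominates linear functionals of \<open>k\<close>. This follows by integrating \<open>ln (s / k) \<le> s / k - 1\<close> with \<open>s = n exp v\<close>, where \<open>n\<close> is the mean of \<open>k\<close>.\<close>

lemma (in prob_space) Ent_variational:
  assumes [measurable]: "k \<in> borel_measurable M" "v \<in> borel_measurable M"
    and a: "0 < a" "\<And>x. x \<in> space M \<Longrightarrow> a \<le> k x" "\<And>x. x \<in> space M \<Longrightarrow> k x \<le> b"
    and v: "\<And>x. x \<in> space M \<Longrightarrow> \<bar>v x\<bar> \<le> B" and e: "(\<integral>x. exp (v x) \<partial>M) = 1"
  shows "(\<integral>x. k x * v x \<partial>M) \<le> Ent M k"
proof -
  note k = expectation_between[OF assms(1) a(2,3)]
  note kl = integrable_mult_ln[OF assms(1) a]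
  define n where "n = (\<integral>x. k x \<partial>M)"
  have n: "n > 0" using k(2) a(1) by (simp add: n_def)
  have kv: "integrable M (\<lambda>x. k x * v x)"
  proof (rule integrable_bounded)
    fix x assume x: "x \<in> space M"
    have "\<bar>k x\<bar> * \<bar>v x\<bar> \<le> b * B"
      using a(1) a(2)[OF x] a(3)[OF x] v[OF x] by (intro mult_mono) auto
    then show "\<bar>k x * v x\<bar> \<le> b * B" by (simp add: abs_mult)
  qed simp
  have ev: "integrable M (\<lambda>x. exp (v x))"
    by (rule integrable_bounded[where B="exp B"]) (use v in \<open>auto simp: abs_le_iff\<close>)
  have "(\<integral>x. k x * ln n + k x * v x \<partial>M) \<le> (\<integral>x. k x * ln (k x) + n * exp (v x) - k x \<partial>M)"
  proof (rule integral_mono)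
    fix x assume x: "x \<in> space M"
    have p: "k x > 0" using a(1) a(2)[OF x] by simp
    have "ln (n * exp (v x) / k x) \<le> n * exp (v x) / k x - 1"
      using n p by (intro ln_le_minus_one) simp
    then have "ln n + v x - ln (k x) \<le> n * exp (v x) / k x - 1"
      using n p by (simp add: ln_div ln_mult)
    then have "k x * (ln n + v x - ln (k x)) \<le> k x * (n * exp (v x) / k x - 1)"
      using p by (intro mult_left_mono) auto
    then show "k x * ln n + k x * v x \<le> k x * ln (k x) + n * exp (v x) - k x"
      using p by (simp add: algebra_simps)
  qed (use k kv kl ev in auto)
  then show ?thesis
    using k kv kl ev by (simp add: Ent_def n_def[symmetric] e)
qed

lemma (in pair_prob_space) integrable_Ent_slice:
  assumes [measurable]: "k \<in> borel_measurable (M1 \<Otimes>\<^sub>M M2)"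
    and a: "0 < a" "\<And>p. a \<le> k p" "\<And>p. k p \<le> b"
  shows "integrable M1 (\<lambda>x. Ent M2 (\<lambda>y. k (x, y)))"
proof -
  have "integrable (M1 \<Otimes>\<^sub>M M2) (\<lambda>p. k p * ln (k p))"
    using P.integrable_mult_ln[of k a b] a by auto
  then have "integrable (M1 \<Otimes>\<^sub>M M2) (\<lambda>(x, y). k (x, y) * ln (k (x, y)))"
    by (simp add: split_def)
  from integrable_fst[OF this]
  have "integrable M1 (\<lambda>x. \<integral>y. k (x, y) * ln (k (x, y)) \<partial>M2)" .
  moreover have "integrable M1 (\<lambda>x. (\<integral>y. k (x, y) \<partial>M2) * ln (\<integral>y. k (x, y) \<partial>M2))"
  proof (rule M1.integrable_mult_ln[where a=a and b=b])
    fix x assume "x \<in> space M1"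
    then show "a \<le> (\<integral>y. k (x, y) \<partial>M2)" "(\<integral>y. k (x, y) \<partial>M2) \<le> b"
      using a by (auto intro!: M2.expectation_between)
  qed (use a in \<open>simp_all\<close>)
  ultimately show ?thesis
    unfolding Ent_def by (rule Bochner_Integration.integrable_diff)
qed

text \<open>The chain rule splits the entropy into the mean entropy in \<open>x\<close> and the entropy in \<open>y\<close> of the
  partial mean \<open>m\<close>; the latter is tested against the function \<open>ln (m / mean of m)\<close>, which by the
  variational inequality bounds the entropy in \<open>y\<close> of every slice as well.\<close>

lemma (in pair_prob_space) Ent_tensorization:
  assumes [measurable]: "k \<in> borel_measurable (M1 \<Otimes>\<^sub>M M2)"
    and a: "0 < a" "\<And>p. a \<le> k p" "\<And>p. k p \<le> b"
  shows "Ent (M1 \<Otimes>\<^sub>M M2) k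
      \<le> (\<integral>y. Ent M1 (\<lambda>x. k (x, y)) \<partial>M2) + (\<integral>x. Ent M2 (\<lambda>y. k (x, y)) \<partial>M1)"
proof -
  define m where "m y = (\<integral>x. k (x, y) \<partial>M1)" for y
  have [measurable]: "m \<in> borel_measurable M2" unfolding m_def[abs_def] by measurable
  have m: "a \<le> m y" "m y \<le> b" if "y \<in> space M2" for y
    unfolding m_def using that a by (auto intro!: M1.expectation_between)
  note mi = M2.expectation_between[of m a b, simplified, OF m]
  define mm where "mm = (\<integral>y. m y \<partial>M2)"
  have mm: "mm > 0" using mi a(1) by (simp add: mm_def)
  have ik: "integrable (M1 \<Otimes>\<^sub>M M2) k" and ikl: "integrable (M1 \<Otimes>\<^sub>M M2) (\<lambda>p. k p * ln (k p))"
    using P.expectation_between(1)[of k a b] P.integrable_mult_ln[of k a b] a by auto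
  have ik': "integrable (M1 \<Otimes>\<^sub>M M2) (\<lambda>(x, y). k (x, y))" using ik by simp
  have ikl': "integrable (M1 \<Otimes>\<^sub>M M2) (\<lambda>(x, y). k (x, y) * ln (k (x, y)))"
    using ikl by (simp add: split_def)
  have e1: "(\<integral>p. k p \<partial>(M1 \<Otimes>\<^sub>M M2)) = mm"
    using integral_snd[OF ik'] by (simp add: mm_def m_def)
  have e2: "(\<integral>p. k p * ln (k p) \<partial>(M1 \<Otimes>\<^sub>M M2)) = (\<integral>y. \<integral>x. k (x, y) * ln (k (x, y)) \<partial>M1 \<partial>M2)"
    using integral_snd[OF ikl'] by (simp add: split_def)
  have iy: "integrable M2 (\<lambda>y. \<integral>x. k (x, y) * ln (k (x, y)) \<partial>M1)"
    using integrable_snd[OF ikl'] by simp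
  have iml: "integrable M2 (\<lambda>y. m y * ln (m y))"
    using M2.integrable_mult_ln[of m a b] m a(1) by simp
  have t1: "(\<integral>y. Ent M1 (\<lambda>x. k (x, y)) \<partial>M2)
      = (\<integral>y. \<integral>x. k (x, y) * ln (k (x, y)) \<partial>M1 \<partial>M2) - (\<integral>y. m y * ln (m y) \<partial>M2)"
    unfolding Ent_def m_def[symmetric] using iy iml by simp
  define v where "v y = ln (m y / mm)" for y
  have [measurable]: "v \<in> borel_measurable M2" unfolding v_def[abs_def] by measurable
  have mp: "m y > 0" if "y \<in> space M2" for y using m[OF that] a(1) by simp
  have vb: "\<bar>v y\<bar> \<le> \<bar>ln a\<bar> + \<bar>ln b\<bar> + \<bar>ln mm\<bar>" if "y \<in> space M2" for y
  proof -
    have "ln a \<le> ln (m y)" "ln (m y) \<le> ln b" using m[OF that] mp[OF that] a(1) by auto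
    then show ?thesis unfolding v_def using mm mp[OF that] by (simp add: ln_div)
  qed
  have ev: "(\<integral>y. exp (v y) \<partial>M2) = 1"
  proof -
    have "(\<integral>y. exp (v y) \<partial>M2) = (\<integral>y. m y / mm \<partial>M2)"
      by (rule Bochner_Integration.integral_cong) (use mm mp in \<open>auto simp: v_def\<close>)
    then show ?thesis using mm by (simp add: mm_def[symmetric])
  qed
  have ikv: "integrable (M1 \<Otimes>\<^sub>M M2) (\<lambda>(x, y). k (x, y) * v y)"
  proof (rule P.integrable_bounded)
    fix p assume p: "p \<in> space (M1 \<Otimes>\<^sub>M M2)"
    then have "\<bar>k p\<bar> * \<bar>v (snd p)\<bar> \<le> b * (\<bar>ln a\<bar> + \<bar>ln b\<bar> + \<bar>ln mm\<bar>)"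
      using a(1) a(2)[of p] a(3)[of p]
      by (intro mult_mono vb) (auto simp: space_pair_measure)
    then show "\<bar>case p of (x, y) \<Rightarrow> k (x, y) * v y\<bar> \<le> b * (\<bar>ln a\<bar> + \<bar>ln b\<bar> + \<bar>ln mm\<bar>)"
      by (simp add: split_def abs_mult)
  qed measurable
  have "(\<integral>y. m y * ln (m y) \<partial>M2) - mm * ln mm = (\<integral>y. m y * v y \<partial>M2)"
  proof -
    have "(\<integral>y. m y * v y \<partial>M2) = (\<integral>y. m y * ln (m y) - m y * ln mm \<partial>M2)"
      by (rule Bochner_Integration.integral_cong)
         (use mm mp in \<open>auto simp: v_def ln_div right_diff_distrib\<close>)
    then show ?thesis using iml mi(1) by (simp add: mm_def[symmetric])
  qed
  also have "\<dots> = (\<integral>y. \<integral>x. k (x, y) * v y \<partial>M1 \<partial>M2)"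
    by (simp add: m_def)
  also have "\<dots> = (\<integral>x. \<integral>y. k (x, y) * v y \<partial>M2 \<partial>M1)"
    by (rule Fubini_integral) (rule ikv)
  also have "\<dots> \<le> (\<integral>x. Ent M2 (\<lambda>y. k (x, y)) \<partial>M1)"
  proof (rule integral_mono)
    show "integrable M1 (\<lambda>x. \<integral>y. k (x, y) * v y \<partial>M2)"
      using integrable_fst[OF ikv] .
    show "integrable M1 (\<lambda>x. Ent M2 (\<lambda>y. k (x, y)))"
      by (rule integrable_Ent_slice[OF assms])
    fix x assume [measurable]: "x \<in> space M1"
    show "(\<integral>y. k (x, y) * v y \<partial>M2) \<le> Ent M2 (\<lambda>y. k (x, y))"
      by (rule M2.Ent_variational[where a=a and b=b, OF _ _ _ _ _ vb ev]) (use a in auto)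
  qed
  finally show ?thesis
    unfolding t1 by (subst Ent_def) (simp add: e1 e2)
qed

section \<open>The logarithmic Sobolev inequality for regular functions\<close>

lemma ln_one_plus_le_cubic:
  fixes w :: real
  assumes "-1 < w"
  shows "ln (1 + w) \<le> w - w\<^sup>2 / 2 + w ^ 3 / 3"
proof -
  define f where "f w = w - w\<^sup>2 / 2 + w ^ 3 / 3 - ln (1 + w)" for w :: real
  have d: "(f has_real_derivative (t ^ 3 / (1 + t))) (at t)" if "-1 < t" for t
    unfolding f_def[abs_def]
    by (rule derivative_eq_intros refl | use that in \<open>simp; fail\<close>)+
       (use that in \<open>simp add: field_simps power2_eq_square power3_eq_cube\<close>)
  have "f 0 \<le> f w"
  proof (cases "0 \<le> w")
    case True
    then show ?thesis
      by (intro DERIV_nonneg_imp_nondecreasing[of 0 w f]) (auto intro!: exI d divide_nonneg_nonneg)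
  next
    case False
    then show ?thesis
      by (intro DERIV_nonpos_imp_nonincreasing[of w 0 f])
         (use assms in \<open>auto intro!: exI d divide_nonpos_nonneg simp: power3_eq_cube mult_nonneg_nonpos\<close>)
  qed
  then show ?thesis by (simp add: f_def)
qed

text \<open>The right-hand side is minimal when \<open>m\<close> is the mean of \<open>k\<close>, where it equals the entropy. Being
  free to take another \<open>m\<close> makes the integrand accessible pointwise.\<close>

lemma (in prob_space) Ent_le:
  assumes [measurable]: "k \<in> borel_measurable M"
    and a: "0 < a" "\<And>x. x \<in> space M \<Longrightarrow> a \<le> k x" "\<And>x. x \<in> space M \<Longrightarrow> k x \<le> b"
    and m: "0 < m"
  shows "integrable M (\<lambda>x. k x * ln (k x / m) - k x + m)"
    and "Ent M k \<le> (\<integral>x. k x * ln (k x / m) - k x + m \<partial>M)"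
proof -
  note k = expectation_between[OF assms(1) a(2,3)]
  note kl = integrable_mult_ln[OF assms(1) a]
  define n where "n = (\<integral>x. k x \<partial>M)"
  have n: "n > 0" using k(2) a(1) by (simp add: n_def)
  have eq: "k x * ln (k x / m) - k x + m = k x * ln (k x) - k x * (ln m + 1) + m"
    if "x \<in> space M" for x
    using a(1) a(2)[OF that] m by (simp add: ln_div algebra_simps)
  have i: "integrable M (\<lambda>x. k x * ln (k x) - k x * (ln m + 1) + m)"
    using k(1) kl by simp
  then show "integrable M (\<lambda>x. k x * ln (k x / m) - k x + m)"
    by (subst Bochner_Integration.integrable_cong[OF refl eq])
  have "(\<integral>x. k x * ln (k x / m) - k x + m \<partial>M) = (\<integral>x. k x * ln (k x) - k x * (ln m + 1) + m \<partial>M)"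
    by (rule Bochner_Integration.integral_cong[OF refl eq])
  also have "\<dots> = (\<integral>x. k x * ln (k x) \<partial>M) - n * (ln m + 1) + m"
    using k(1) kl by (simp add: n_def prob_space)
  finally have 1: "(\<integral>x. k x * ln (k x / m) - k x + m \<partial>M)
      = (\<integral>x. k x * ln (k x) \<partial>M) - n * (ln m + 1) + m" .
  have "ln (m / n) \<le> m / n - 1" using n m by (intro ln_le_minus_one) simp
  then have "n * ln (m / n) \<le> n * (m / n - 1)" using n by (intro mult_left_mono) auto
  then have "n * (ln m - ln n) \<le> m - n" using n m by (simp add: ln_div algebra_simps)
  then show "Ent M k \<le> (\<integral>x. k x * ln (k x / m) - k x + m \<partial>M)"
    unfolding 1 Ent_def n_def[symmetric] by (simp add: algebra_simps)
qed

text \<open>By Taylor expansion, \<open>u ln (u/m) - u + m\<close> is at most \<open>(u - m)\<^sup>2 / (2m)\<close> up to terms of third order.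
  Here \<open>m\<close> and \<open>u\<close> stand for the values of a function at \<open>0\<close> and \<open>r z\<close>, with \<open>s = \<bar>z\<bar>\<close>, and \<open>r p\<close> for the
  linear part of the increment. The coefficient of \<open>r\<^sup>3\<close> depends on \<open>a\<close>, \<open>L\<close> and \<open>s\<close> only.\<close>

lemma local_entropy_bound:
  fixes u m r p s a L :: real
  assumes a: "0 < a" "a \<le> m" and u: "0 < u" and r: "0 \<le> r" "r \<le> 1" and L: "0 \<le> L" and s: "0 \<le> s"
    and p: "\<bar>p\<bar> \<le> L * s" and d1: "\<bar>u - m\<bar> \<le> L * r * s" and d2: "\<bar>u - m - r * p\<bar> \<le> L * r\<^sup>2 * s\<^sup>2"
  shows "u * ln (u / m) - u + m
    \<le> r\<^sup>2 * (p\<^sup>2 / m) / 2 + r ^ 3 * ((L\<^sup>2 / a + L ^ 3 / a\<^sup>2 + L ^ 4 / a ^ 3) * (s ^ 3 + s ^ 4))"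
proof -
  have m: "m > 0" using a by simp
  define w where "w = (u - m) / m"
  have w1: "1 + w = u / m" using m by (simp add: w_def field_simps)
  have "-1 < w" using u m by (simp add: w_def field_simps)
  then have "u / m * ln (u / m) \<le> (1 + w) * (w - w\<^sup>2 / 2 + w ^ 3 / 3)"
    unfolding w1[symmetric] by (intro mult_left_mono ln_one_plus_le_cubic) auto
  also have "\<dots> = w + w\<^sup>2 / 2 - w ^ 3 / 6 + w ^ 4 / 3"
    by (simp add: field_simps power2_eq_square power3_eq_cube power4_eq_xxxx)
  finally have "m * (u / m * ln (u / m)) \<le> m * (w + w\<^sup>2 / 2 - w ^ 3 / 6 + w ^ 4 / 3)"
    using m by (intro mult_left_mono) auto
  then have 1: "u * ln (u / m) - u + m \<le> m * (w\<^sup>2 / 2 - w ^ 3 / 6 + w ^ 4 / 3)"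
  proof -
    have "m * w = u - m" using m by (simp add: w_def)
    then have "m * (w + w\<^sup>2 / 2 - w ^ 3 / 6 + w ^ 4 / 3) = (u - m) + m * (w\<^sup>2 / 2 - w ^ 3 / 6 + w ^ 4 / 3)"
      by (simp add: algebra_simps)
    moreover have "m * (u / m * ln (u / m)) = u * ln (u / m)" using m by simp
    ultimately show ?thesis
      using \<open>m * (u / m * ln (u / m)) \<le> m * (w + w\<^sup>2 / 2 - w ^ 3 / 6 + w ^ 4 / 3)\<close> by linarith
  qed
  have "(u - m)\<^sup>2 - r\<^sup>2 * p\<^sup>2 = (u - m - r * p) * (u - m + r * p)"
    by (simp add: power2_eq_square algebra_simps)
  also have "\<dots> \<le> \<bar>u - m - r * p\<bar> * \<bar>u - m + r * p\<bar>"
    by (metis abs_ge_self abs_mult)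
  also have "\<dots> \<le> (L * r\<^sup>2 * s\<^sup>2) * (2 * (L * r * s))"
  proof (rule mult_mono[OF d2])
    have "r * \<bar>p\<bar> \<le> r * (L * s)" using p r by (intro mult_left_mono)
    then show "\<bar>u - m + r * p\<bar> \<le> 2 * (L * r * s)"
      using d1 abs_triangle_ineq[of "u - m" "r * p"] r by (simp add: abs_mult ac_simps)
  qed (use L r s in auto)
  finally have "(u - m)\<^sup>2 \<le> r\<^sup>2 * p\<^sup>2 + 2 * (L\<^sup>2 * r ^ 3 * s ^ 3)"
    by (simp add: power2_eq_square power3_eq_cube ac_simps)
  then have "(u - m)\<^sup>2 / (2 * m) \<le> (r\<^sup>2 * p\<^sup>2 + 2 * (L\<^sup>2 * r ^ 3 * s ^ 3)) / (2 * m)"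
    using m by (intro divide_right_mono) auto
  also have "\<dots> = r\<^sup>2 * (p\<^sup>2 / m) / 2 + (L\<^sup>2 * r ^ 3 * s ^ 3) / m"
    using m by (simp add: field_simps)
  also have "(L\<^sup>2 * r ^ 3 * s ^ 3) / m \<le> (L\<^sup>2 * r ^ 3 * s ^ 3) / a"
    using a m L r s by (intro divide_left_mono) auto
  finally have 20: "(u - m)\<^sup>2 / (2 * m) \<le> r\<^sup>2 * (p\<^sup>2 / m) / 2 + (L\<^sup>2 * r ^ 3 * s ^ 3) / a"
    by simp
  have 2: "m * (w\<^sup>2 / 2) \<le> r\<^sup>2 * (p\<^sup>2 / m) / 2 + (L\<^sup>2 * r ^ 3 * s ^ 3) / a"
  proof -
    have "m * (w\<^sup>2 / 2) = (u - m)\<^sup>2 / (2 * m)"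
      using m by (simp add: w_def power_divide power2_eq_square)
    then show ?thesis using 20 by simp
  qed
  have b: "\<bar>w\<bar> \<le> L * r * s / m" using d1 m by (simp add: w_def divide_right_mono)
  have "- (w ^ 3 / 6) \<le> \<bar>w\<bar> ^ 3"
    using abs_ge_minus_self[of "w ^ 3"] abs_ge_zero[of "w ^ 3"] unfolding power_abs by linarith
  then have "m * (- (w ^ 3 / 6)) \<le> m * \<bar>w\<bar> ^ 3"
    using m by (intro mult_left_mono) auto
  also have "\<dots> \<le> m * (L * r * s / m) ^ 3"
    using m b by (intro mult_left_mono power_mono) auto
  also have "\<dots> = (L * r * s) ^ 3 / m\<^sup>2"
    using m by (simp add: power_divide power2_eq_square power3_eq_cube)
  also have "\<dots> \<le> (L * r * s) ^ 3 / a\<^sup>2"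
    using a m L r s by (intro divide_left_mono power_mono) auto
  finally have 3: "m * (- (w ^ 3 / 6)) \<le> (L * r * s) ^ 3 / a\<^sup>2" .
  have "m * (w ^ 4 / 3) \<le> m * \<bar>w\<bar> ^ 4"
    using m by (simp add: power_abs)
  also have "\<dots> \<le> m * (L * r * s / m) ^ 4"
    using m b by (intro mult_left_mono power_mono) auto
  also have "\<dots> = (L * r * s) ^ 4 / m ^ 3"
    using m by (simp add: power_divide power4_eq_xxxx power3_eq_cube)
  also have "\<dots> \<le> (L * r * s) ^ 4 / a ^ 3"
    using a m L r s by (intro divide_left_mono power_mono) auto
  also have "\<dots> \<le> (L ^ 4 * r ^ 3 * s ^ 4) / a ^ 3"
  proof -
    have "r ^ 4 \<le> r ^ 3" using r by (intro power_decreasing) auto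
    then have "L ^ 4 * r ^ 4 * s ^ 4 \<le> L ^ 4 * r ^ 3 * s ^ 4"
      using L s by (intro mult_right_mono mult_left_mono) auto
    then show ?thesis using a by (intro divide_right_mono) (simp_all add: power_mult_distrib)
  qed
  finally have 4: "m * (w ^ 4 / 3) \<le> (L ^ 4 * r ^ 3 * s ^ 4) / a ^ 3" .
  let ?A = "L\<^sup>2 / a" and ?B = "L ^ 3 / a\<^sup>2" and ?D = "L ^ 4 / a ^ 3"
  have nn: "0 \<le> ?A" "0 \<le> ?B" "0 \<le> ?D" "0 \<le> s ^ 3" "0 \<le> s ^ 4" using a L s by auto
  have "A * x + B * x + D * y \<le> (A + B + D) * (x + y)"
    if "0 \<le> A" "0 \<le> B" "0 \<le> D" "0 \<le> x" "0 \<le> y" for A B D x y :: real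
    using mult_nonneg_nonneg[OF that(1,5)] mult_nonneg_nonneg[OF that(2,5)]
      mult_nonneg_nonneg[OF that(3,4)] by (simp add: algebra_simps)
  from this[OF nn]
  have "?A * s ^ 3 + ?B * s ^ 3 + ?D * s ^ 4 \<le> (?A + ?B + ?D) * (s ^ 3 + s ^ 4)" .
  then have "r ^ 3 * (?A * s ^ 3 + ?B * s ^ 3 + ?D * s ^ 4) \<le> r ^ 3 * ((?A + ?B + ?D) * (s ^ 3 + s ^ 4))"
    using r by (intro mult_left_mono) auto
  moreover have "r ^ 3 * (?A * s ^ 3 + ?B * s ^ 3 + ?D * s ^ 4)
     = (L\<^sup>2 * r ^ 3 * s ^ 3) / a + (L * r * s) ^ 3 / a\<^sup>2 + (L ^ 4 * r ^ 3 * s ^ 4) / a ^ 3"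
    by (simp add: power_mult_distrib algebra_simps)
  moreover have "m * (w\<^sup>2 / 2 - w ^ 3 / 6 + w ^ 4 / 3) = m * (w\<^sup>2 / 2) + m * (- (w ^ 3 / 6)) + m * (w ^ 4 / 3)"
    by (simp add: algebra_simps)
  ultimately show ?thesis using 1 2 3 4 by linarith
qed

text \<open>The bounds are explicit because the error in the small-scale estimate must be uniform over a class
  of functions that is closed under translation.\<close>

definition regular :: "real \<Rightarrow> real \<Rightarrow> real \<Rightarrow> ('a::euclidean_space \<Rightarrow> real) \<Rightarrow> ('a \<Rightarrow> 'a) \<Rightarrow> bool" where
  "regular a b L h g \<longleftrightarrow> 0 < a \<and> 0 \<le> L \<and> (\<forall>x. a \<le> h x \<and> h x \<le> b) \<and> (\<forall>x. GDERIV h x :> g x) \<and>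
     (\<forall>x. norm (g x) \<le> L) \<and> (\<forall>x y. norm (g x - g y) \<le> L * norm (x - y))"

lemma gderiv_mean_value:
  assumes "\<And>x. GDERIV h x :> g x"
  obtains \<xi> where "0 < \<xi>" "\<xi> < 1" "h (x + z) - h x = g (x + \<xi> *\<^sub>R z) \<bullet> z"
proof -
  have "\<exists>\<xi>>0. \<xi> < 1 \<and> h (x + 1 *\<^sub>R z) - h (x + 0 *\<^sub>R z) = (1 - 0) * (g (x + \<xi> *\<^sub>R z) \<bullet> z)"
    by (rule MVT2) (auto simp: has_real_derivative_iff_has_vector_derivative
        intro!: gderiv_has_vector_derivative_line assms)
  then show thesis using that by auto
qed

lemma regular_taylor:
  assumes "regular a b L h g"
  shows "\<bar>h (x + z) - h x\<bar> \<le> L * norm z"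
    and "\<bar>h (x + z) - h x - g x \<bullet> z\<bar> \<le> L * (norm z)\<^sup>2"
proof -
  have L: "0 \<le> L" and d: "\<And>x. GDERIV h x :> g x" and g: "\<And>x. norm (g x) \<le> L"
    and gl: "\<And>x y. norm (g x - g y) \<le> L * norm (x - y)"
    using assms by (auto simp: regular_def)
  obtain \<xi> where \<xi>: "0 < \<xi>" "\<xi> < 1" and eq: "h (x + z) - h x = g (x + \<xi> *\<^sub>R z) \<bullet> z"
    by (rule gderiv_mean_value[OF d, where x=x and z=z]) (rule that)
  have "\<bar>g (x + \<xi> *\<^sub>R z) \<bullet> z\<bar> \<le> norm (g (x + \<xi> *\<^sub>R z)) * norm z" by (rule Cauchy_Schwarz_ineq2)
  also have "\<dots> \<le> L * norm z" by (intro mult_right_mono g) simp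
  finally show "\<bar>h (x + z) - h x\<bar> \<le> L * norm z" by (simp add: eq)
  have "\<bar>(g (x + \<xi> *\<^sub>R z) - g x) \<bullet> z\<bar> \<le> norm (g (x + \<xi> *\<^sub>R z) - g x) * norm z"
    by (rule Cauchy_Schwarz_ineq2)
  also have "\<dots> \<le> (L * norm z) * norm z"
  proof (rule mult_right_mono)
    have "norm (g (x + \<xi> *\<^sub>R z) - g x) \<le> L * norm (\<xi> *\<^sub>R z)" using gl[of "x + \<xi> *\<^sub>R z" x] by simp
    also have "\<dots> \<le> L * norm z" using \<xi> L by (intro mult_left_mono) (auto simp: mult_left_le_one_le)
    finally show "norm (g (x + \<xi> *\<^sub>R z) - g x) \<le> L * norm z" .
  qed simp
  finally show "\<bar>h (x + z) - h x - g x \<bullet> z\<bar> \<le> L * (norm z)\<^sup>2"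
    by (simp add: eq inner_diff_left power2_eq_square)
qed

lemma regular_shift:
  assumes "regular a b L h g"
  shows "regular a b L (\<lambda>x. h (y + x)) (\<lambda>x. g (y + x))"
proof -
  have "GDERIV (\<lambda>x. h (y + x)) x :> g (y + x)" for x
  proof -
    have "((\<lambda>x. y + x) has_derivative (\<lambda>h. h)) (at x)" by (auto intro!: derivative_eq_intros)
    from has_derivative_compose[OF this] show ?thesis
      using assms by (auto simp: regular_def gderiv_def)
  qed
  then show ?thesis
    using assms unfolding regular_def by (simp add: add_diff_cancel_left)
      (metis add_diff_cancel_left)
qed

context centered_gaussian begin

text \<open>Where \<open>h x = 0\<close> for a nonnegative differentiable \<open>h\<close> the gradient vanishes, so the quotient by
  zero has the value \<open>0\<close> that is wanted there.\<close>

definition fisher :: "('a \<Rightarrow> real) \<Rightarrow> ('a \<Rightarrow> 'a) \<Rightarrow> 'a \<Rightarrow> real" where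
  "fisher h g x = (g x \<bullet> C (g x)) / h x"

lemma regular_measurable:
  assumes "regular a b L h g"
  shows "h \<in> borel_measurable borel" "g \<in> borel_measurable borel"
proof -
  have d: "\<And>x. GDERIV h x :> g x" using assms by (auto simp: regular_def)
  show "h \<in> borel_measurable borel"
    by (intro borel_measurable_continuous_onI gderiv_continuous_on[OF d])
  show "g \<in> borel_measurable borel" by (rule gderiv_measurable[OF d])
qed

lemma fisher_measurable:
  assumes [measurable]: "h \<in> borel_measurable borel" "g \<in> borel_measurable borel"
  shows "fisher h g \<in> borel_measurable borel"
  unfolding fisher_def[abs_def] by measurable

lemma norm_C_bound: obtains B where "B > 0" "\<And>v. norm (C v) \<le> B * norm v"
proof -
  obtain B where "B > 0" "\<And>v. norm (C v) \<le> norm v * B"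
    using bounded_linear.pos_bounded[OF C_bounded_linear] by blast
  then show thesis using that[of B] by (simp add: mult.commute)
qed

lemma fisher_bounds:
  assumes n: "regular a b L h g" and B: "\<And>v. norm (C v) \<le> B * norm v" "0 < B"
  shows "0 \<le> fisher h g x" "fisher h g x \<le> B * L\<^sup>2 / a"
    and "fisher h g x \<le> fisher h g y + (2 * B * L\<^sup>2 / a + B * L ^ 3 / a\<^sup>2) * norm (x - y)"
proof -
  have L: "0 \<le> L" and a: "0 < a" and h: "\<And>x. a \<le> h x" and g: "\<And>x. norm (g x) \<le> L"
    and gl: "\<And>x y. norm (g x - g y) \<le> L * norm (x - y)"
    using n by (auto simp: regular_def)
  have hp: "h x > 0" for x using a h[of x] by simp
  have CS: "\<bar>u \<bullet> C v\<bar> \<le> norm u * (B * norm v)" for u v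
    using Cauchy_Schwarz_ineq2[of u "C v"] B(1)[of v]
    by (meson mult_left_mono norm_ge_zero order_trans)
  let ?N = "\<lambda>x. g x \<bullet> C (g x)"
  have N: "0 \<le> ?N x" "?N x \<le> B * L\<^sup>2" for x
  proof -
    show "0 \<le> ?N x" by (rule nonneg_C)
    have "?N x \<le> norm (g x) * (B * norm (g x))" using CS[of "g x" "g x"] by linarith
    also have "\<dots> \<le> L * (B * L)" using g[of x] B L by (intro mult_mono) auto
    finally show "?N x \<le> B * L\<^sup>2" by (simp add: power2_eq_square ac_simps)
  qed
  show "0 \<le> fisher h g x" using N(1) hp[of x] by (simp add: fisher_def)
  show "fisher h g x \<le> B * L\<^sup>2 / a"
    unfolding fisher_def using N[of x] a h[of x] by (intro frac_le) auto
  have "?N x - ?N y = (g x - g y) \<bullet> C (g x) + g y \<bullet> C (g x - g y)"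
    by (simp add: C.diff inner_diff_left inner_diff_right)
  also have "\<dots> \<le> norm (g x - g y) * (B * norm (g x)) + norm (g y) * (B * norm (g x - g y))"
    using CS[of "g x - g y" "g x"] CS[of "g y" "g x - g y"] by linarith
  also have "\<dots> \<le> (L * norm (x - y)) * (B * L) + L * (B * (L * norm (x - y)))"
    using g[of x] g[of y] gl[of x y] B L by (intro add_mono mult_mono) auto
  finally have Nd: "?N x \<le> ?N y + 2 * (B * L\<^sup>2 * norm (x - y))"
    by (simp add: power2_eq_square ac_simps)
  have hd: "h y - h x \<le> L * norm (x - y)"
    using regular_taylor(1)[OF n, of x "y - x"] by (simp add: norm_minus_commute abs_le_iff)
  have "fisher h g x \<le> (?N y + 2 * (B * L\<^sup>2 * norm (x - y))) / h x"
    unfolding fisher_def using hp[of x] Nd by (intro divide_right_mono) auto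
  also have "\<dots> = ?N y / h y + (?N y / h y) * (h y - h x) / h x + 2 * (B * L\<^sup>2 * norm (x - y)) / h x"
    using hp[of x] hp[of y] by (simp add: field_simps)
  also have "(?N y / h y) * (h y - h x) / h x \<le> (B * L\<^sup>2 / a) * (L * norm (x - y)) / a"
  proof -
    have "(?N y / h y) * (h y - h x) \<le> (?N y / h y) * (L * norm (x - y))"
      using hd N(1)[of y] hp[of y] by (intro mult_left_mono) auto
    also have "\<dots> \<le> (B * L\<^sup>2 / a) * (L * norm (x - y))"
      using N[of y] a h[of y] L by (intro mult_right_mono frac_le) auto
    finally have "(?N y / h y) * (h y - h x) \<le> (B * L\<^sup>2 / a) * (L * norm (x - y))" .
    then have "(?N y / h y) * (h y - h x) / h x \<le> (B * L\<^sup>2 / a) * (L * norm (x - y)) / h x"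
      using hp[of x] by (intro divide_right_mono) auto
    also have "\<dots> \<le> (B * L\<^sup>2 / a) * (L * norm (x - y)) / a"
      using a h[of x] hp[of x] B L by (intro divide_left_mono) auto
    finally show ?thesis .
  qed
  also have "2 * (B * L\<^sup>2 * norm (x - y)) / h x \<le> 2 * (B * L\<^sup>2 * norm (x - y)) / a"
    using a h[of x] hp[of x] B L by (intro divide_left_mono) auto
  finally show "fisher h g x \<le> fisher h g y + (2 * B * L\<^sup>2 / a + B * L ^ 3 / a\<^sup>2) * norm (x - y)"
    by (simp add: fisher_def algebra_simps power2_eq_square power3_eq_cube)
qed

lemma fisher_integrable:
  assumes n: "regular a b L h g"
  shows "integrable gam (\<lambda>z. fisher h g (y + r *\<^sub>R z))"
proof -
  obtain B where B: "B > 0" "\<And>v. norm (C v) \<le> B * norm v" by (rule norm_C_bound) (rule that)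
  note [measurable] = fisher_measurable[OF regular_measurable[OF n]]
  show ?thesis
    by (rule integrable_bounded[where B="B * L\<^sup>2 / a"])
       (use fisher_bounds(1,2)[OF n B(2,1)] in \<open>auto simp: abs_le_iff intro: order_trans[of _ 0]\<close>)
qed

text \<open>Under the Gaussian rescaled by \<open>r\<close>, a regular function is affine up to \<open>O(r\<^sup>2)\<close>, and the
  inequality reduces to the variance \<open>g 0 \<bullet> C (g 0)\<close> of a linear function. Replacing the value of
  \<open>fisher h g\<close> at the origin by its mean costs another \<open>O(r\<^sup>3)\<close>.\<close>

lemma Ent_small_scale:
  assumes a: "0 < a" and L: "0 \<le> L"
  obtains K where "\<And>(h :: 'a \<Rightarrow> real) g r. regular a b L h g \<Longrightarrow> 0 \<le> r \<Longrightarrow> r \<le> 1 \<Longrightarrow>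
    Ent gam (\<lambda>z. h (r *\<^sub>R z)) \<le> r\<^sup>2 / 2 * (\<integral>z. fisher h g (r *\<^sub>R z) \<partial>gam) + K * r ^ 3"
proof -
  obtain B where B: "B > 0" "\<And>v. norm (C v) \<le> B * norm v" by (rule norm_C_bound) (rule that)
  define K1 where "K1 = L\<^sup>2 / a + L ^ 3 / a\<^sup>2 + L ^ 4 / a ^ 3"
  define K2 where "K2 = 2 * B * L\<^sup>2 / a + B * L ^ 3 / a\<^sup>2"
  define M where "M k = (\<integral>z. norm z ^ k \<partial>gam)" for k :: nat
  show thesis
  proof
    fix h :: "'a \<Rightarrow> real" and g and r :: real assume n: "regular a b L h g" and r: "0 \<le> r" "r \<le> 1"
    have h: "\<And>x. a \<le> h x" "\<And>x. h x \<le> b" and g: "\<And>x. norm (g x) \<le> L"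
      using n by (auto simp: regular_def)
    have hp: "h x > 0" for x using a h(1)[of x] by simp
    note [measurable] = regular_measurable[OF n]
    let ?m = "h 0"
    have pw: "h (r *\<^sub>R z) * ln (h (r *\<^sub>R z) / ?m) - h (r *\<^sub>R z) + ?m
        \<le> r\<^sup>2 / 2 / ?m * ((z \<bullet> g 0) * (z \<bullet> g 0)) + r ^ 3 * K1 * (norm z ^ 3 + norm z ^ 4)" for z
    proof -
      have "h (r *\<^sub>R z) * ln (h (r *\<^sub>R z) / ?m) - h (r *\<^sub>R z) + ?m
        \<le> r\<^sup>2 * ((g 0 \<bullet> z)\<^sup>2 / ?m) / 2 + r ^ 3 * ((L\<^sup>2 / a + L ^ 3 / a\<^sup>2 + L ^ 4 / a ^ 3) * (norm z ^ 3 + norm z ^ 4))"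
      proof (rule local_entropy_bound[OF a h(1) hp r L norm_ge_zero])
        show "\<bar>g 0 \<bullet> z\<bar> \<le> L * norm z"
          using Cauchy_Schwarz_ineq2[of "g 0" z] g[of 0] by (meson mult_right_mono norm_ge_zero order_trans)
        show "\<bar>h (r *\<^sub>R z) - h 0\<bar> \<le> L * r * norm z"
          using regular_taylor(1)[OF n, of 0 "r *\<^sub>R z"] r by (simp add: mult.assoc)
        show "\<bar>h (r *\<^sub>R z) - h 0 - r * (g 0 \<bullet> z)\<bar> \<le> L * r\<^sup>2 * (norm z)\<^sup>2"
          using regular_taylor(2)[OF n, of 0 "r *\<^sub>R z"] r by (simp add: mult.assoc power_mult_distrib)
      qed
      then show ?thesis by (simp add: K1_def inner_commute[of "g 0"] power2_eq_square field_simps)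
    qed
    have i1: "integrable gam (\<lambda>z. r\<^sup>2 / 2 / ?m * ((z \<bullet> g 0) * (z \<bullet> g 0)))"
      by (intro integrable_mult_right integrable_second_moment)
    have i2: "integrable gam (\<lambda>z. r ^ 3 * K1 * (norm z ^ 3 + norm z ^ 4))"
      by (intro integrable_mult_right Bochner_Integration.integrable_add integrable_norm_power)
    have "Ent gam (\<lambda>z. h (r *\<^sub>R z))
        \<le> (\<integral>z. h (r *\<^sub>R z) * ln (h (r *\<^sub>R z) / ?m) - h (r *\<^sub>R z) + ?m \<partial>gam)"
      by (rule Ent_le(2)[where a=a and b=b]) (use a h hp in simp_all)
    also have "\<dots> \<le> (\<integral>z. r\<^sup>2 / 2 / ?m * ((z \<bullet> g 0) * (z \<bullet> g 0)) + r ^ 3 * K1 * (norm z ^ 3 + norm z ^ 4) \<partial>gam)"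
      by (intro integral_mono pw Bochner_Integration.integrable_add i1 i2 Ent_le(1)[where a=a and b=b])
         (use a h hp in simp_all)
    also have "\<dots> = r\<^sup>2 / 2 / ?m * (g 0 \<bullet> C (g 0)) + r ^ 3 * K1 * (M 3 + M 4)"
      using i1 i2 integrable_norm_power by (simp add: second_moment M_def)
    also have "r\<^sup>2 / 2 / ?m * (g 0 \<bullet> C (g 0)) = r\<^sup>2 / 2 * fisher h g 0"
      by (simp add: fisher_def)
    also have "fisher h g 0 \<le> (\<integral>z. fisher h g (r *\<^sub>R z) \<partial>gam) + K2 * r * M 1"
    proof -
      have fi: "integrable gam (\<lambda>z. fisher h g (r *\<^sub>R z))"
        using fisher_integrable[OF n, of 0 r] by simp
      have ni: "integrable gam (\<lambda>z. K2 * r * norm z ^ 1)"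
        by (intro integrable_mult_right integrable_norm_power)
      have "(\<integral>z. fisher h g 0 \<partial>gam) \<le> (\<integral>z. fisher h g (r *\<^sub>R z) + K2 * r * norm z ^ 1 \<partial>gam)"
      proof (rule integral_mono)
        show "fisher h g 0 \<le> fisher h g (r *\<^sub>R z) + K2 * r * norm z ^ 1" for z
          using fisher_bounds(3)[OF n B(2,1), of 0 "r *\<^sub>R z"] r by (simp add: K2_def mult.assoc)
      qed (use fi ni in auto)
      also have "\<dots> = (\<integral>z. fisher h g (r *\<^sub>R z) \<partial>gam) + K2 * r * M 1"
        using fi ni by (simp add: M_def)
      finally show ?thesis using prob_space by simp
    qed
    then have "r\<^sup>2 / 2 * fisher h g 0 \<le> r\<^sup>2 / 2 * ((\<integral>z. fisher h g (r *\<^sub>R z) \<partial>gam) + K2 * r * M 1)"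
      by (intro mult_left_mono) auto
    finally show "Ent gam (\<lambda>z. h (r *\<^sub>R z)) \<le> r\<^sup>2 / 2 * (\<integral>z. fisher h g (r *\<^sub>R z) \<partial>gam)
        + (K2 * M 1 / 2 + K1 * (M 3 + M 4)) * r ^ 3"
      by (simp add: algebra_simps power2_eq_square power3_eq_cube)
  qed
qed

text \<open>A Gaussian at scale \<open>sqrt 2 * r\<close> is a sum of two independent ones at scale \<open>r\<close>. Tensorization
  bounds the entropy by two mean entropies over one summand with the other one fixed, and fixing one
  summand only translates \<open>h\<close>.\<close>

lemma Ent_doubling:
  assumes IH: "\<And>h g. regular a b L h g \<Longrightarrow>
      Ent gam (\<lambda>z. h (r *\<^sub>R z)) \<le> r\<^sup>2 / 2 * (\<integral>z. fisher h g (r *\<^sub>R z) \<partial>gam) + E"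
    and n: "regular a b L h g"
  shows "Ent gam (\<lambda>z. h ((sqrt 2 * r) *\<^sub>R z))
      \<le> (sqrt 2 * r)\<^sup>2 / 2 * (\<integral>z. fisher h g ((sqrt 2 * r) *\<^sub>R z) \<partial>gam) + 2 * E"
proof -
  have a: "0 < a" and h: "\<And>x. a \<le> h x" "\<And>x. h x \<le> b" using n by (auto simp: regular_def)
  note [measurable] = regular_measurable[OF n] fisher_measurable[OF regular_measurable[OF n]]
  let ?s = "1 / sqrt 2"
  have s: "?s\<^sup>2 + ?s\<^sup>2 = 1" "?s \<noteq> 0" by (auto simp: power_divide)
  have sx: "(sqrt 2 * r) *\<^sub>R (?s *\<^sub>R x + ?s *\<^sub>R z) = r *\<^sub>R x + r *\<^sub>R z" for x z :: 'a
    by (simp add: scaleR_add_right)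
  define k where "k = (\<lambda>(x, y). h (r *\<^sub>R x + r *\<^sub>R y))"
  have km[measurable]: "k \<in> borel_measurable (gam \<Otimes>\<^sub>M gam)" unfolding k_def by measurable
  have kb: "a \<le> k p" "k p \<le> b" for p using h by (auto simp: k_def split_def)
  have eq: "(\<integral>p. w (k p) \<partial>(gam \<Otimes>\<^sub>M gam)) = (\<integral>z. w (h ((sqrt 2 * r) *\<^sub>R z)) \<partial>gam)"
    if [measurable]: "w \<in> borel_measurable borel" for w :: "real \<Rightarrow> real"
  proof -
    have "(\<integral>z. w (h ((sqrt 2 * r) *\<^sub>R z)) \<partial>gam)
      = (\<integral>z. w (h ((sqrt 2 * r) *\<^sub>R z)) \<partial>distr (gam \<Otimes>\<^sub>M gam) borel (\<lambda>(x, z). ?s *\<^sub>R x + ?s *\<^sub>R z))"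
      by (simp only: distr_rotation[OF s])
    also have "\<dots> = (\<integral>p. w (h ((sqrt 2 * r) *\<^sub>R (case p of (x, z) \<Rightarrow> ?s *\<^sub>R x + ?s *\<^sub>R z))) \<partial>(gam \<Otimes>\<^sub>M gam))"
      by (rule integral_distr) measurable
    also have "\<dots> = (\<integral>p. w (k p) \<partial>(gam \<Otimes>\<^sub>M gam))"
      unfolding k_def split_def sx ..
    finally show ?thesis ..
  qed
  have "Ent gam (\<lambda>z. h ((sqrt 2 * r) *\<^sub>R z)) = Ent (gam \<Otimes>\<^sub>M gam) k"
    unfolding Ent_def using eq[of "\<lambda>t. t"] eq[of "\<lambda>t. t * ln t"] by simp
  also have "\<dots> \<le> (\<integral>y. Ent gam (\<lambda>x. k (x, y)) \<partial>gam) + (\<integral>x. Ent gam (\<lambda>y. k (x, y)) \<partial>gam)"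
    by (rule GG.Ent_tensorization[OF km a kb])
  also have "(\<integral>y. Ent gam (\<lambda>x. k (x, y)) \<partial>gam) = (\<integral>x. Ent gam (\<lambda>y. k (x, y)) \<partial>gam)"
    by (simp add: k_def add.commute)
  also have "(\<integral>x. Ent gam (\<lambda>y. k (x, y)) \<partial>gam)
      \<le> (\<integral>x. r\<^sup>2 / 2 * (\<integral>z. fisher h g ((sqrt 2 * r) *\<^sub>R (?s *\<^sub>R x + ?s *\<^sub>R z)) \<partial>gam) + E \<partial>gam)"
  proof (rule integral_mono)
    show "integrable gam (\<lambda>x. Ent gam (\<lambda>y. k (x, y)))"
      by (rule GG.integrable_Ent_slice[OF km a kb])
    have "integrable gam (\<lambda>z. fisher h g ((sqrt 2 * r) *\<^sub>R z))"
      using fisher_integrable[OF n, of 0] by simp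
    from integral_rotation(3)[OF s this]
    show "integrable gam (\<lambda>x. r\<^sup>2 / 2 * (\<integral>z. fisher h g ((sqrt 2 * r) *\<^sub>R (?s *\<^sub>R x + ?s *\<^sub>R z)) \<partial>gam) + E)"
      by simp
    show "Ent gam (\<lambda>y. k (x, y)) \<le> r\<^sup>2 / 2 * (\<integral>z. fisher h g ((sqrt 2 * r) *\<^sub>R (?s *\<^sub>R x + ?s *\<^sub>R z)) \<partial>gam) + E" for x
      using IH[OF regular_shift[OF n, of "r *\<^sub>R x"]] unfolding sx by (simp add: k_def fisher_def)
  qed
  also have "\<dots> = r\<^sup>2 / 2 * (\<integral>z. fisher h g ((sqrt 2 * r) *\<^sub>R z) \<partial>gam) + E"
  proof -
    have i: "integrable gam (\<lambda>z. fisher h g ((sqrt 2 * r) *\<^sub>R z))"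
      using fisher_integrable[OF n, of 0] by simp
    show ?thesis
      using integral_rotation(1)[OF s i] integral_rotation(3)[OF s i] prob_space by simp
  qed
  finally show ?thesis by (simp add: power_mult_distrib algebra_simps)
qed

text \<open>Starting at scale \<open>2 powr (- k / 2)\<close>, the error \<open>K * 2 powr (- 3 * k / 2)\<close> is doubled \<open>k\<close> times
  on the way to scale \<open>1\<close>, and \<open>K * 2 powr (- k / 2)\<close> remains.\<close>

lemma log_sobolev_regular:
  assumes n: "regular a b L h g"
  shows "Ent gam h \<le> 1/2 * (\<integral>z. fisher h g z \<partial>gam)"
proof -
  have a: "0 < a" and L: "0 \<le> L" using n by (auto simp: regular_def)
  obtain K where K: "\<And>(h :: 'a \<Rightarrow> real) g r. regular a b L h g \<Longrightarrow> 0 \<le> r \<Longrightarrow> r \<le> 1 \<Longrightarrow>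
    Ent gam (\<lambda>z. h (r *\<^sub>R z)) \<le> r\<^sup>2 / 2 * (\<integral>z. fisher h g (r *\<^sub>R z) \<partial>gam) + K * r ^ 3"
    by (rule Ent_small_scale[OF a L, where b=b]) (rule that)
  let ?q = "1 / sqrt 2"
  have step: "regular a b L h g \<Longrightarrow> Ent gam (\<lambda>z. h ((sqrt 2 ^ k * r) *\<^sub>R z))
      \<le> (sqrt 2 ^ k * r)\<^sup>2 / 2 * (\<integral>z. fisher h g ((sqrt 2 ^ k * r) *\<^sub>R z) \<partial>gam) + 2 ^ k * (K * r ^ 3)"
    if r: "0 \<le> r" "r \<le> 1" for r and h :: "'a \<Rightarrow> real" and g and k :: nat
  proof (induction k arbitrary: h g)
    case 0
    then show ?case using K[OF 0 r] by simp
  next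
    case (Suc k)
    show ?case using Ent_doubling[OF Suc.IH Suc.prems] by (simp add: mult.assoc)
  qed
  have bound: "Ent gam h \<le> 1/2 * (\<integral>z. fisher h g z \<partial>gam) + K * ?q ^ k" for k
  proof -
    have e1: "sqrt 2 ^ k * ?q ^ k = 1" by (simp add: power_mult_distrib[symmetric])
    have e2: "2 ^ k * (K * (?q ^ k) ^ 3) = K * ?q ^ k"
    proof -
      have "2 * ?q ^ 3 = ?q" by (simp add: power3_eq_cube field_simps)
      then have "2 ^ k * (?q ^ 3) ^ k = ?q ^ k" by (metis power_mult_distrib)
      then show ?thesis by (simp add: power_mult[symmetric] mult.commute mult.left_commute)
    qed
    have "0 \<le> ?q ^ k" "?q ^ k \<le> 1" by (auto intro!: power_le_one simp: power_one_over)
    from step[OF this n, of k] show ?thesis unfolding e1 e2 by simp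
  qed
  have "(\<lambda>k. 1/2 * (\<integral>z. fisher h g z \<partial>gam) + K * ?q ^ k) \<longlonglongrightarrow> 1/2 * (\<integral>z. fisher h g z \<partial>gam) + K * 0"
    by (intro tendsto_intros LIMSEQ_power_zero) simp
  then show ?thesis
    by (intro LIMSEQ_le_const[where X="\<lambda>k. 1/2 * (\<integral>z. fisher h g z \<partial>gam) + K * ?q ^ k"])
       (use bound in auto)
qed

end

section \<open>Smoothing by the Ornstein-Uhlenbeck semigroup\<close>

lemma gderiv_quadratic_bound:
  fixes f :: "'a::euclidean_space \<Rightarrow> real"
  assumes "0 < \<delta>" and b: "\<And>v. norm v \<le> \<delta> \<Longrightarrow> \<bar>f (x + v) - f x - D \<bullet> v\<bar> \<le> K * (norm v)\<^sup>2"
  shows "GDERIV f x :> D"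
  unfolding gderiv_def has_derivative_iff_norm
proof
  show "bounded_linear (\<lambda>h. inner h D)" by (rule bounded_linear_inner_left)
  have "((\<lambda>y. norm (y - x)) \<longlongrightarrow> norm (x - x)) (at x)" by (intro tendsto_intros)
  then have "((\<lambda>y. norm (y - x)) \<longlongrightarrow> 0) (at x)" by simp
  moreover have "\<forall>\<^sub>F y in at x. norm (norm (f y - f x - inner (y - x) D) / norm (y - x)) \<le> norm (norm (y - x)) * K"
  proof -
    have "\<forall>\<^sub>F y in at x. y \<in> cball x \<delta>"
      using \<open>0 < \<delta>\<close> by (intro eventually_at_in_open'[THEN eventually_mono, of "ball x \<delta>"]) auto
    then show ?thesis
    proof eventually_elim
      case (elim y)
      then have "norm (y - x) \<le> \<delta>" by (simp add: dist_norm norm_minus_commute)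
      from b[OF this] have "\<bar>f y - f x - inner (y - x) D\<bar> \<le> K * (norm (y - x))\<^sup>2"
        by (simp add: inner_commute)
      then show ?case
        by (cases "y = x") (simp_all add: power2_eq_square field_simps)
    qed
  qed
  ultimately show "((\<lambda>y. norm (f y - f x - inner (y - x) D) / norm (y - x)) \<longlongrightarrow> 0) (at x)"
    by (rule tendsto_0_le)
qed

lemma (in prob_space) Ent_tendsto:
  assumes k: "\<And>n. k n \<in> borel_measurable M" "k' \<in> borel_measurable M"
    and a: "0 < a" "\<And>n x. a \<le> k n x" "\<And>n x. k n x \<le> b"
    and lim: "\<And>x. (\<lambda>n. k n x) \<longlonglongrightarrow> k' x"
  shows "(\<lambda>n. Ent M (k n)) \<longlonglongrightarrow> Ent M k'"
proof -
  note [measurable] = k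
  have k': "a \<le> k' x" "k' x \<le> b" for x
    using LIMSEQ_le_const[OF lim, of a x] LIMSEQ_le_const2[OF lim, of x b] a by auto
  have 1: "(\<lambda>n. \<integral>x. k n x \<partial>M) \<longlonglongrightarrow> (\<integral>x. k' x \<partial>M)"
    by (rule integral_dominated_convergence[where w="\<lambda>_. b"])
       (use a(3) abs_of_pos[OF less_le_trans[OF a(1,2)]] lim in \<open>auto\<close>)
  have 2: "(\<lambda>n. \<integral>x. k n x * ln (k n x) \<partial>M) \<longlonglongrightarrow> (\<integral>x. k' x * ln (k' x) \<partial>M)"
  proof (rule integral_dominated_convergence[where w="\<lambda>_. b * (\<bar>ln a\<bar> + \<bar>ln b\<bar>)"])
    show "AE x in M. (\<lambda>n. k n x * ln (k n x)) \<longlonglongrightarrow> k' x * ln (k' x)"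
    proof (intro AE_I2 tendsto_mult tendsto_ln lim)
      show "k' x \<noteq> 0" for x using k'(1)[of x] a(1) by auto
    qed
    show "AE x in M. norm (k n x * ln (k n x)) \<le> b * (\<bar>ln a\<bar> + \<bar>ln b\<bar>)" for n
      using mult_ln_bounded[OF a] by auto
  qed auto
  have "a \<le> (\<integral>x. k' x \<partial>M)" by (rule expectation_between) (use k' k in auto)
  then show ?thesis unfolding Ent_def using a(1) by (intro tendsto_intros 1 2) auto
qed

context centered_gaussian begin

lemma norm_A_bound: obtains B where "B > 0" "\<And>v. norm (A v) \<le> B * norm v"
proof -
  obtain B where "B > 0" "\<And>v. norm (A v) \<le> norm v * B"
    using bounded_linear.pos_bounded[OF A_bounded_linear] by blast
  then show thesis using that[of B] by (simp add: mult.commute)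
qed

definition drift :: "'a \<Rightarrow> 'a" where "drift z = dens z *\<^sub>R A z"

lemma measurable_drift [measurable]: "drift \<in> borel_measurable borel"
  unfolding drift_def[abs_def] by measurable

lemma integrable_drift: "integrable lborel drift"
proof -
  obtain B where B: "B > 0" "\<And>v. norm (A v) \<le> B * norm v" by (rule norm_A_bound) (rule that)
  have "integrable gam A"
    by (rule integrable_gam_bound[where K=B and k=1]) (use B in auto)
  then show ?thesis by (simp add: integrable_gam drift_def[abs_def])
qed

lemma drift_has_derivative:
  "(drift has_derivative (\<lambda>v. dens y *\<^sub>R A v - (dens y * (A y \<bullet> v)) *\<^sub>R A y)) (at y)"
proof -
  have "(drift has_derivative (\<lambda>v. dens y *\<^sub>R A v + (inner v (- (dens y *\<^sub>R A y))) *\<^sub>R A y)) (at y)"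
    unfolding drift_def[abs_def]
    by (intro has_derivative_scaleR gderiv_dens[unfolded gderiv_def]
        bounded_linear_imp_has_derivative A_bounded_linear)
  then show ?thesis by (simp add: inner_commute)
qed

text \<open>The derivative of \<open>drift\<close> is \<open>dens\<close> times a quadratic polynomial; within unit distance of \<open>z\<close> it is
  dominated by a wider Gaussian centred at the origin and evaluated at \<open>z\<close>.\<close>

lemma drift_increments:
  obtains D where "integrable lborel D" "\<And>z. 0 \<le> D z"
    "\<And>z w. norm w \<le> 1 \<Longrightarrow> norm (drift (z - w) - drift z) \<le> norm w * D z"
    "\<And>z w. norm w \<le> 1 \<Longrightarrow> \<bar>dens (z - w) - dens z - drift z \<bullet> w\<bar> \<le> (norm w)\<^sup>2 * D z"
proof -
  obtain B where B: "B > 0" "\<And>v. norm (A v) \<le> B * norm v" by (rule norm_A_bound) (rule that)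
  have "0 < (1/4 :: real)" by simp
  from norm_power_le_exp_quadratic[OF this, of 2]
  obtain K where K: "K > 0" "\<forall>x. norm x ^ 2 \<le> K * exp (1/4 * (x \<bullet> A x))" by blast
  define K' where "K' = c * (B + B\<^sup>2 * K)"
  have K': "K' > 0" using c_pos B K by (simp add: K'_def add_pos_pos)
  have qpos: "0 \<le> x \<bullet> A x" for x
    by (cases "x = 0") (auto intro: less_imp_le positive_A simp: A.zero)
  have der: "norm (dens y *\<^sub>R A v - (dens y * (A y \<bullet> v)) *\<^sub>R A y)
      \<le> (K' * exp (- (y \<bullet> A y) / 4)) * norm v" for y v
  proof -
    have "\<bar>A y \<bullet> v\<bar> \<le> (B * norm y) * norm v"
      using Cauchy_Schwarz_ineq2[of "A y" v] B(2)[of y] by (meson mult_right_mono norm_ge_zero order_trans)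
    then have "\<bar>A y \<bullet> v\<bar> * norm (A y) \<le> ((B * norm y) * norm v) * (B * norm y)"
      using B by (intro mult_mono) auto
    then have "norm ((A y \<bullet> v) *\<^sub>R A y) \<le> B\<^sup>2 * (norm y)\<^sup>2 * norm v"
      by (simp add: power2_eq_square ac_simps)
    then have "norm (A v - (A y \<bullet> v) *\<^sub>R A y) \<le> B * norm v + B\<^sup>2 * (norm y)\<^sup>2 * norm v"
      using norm_triangle_ineq4[of "A v" "(A y \<bullet> v) *\<^sub>R A y"] B(2)[of v] by linarith
    also have "\<dots> \<le> B * exp (1/4 * (y \<bullet> A y)) * norm v + B\<^sup>2 * (K * exp (1/4 * (y \<bullet> A y))) * norm v"
      using B K qpos[of y] by (intro add_mono mult_right_mono mult_left_mono) auto
    finally have "norm (A v - (A y \<bullet> v) *\<^sub>R A y) \<le> (B + B\<^sup>2 * K) * exp (1/4 * (y \<bullet> A y)) * norm v"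
      by (simp add: algebra_simps)
    then have "dens y * norm (A v - (A y \<bullet> v) *\<^sub>R A y)
        \<le> dens y * ((B + B\<^sup>2 * K) * exp (1/4 * (y \<bullet> A y)) * norm v)"
      by (intro mult_left_mono) auto
    also have "\<dots> = K' * (exp (- (y \<bullet> A y) / 2) * exp (1/4 * (y \<bullet> A y))) * norm v"
      by (simp add: dens_def K'_def)
    also have "\<dots> = K' * exp (- (y \<bullet> A y) / 4) * norm v"
      by (subst exp_add[symmetric]) simp
    also have "dens y * norm (A v - (A y \<bullet> v) *\<^sub>R A y)
        = norm (dens y *\<^sub>R (A v - (A y \<bullet> v) *\<^sub>R A y))" by simp
    finally show ?thesis by (simp add: scaleR_diff_right)
  qed
  define D where "D z = K' * exp (B / 2) * exp (- (1/8) * (z \<bullet> A z))" for z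
  have near: "K' * exp (- (y \<bullet> A y) / 4) \<le> D z" if "y \<in> cball z 1" for y z
  proof -
    define u where "u = z - y"
    have u: "norm u \<le> 1" using that by (simp add: u_def dist_norm)
    have "u \<bullet> A u \<le> norm u * (B * norm u)"
      using Cauchy_Schwarz_ineq2[of u "A u"] B(2)[of u]
      by (meson abs_le_D1 mult_left_mono norm_ge_zero order_trans)
    also have "\<dots> \<le> 1 * (B * 1)" using u B by (intro mult_mono) auto
    finally have "u \<bullet> A u \<le> B" by simp
    moreover have "z = y + u" by (simp add: u_def)
    \<comment> \<open>The parallelogram law compares the exponents at \<open>y\<close> and \<open>z\<close>.\<close>
    have "z \<bullet> A z + (y - u) \<bullet> A (y - u) = 2 * (y \<bullet> A y) + 2 * (u \<bullet> A u)"
      unfolding \<open>z = y + u\<close>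
      by (simp add: A.add A.diff inner_add_left inner_add_right inner_diff_left inner_diff_right)
    ultimately have "- (y \<bullet> A y) / 4 \<le> B / 2 + (- (1/8) * (z \<bullet> A z))"
      using qpos[of "y - u"] B(1) by linarith
    then have "K' * exp (- (y \<bullet> A y) / 4) \<le> K' * exp (B / 2 + (- (1/8) * (z \<bullet> A z)))"
      using K' by (intro mult_left_mono) auto
    then show ?thesis by (simp only: D_def exp_add mult.assoc)
  qed
  show thesis
  proof
    show "integrable lborel D"
      unfolding D_def[abs_def] by (intro integrable_mult_right integrable_exp_quadratic) simp
    show D0: "0 \<le> D z" for z using K' by (simp add: D_def)
    show lip: "norm (drift (z - w) - drift z) \<le> norm w * D z" if "norm w \<le> 1" for z w
    proof -
      have "norm (drift (z - w) - drift z) \<le> D z * norm ((z - w) - z)"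
      proof (rule differentiable_bound[OF convex_cball[of z 1]])
        fix y assume y: "y \<in> cball z 1"
        show "(drift has_derivative (\<lambda>v. dens y *\<^sub>R A v - (dens y * (A y \<bullet> v)) *\<^sub>R A y)) (at y within cball z 1)"
          by (rule has_derivative_at_withinI[OF drift_has_derivative])
        show "onorm (\<lambda>v. dens y *\<^sub>R A v - (dens y * (A y \<bullet> v)) *\<^sub>R A y) \<le> D z"
          by (rule onorm_le) (rule order_trans[OF der mult_right_mono[OF near[OF y] norm_ge_zero]])
      qed (use that in \<open>auto simp: dist_norm\<close>)
      then show ?thesis by (simp add: mult.commute)
    qed
    show "\<bar>dens (z - w) - dens z - drift z \<bullet> w\<bar> \<le> (norm w)\<^sup>2 * D z" if w: "norm w \<le> 1" for z w
    proof -
      have d: "GDERIV dens x :> - drift x" for x using gderiv_dens by (simp add: drift_def)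
      obtain \<xi> where \<xi>: "0 < \<xi>" "\<xi> < 1"
        and eq: "dens (z + (- w)) - dens z = - drift (z + \<xi> *\<^sub>R (- w)) \<bullet> (- w)"
        by (rule gderiv_mean_value[OF d, where x=z and z="- w"]) (rule that)
      have eq': "dens (z - w) - dens z - drift z \<bullet> w = (drift (z - \<xi> *\<^sub>R w) - drift z) \<bullet> w"
        using eq by (simp add: inner_diff_left)
      have \<xi>w: "norm (\<xi> *\<^sub>R w) \<le> norm w" using \<xi> by (simp add: mult_left_le_one_le)
      have "\<bar>(drift (z - \<xi> *\<^sub>R w) - drift z) \<bullet> w\<bar> \<le> norm (drift (z - \<xi> *\<^sub>R w) - drift z) * norm w"
        by (rule Cauchy_Schwarz_ineq2)
      also have "\<dots> \<le> (norm (\<xi> *\<^sub>R w) * D z) * norm w"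
        by (intro mult_right_mono lip order_trans[OF \<xi>w w]) simp
      also have "\<dots> \<le> (norm w * D z) * norm w"
        by (intro mult_right_mono \<xi>w D0) simp
      finally show ?thesis by (simp add: eq' power2_eq_square ac_simps)
    qed
  qed
qed

text \<open>For \<open>\<alpha>\<^sup>2 + \<beta>\<^sup>2 = 1\<close> this is the Ornstein-Uhlenbeck semigroup in Mehler's form.\<close>

definition mehler :: "real \<Rightarrow> real \<Rightarrow> ('a \<Rightarrow> real) \<Rightarrow> 'a \<Rightarrow> real" where
  "mehler \<alpha> \<beta> h x = (\<integral>z. h (\<alpha> *\<^sub>R x + \<beta> *\<^sub>R z) \<partial>gam)"

text \<open>This is the gradient of the preceding function, with the derivative falling on the Gaussian kernel,
  so that it makes sense for every bounded \<open>h\<close>.\<close>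

definition mehler_grad :: "real \<Rightarrow> real \<Rightarrow> ('a \<Rightarrow> real) \<Rightarrow> 'a \<Rightarrow> 'a" where
  "mehler_grad \<alpha> \<beta> h x = (\<alpha> / \<beta>) *\<^sub>R (\<integral>z. h (\<alpha> *\<^sub>R x + \<beta> *\<^sub>R z) *\<^sub>R drift z \<partial>lborel)"

lemma integrable_bounded_scaleR:
  fixes u :: "'a \<Rightarrow> 'b::{banach, second_countable_topology}"
  assumes "integrable lborel u" "h \<in> borel_measurable borel" "\<And>x. \<bar>h x\<bar> \<le> b"
  shows "integrable lborel (\<lambda>x. h x *\<^sub>R u x)"
proof (rule Bochner_Integration.integrable_bound)
  show "integrable lborel (\<lambda>x. b * norm (u x))"
    using assms(1) by (intro integrable_mult_right integrable_norm)
  have "b \<ge> 0" using assms(3)[of 0] by linarith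
  then show "AE x in lborel. norm (h x *\<^sub>R u x) \<le> norm (b * norm (u x))"
    using assms(3) by (auto simp: abs_mult intro!: mult_right_mono)
  show "(\<lambda>x. h x *\<^sub>R u x) \<in> borel_measurable lborel"
    using assms(2) borel_measurable_integrable[OF assms(1)] by simp
qed

lemma norm_integral_bounded_scaleR:
  fixes u :: "'a \<Rightarrow> 'b::{banach, second_countable_topology}"
  assumes u: "integrable lborel u" "h \<in> borel_measurable borel" "\<And>x. \<bar>h x\<bar> \<le> b"
    and D: "integrable lborel D" "\<And>x. norm (u x) \<le> s * D x"
  shows "norm (\<integral>x. h x *\<^sub>R u x \<partial>lborel) \<le> b * s * (\<integral>x. D x \<partial>lborel)"
proof -
  have b: "b \<ge> 0" using assms(3)[of 0] by linarith
  have "norm (\<integral>x. h x *\<^sub>R u x \<partial>lborel) \<le> (\<integral>x. norm (h x *\<^sub>R u x) \<partial>lborel)"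
    by (rule integral_norm_bound)
  also have "\<dots> \<le> (\<integral>x. (b * s) * D x \<partial>lborel)"
  proof (rule integral_mono)
    show "integrable lborel (\<lambda>x. norm (h x *\<^sub>R u x))"
      by (intro integrable_norm integrable_bounded_scaleR[OF u])
    show "norm (h x *\<^sub>R u x) \<le> (b * s) * D x" for x
    proof -
      have "\<bar>h x\<bar> * norm (u x) \<le> b * (s * D x)"
        using b by (intro mult_mono assms(3) D(2)) auto
      then show ?thesis by (simp add: mult.assoc)
    qed
  qed (use D in simp)
  finally show ?thesis by simp
qed

text \<open>A translation of \<open>x\<close> can be moved to the Gaussian density by a change of variables, so \<open>h\<close>
  enters the regularity estimates only through its bounds.\<close>

lemma mehler_regular:
  assumes ab: "0 \<le> \<alpha>" "0 < \<beta>" and a: "0 < a" and h: "\<And>x. a \<le> h x" "\<And>x. h x \<le> b"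
    and [measurable]: "h \<in> borel_measurable borel"
  obtains L where "regular a b L (mehler \<alpha> \<beta> h) (mehler_grad \<alpha> \<beta> h)"
proof -
  define \<kappa> where "\<kappa> = \<alpha> / \<beta>"
  have \<kappa>: "\<kappa> \<ge> 0" and \<beta>\<kappa>: "\<beta> * \<kappa> = \<alpha>" using ab by (simp_all add: \<kappa>_def)
  have hb: "\<bar>h x\<bar> \<le> b" for x using h[of x] a by simp
  have b: "b \<ge> 0" using hb[of 0] by linarith
  obtain D where D: "integrable lborel D" "\<And>z. 0 \<le> D z"
    "\<And>z w. norm w \<le> 1 \<Longrightarrow> norm (drift (z - w) - drift z) \<le> norm w * D z"
    "\<And>z w. norm w \<le> 1 \<Longrightarrow> \<bar>dens (z - w) - dens z - drift z \<bullet> w\<bar> \<le> (norm w)\<^sup>2 * D z"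
    by (rule drift_increments) (rule that)
  let ?I = "\<integral>z. D z \<partial>lborel"
  have I: "?I \<ge> 0" using D(2) by simp
  let ?k = "\<lambda>x z. h (\<alpha> *\<^sub>R x + \<beta> *\<^sub>R z)"
  have shift: "\<alpha> *\<^sub>R (x + v) + \<beta> *\<^sub>R z = \<alpha> *\<^sub>R x + \<beta> *\<^sub>R (\<kappa> *\<^sub>R v + z)" for x v z :: 'a
    by (simp add: scaleR_add_right \<beta>\<kappa>)
  have transl: "(\<integral>z. ?k (x + v) z *\<^sub>R u z \<partial>lborel) = (\<integral>z. ?k x z *\<^sub>R u (z - \<kappa> *\<^sub>R v) \<partial>lborel)"
    if [measurable]: "u \<in> borel_measurable borel" for u :: "'a \<Rightarrow> 'b::{banach, second_countable_topology}" and x v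
  proof -
    have "(\<integral>z. ?k x (\<kappa> *\<^sub>R v + z) *\<^sub>R u ((\<kappa> *\<^sub>R v + z) - \<kappa> *\<^sub>R v) \<partial>lborel)
        = (\<integral>z. ?k x z *\<^sub>R u (z - \<kappa> *\<^sub>R v) \<partial>lborel)"
      by (rule integral_lborel_translate) measurable
    then show ?thesis by (simp add: shift)
  qed
  have transl_integrable: "integrable lborel (\<lambda>z. u (z - w))" if "integrable lborel u"
    for u :: "'a \<Rightarrow> 'b::{banach, second_countable_topology}" and w
    using integrable_lborel_translate[OF that, of "- w"] by simp
  have S: "mehler \<alpha> \<beta> h x = (\<integral>z. ?k x z *\<^sub>R dens z \<partial>lborel)" for x
    by (simp add: mehler_def integral_gam mult.commute)
  have ik: "integrable lborel (\<lambda>z. ?k x z *\<^sub>R u z)" if "integrable lborel u"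
    for u :: "'a \<Rightarrow> 'b::{banach, second_countable_topology}" and x
    by (rule integrable_bounded_scaleR[OF that, where b=b]) (use hb in auto)
  let ?G = "mehler_grad \<alpha> \<beta> h"
  have quad: "\<bar>mehler \<alpha> \<beta> h (x + v) - mehler \<alpha> \<beta> h x - ?G x \<bullet> v\<bar> \<le> b * \<kappa>\<^sup>2 * ?I * (norm v)\<^sup>2"
    if v: "norm (\<kappa> *\<^sub>R v) \<le> 1" for x v
  proof -
    let ?w = "\<kappa> *\<^sub>R v"
    have i0: "integrable lborel (\<lambda>z. drift z \<bullet> ?w)" using integrable_drift by simp
    have "?G x \<bullet> v = (\<integral>z. ?k x z *\<^sub>R drift z \<partial>lborel) \<bullet> ?w"
      by (simp add: mehler_grad_def \<kappa>_def)
    also have "\<dots> = (\<integral>z. ?k x z *\<^sub>R (drift z \<bullet> ?w) \<partial>lborel)"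
      by (subst integral_inner_left[symmetric, OF ik[OF integrable_drift]])
         (simp only: inner_scaleR_left real_scaleR_def)
    finally have "mehler \<alpha> \<beta> h (x + v) - mehler \<alpha> \<beta> h x - ?G x \<bullet> v
      = (\<integral>z. ?k x z *\<^sub>R (dens (z - ?w) - dens z - drift z \<bullet> ?w) \<partial>lborel)"
      unfolding S transl[OF measurable_dens] scaleR_diff_right
      by (simp add: Bochner_Integration.integral_diff[symmetric] ik[OF integrable_dens, simplified]
          ik[OF transl_integrable[OF integrable_dens], simplified] ik[OF i0, simplified]
          del: Bochner_Integration.integral_diff)
    also have "\<bar>\<dots>\<bar> \<le> b * (norm ?w)\<^sup>2 * ?I"
      unfolding real_norm_def[symmetric]
      by (rule norm_integral_bounded_scaleR[OF _ _ hb D(1)])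
         (use D(4)[OF v] integrable_dens i0 transl_integrable[OF integrable_dens] in auto)
    finally show ?thesis using \<kappa> by (simp add: power_mult_distrib ac_simps)
  qed
  have d: "GDERIV (mehler \<alpha> \<beta> h) x :> ?G x" for x
  proof (rule gderiv_quadratic_bound[where \<delta>="1 / (\<kappa> + 1)"])
    show "0 < 1 / (\<kappa> + 1)" using \<kappa> by simp
    fix v :: 'a assume "norm v \<le> 1 / (\<kappa> + 1)"
    then have "\<kappa> * norm v \<le> \<kappa> * (1 / (\<kappa> + 1))" using \<kappa> by (rule mult_left_mono)
    also have "\<dots> \<le> 1" using \<kappa> by (simp add: field_simps)
    finally show "\<bar>mehler \<alpha> \<beta> h (x + v) - mehler \<alpha> \<beta> h x - ?G x \<bullet> v\<bar> \<le> b * \<kappa>\<^sup>2 * ?I * (norm v)\<^sup>2"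
      using \<kappa> by (intro quad) simp
  qed
  define L1 where "L1 = \<kappa> * (b * 1 * (\<integral>z. norm (drift z) \<partial>lborel))"
  have L1: "norm (?G x) \<le> L1" for x
  proof -
    have "norm (\<integral>z. ?k x z *\<^sub>R drift z \<partial>lborel) \<le> b * 1 * (\<integral>z. norm (drift z) \<partial>lborel)"
      by (rule norm_integral_bounded_scaleR[OF integrable_drift _ hb]) (use integrable_drift in auto)
    then show ?thesis using \<kappa> unfolding L1_def mehler_grad_def \<kappa>_def[symmetric]
      by (simp add: mult_left_mono)
  qed
  have L10: "L1 \<ge> 0" using L1[of 0] norm_ge_zero order_trans by blast
  define L where "L = L1 + 2 * L1 * \<kappa> + \<kappa>\<^sup>2 * b * ?I"
  have lip: "norm (?G (x + v) - ?G x) \<le> L * norm v" for x v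
  proof (cases "norm (\<kappa> *\<^sub>R v) \<le> 1")
    case True
    have "?G (x + v) - ?G x = \<kappa> *\<^sub>R (\<integral>z. ?k x z *\<^sub>R (drift (z - \<kappa> *\<^sub>R v) - drift z) \<partial>lborel)"
      unfolding mehler_grad_def transl[OF measurable_drift] \<kappa>_def[symmetric]
      by (simp add: scaleR_diff_right ik[OF integrable_drift] ik[OF transl_integrable[OF integrable_drift]])
    also have "norm \<dots> \<le> \<kappa> * (b * norm (\<kappa> *\<^sub>R v) * ?I)"
    proof -
      have "norm (\<integral>z. ?k x z *\<^sub>R (drift (z - \<kappa> *\<^sub>R v) - drift z) \<partial>lborel) \<le> b * norm (\<kappa> *\<^sub>R v) * ?I"
        by (rule norm_integral_bounded_scaleR[OF _ _ hb D(1)])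
           (use D(3)[OF True] integrable_drift transl_integrable[OF integrable_drift] in auto)
      then show ?thesis using \<kappa> by (simp add: mult_left_mono)
    qed
    also have "\<dots> = (\<kappa>\<^sup>2 * b * ?I) * norm v" using \<kappa> by (simp add: power2_eq_square ac_simps)
    also have "\<dots> \<le> L * norm v" using L10 \<kappa> by (intro mult_right_mono) (auto simp: L_def)
    finally show ?thesis .
  next
    case False
    \<comment> \<open>For distant points the bound on the gradient itself suffices.\<close>
    then have "1 \<le> \<kappa> * norm v" using \<kappa> by simp
    then have "2 * L1 * 1 \<le> 2 * L1 * (\<kappa> * norm v)" using L10 by (intro mult_left_mono) auto
    moreover have "norm (?G (x + v) - ?G x) \<le> 2 * L1"
      using norm_triangle_ineq4[of "?G (x + v)" "?G x"] L1[of "x + v"] L1[of x] by linarith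
    moreover have "2 * L1 * \<kappa> * norm v \<le> L * norm v"
      using L10 \<kappa> b I by (intro mult_right_mono) (auto simp: L_def)
    ultimately show ?thesis by (simp add: mult.assoc)
  qed
  have "regular a b L (mehler \<alpha> \<beta> h) ?G"
    unfolding regular_def
  proof (intro conjI allI)
    show "0 < a" by (fact a)
    show "0 \<le> L" using L10 \<kappa> b I by (simp add: L_def)
    show "a \<le> mehler \<alpha> \<beta> h x" "mehler \<alpha> \<beta> h x \<le> b" for x
      unfolding mehler_def using expectation_between(2,3)[of "?k x" a b] h by simp_all
    show "GDERIV (mehler \<alpha> \<beta> h) x :> ?G x" for x by (fact d)
    have "0 \<le> 2 * L1 * \<kappa>" "0 \<le> \<kappa>\<^sup>2 * b * ?I" using L10 \<kappa> b I by auto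
    then have "L1 \<le> L" unfolding L_def by linarith
    then show "norm (?G x) \<le> L" for x using L1[of x] by linarith
    show "norm (?G x - ?G y) \<le> L * norm (x - y)" for x y
      using lip[of y "x - y"] by simp
  qed
  then show thesis by (rule that)
qed

text \<open>Integrating by parts against the Gaussian moves the derivative from the kernel back to \<open>h\<close>.\<close>

lemma mehler_grad_eq:
  assumes ab: "0 < \<beta>" and a: "0 < a" and h: "\<And>x. a \<le> h x" "\<And>x. h x \<le> b"
    and d: "\<And>x. GDERIV h x :> g x"
    and i: "integrable gam (\<lambda>z. g (\<alpha> *\<^sub>R x + \<beta> *\<^sub>R z))"
  shows "mehler_grad \<alpha> \<beta> h x = \<alpha> *\<^sub>R (\<integral>z. g (\<alpha> *\<^sub>R x + \<beta> *\<^sub>R z) \<partial>gam)"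
proof -
  have [measurable]: "h \<in> borel_measurable borel"
    by (intro borel_measurable_continuous_onI gderiv_continuous_on[OF d])
  have [measurable]: "g \<in> borel_measurable borel" by (rule gderiv_measurable[OF d])
  have hb: "\<bar>h x\<bar> \<le> b" for x using h[of x] a by simp
  let ?k = "\<lambda>z. h (\<alpha> *\<^sub>R x + \<beta> *\<^sub>R z)" and ?g = "\<lambda>z. g (\<alpha> *\<^sub>R x + \<beta> *\<^sub>R z)"
  have ikF: "integrable lborel (\<lambda>z. ?k z *\<^sub>R drift z)"
    by (rule integrable_bounded_scaleR[OF integrable_drift, where b=b]) (use hb in auto)
  have ikd: "integrable lborel (\<lambda>z. ?k z * dens z)"
    using integrable_bounded_scaleR[OF integrable_dens, of ?k b] hb by simp
  have ig: "integrable lborel (\<lambda>z. dens z *\<^sub>R ?g z)"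
    using i by (subst (asm) integrable_gam) auto
  have "mehler_grad \<alpha> \<beta> h x \<bullet> v = (\<alpha> *\<^sub>R (\<integral>z. ?g z \<partial>gam)) \<bullet> v" for v
  proof -
    let ?G' = "\<lambda>z. ?k z *\<^sub>R (- (dens z *\<^sub>R A z)) + dens z *\<^sub>R (\<beta> *\<^sub>R ?g z)"
    have dk: "GDERIV ?k z :> \<beta> *\<^sub>R ?g z" for z
    proof -
      have "((\<lambda>z. \<alpha> *\<^sub>R x + \<beta> *\<^sub>R z) has_derivative (\<lambda>v. \<beta> *\<^sub>R v)) (at z)"
        by (auto intro!: derivative_eq_intros)
      from has_derivative_compose[OF this d[of "\<alpha> *\<^sub>R x + \<beta> *\<^sub>R z", unfolded gderiv_def]]
      show ?thesis by (simp add: gderiv_def)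
    qed
    have dG: "GDERIV (\<lambda>z. ?k z * dens z) z :> ?G' z" for z
      by (rule GDERIV_mult[OF dk gderiv_dens])
    have eq: "?G' z \<bullet> v = \<beta> * ((dens z *\<^sub>R ?g z) \<bullet> v) - (?k z *\<^sub>R drift z) \<bullet> v" for z
      by (simp add: inner_add_left inner_diff_left drift_def)
    have i1: "integrable lborel (\<lambda>z. \<beta> * ((dens z *\<^sub>R ?g z) \<bullet> v))"
      by (intro integrable_mult_right integrable_inner_left ig)
    have i2: "integrable lborel (\<lambda>z. (?k z *\<^sub>R drift z) \<bullet> v)"
      by (intro integrable_inner_left ikF)
    have "(\<integral>z. ?G' z \<bullet> v \<partial>lborel) = 0"
      by (rule integral_directional_derivative_eq_0[OF dG ikd])
         (unfold eq, intro Bochner_Integration.integrable_diff i1 i2)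
    then have "(\<integral>z. (?k z *\<^sub>R drift z) \<bullet> v \<partial>lborel) = \<beta> * (\<integral>z. (dens z *\<^sub>R ?g z) \<bullet> v \<partial>lborel)"
      unfolding eq Bochner_Integration.integral_diff[OF i1 i2] by simp
    then have "(\<integral>z. ?k z *\<^sub>R drift z \<partial>lborel) \<bullet> v = \<beta> * ((\<integral>z. ?g z \<partial>gam) \<bullet> v)"
      unfolding integral_inner_left[OF ikF] integral_inner_left[OF ig]
      by (subst integral_gam) auto
    then show ?thesis using ab by (simp add: mehler_grad_def)
  qed
  then show ?thesis by (metis vector_eq_rdot)
qed

text \<open>The Fisher integrand is jointly convex in the gradient and the value: it dominates its tangents
  \<open>2 (g \<bullet> C p) - h (p \<bullet> C p)\<close>. Averaging the tangent at the ratio \<open>p\<close> of the means gives Jensen's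
  inequality. The factor \<open>\<alpha>\<^sup>2\<close> comes from commuting the gradient with the averaging.\<close>

lemma fisher_mehler_le:
  assumes ab: "0 < \<beta>" and a: "0 < a" and h: "\<And>x. a \<le> h x" "\<And>x. h x \<le> b"
    and d: "\<And>x. GDERIV h x :> g x"
    and i: "integrable gam (\<lambda>z. fisher h g (\<alpha> *\<^sub>R x + \<beta> *\<^sub>R z))"
  shows "fisher (mehler \<alpha> \<beta> h) (mehler_grad \<alpha> \<beta> h) x
      \<le> \<alpha>\<^sup>2 * (\<integral>z. fisher h g (\<alpha> *\<^sub>R x + \<beta> *\<^sub>R z) \<partial>gam)"
proof -
  have [measurable]: "h \<in> borel_measurable borel"
    by (intro borel_measurable_continuous_onI gderiv_continuous_on[OF d])
  have [measurable]: "g \<in> borel_measurable borel" by (rule gderiv_measurable[OF d])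
  let ?y = "\<lambda>z. \<alpha> *\<^sub>R x + \<beta> *\<^sub>R z"
  have hp: "h x > 0" for x using a h(1)[of x] by simp
  obtain \<kappa> where \<kappa>: "\<kappa> > 0" "\<And>x. \<kappa> * (norm x)\<^sup>2 \<le> x \<bullet> C x"
    by (rule positive_definite_lower_bound[OF linear_C positive_C]) (auto intro: that)
  have gb: "norm (g y) \<le> 1 + b / \<kappa> * fisher h g y" for y
  proof -
    have "(norm (g y))\<^sup>2 \<le> (g y \<bullet> C (g y)) / \<kappa>" using \<kappa> by (simp add: field_simps)
    also have "\<dots> = h y / \<kappa> * fisher h g y" using hp[of y] by (simp add: fisher_def)
    also have "\<dots> \<le> b / \<kappa> * fisher h g y"
      using \<kappa>(1) h(2)[of y] hp[of y] nonneg_C[of "g y"]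
      by (intro mult_right_mono divide_right_mono) (auto simp: fisher_def)
    finally have "(norm (g y))\<^sup>2 \<le> b / \<kappa> * fisher h g y" .
    moreover have "norm (g y) \<le> 1 + (norm (g y))\<^sup>2"
      using zero_le_power2[of "norm (g y) - 1/2"] by (simp add: power2_eq_square algebra_simps)
    ultimately show ?thesis by linarith
  qed
  have ig: "integrable gam (\<lambda>z. g (?y z))"
  proof (rule Bochner_Integration.integrable_bound)
    show "integrable gam (\<lambda>z. 1 + b / \<kappa> * fisher h g (?y z))" using i by simp
    show "AE z in gam. norm (g (?y z)) \<le> norm (1 + b / \<kappa> * fisher h g (?y z))"
      using gb by (auto intro!: AE_I2 order_trans[OF gb] abs_ge_self)
  qed measurable
  have ih: "integrable gam (\<lambda>z. h (?y z))" and H: "a \<le> (\<integral>z. h (?y z) \<partial>gam)"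
    using expectation_between[of "\<lambda>z. h (?y z)" a b] h by auto
  define G where "G = (\<integral>z. g (?y z) \<partial>gam)"
  define H where "H = (\<integral>z. h (?y z) \<partial>gam)"
  have Hp: "H > 0" using H a by (simp add: H_def)
  define p where "p = (1 / H) *\<^sub>R G"
  \<comment> \<open>With this \<open>p\<close> the left-hand side is \<open>(G \<bullet> C G) / H\<close>, the Fisher integrand of the means.\<close>
  have "2 * (G \<bullet> C p) - H * (p \<bullet> C p) = (\<integral>z. 2 * (g (?y z) \<bullet> C p) - h (?y z) * (p \<bullet> C p) \<partial>gam)"
    using ig ih by (simp add: G_def H_def)
  also have "\<dots> \<le> (\<integral>z. fisher h g (?y z) \<partial>gam)"
  proof (rule integral_mono)
    show "integrable gam (\<lambda>z. 2 * (g (?y z) \<bullet> C p) - h (?y z) * (p \<bullet> C p))" using ig ih by simp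
    fix z
    let ?g = "g (?y z)" and ?h = "h (?y z)"
    have "0 \<le> (?g - ?h *\<^sub>R p) \<bullet> C (?g - ?h *\<^sub>R p) / ?h"
      using nonneg_C hp[of "?y z"] by simp
    also have "\<dots> = fisher h g (?y z) - (2 * (?g \<bullet> C p) - ?h * (p \<bullet> C p))"
      using hp[of "?y z"]
      by (simp add: fisher_def C.diff C.scaleR inner_diff_left inner_diff_right
          inner_commute[of p "C ?g"] symmetric_C field_simps)
    finally show "2 * (?g \<bullet> C p) - ?h * (p \<bullet> C p) \<le> fisher h g (?y z)" by simp
  qed (fact i)
  also have "2 * (G \<bullet> C p) - H * (p \<bullet> C p) = (G \<bullet> C G) / H"
    using Hp by (simp add: p_def C.scaleR field_simps)
  finally have "\<alpha>\<^sup>2 * ((G \<bullet> C G) / H) \<le> \<alpha>\<^sup>2 * (\<integral>z. fisher h g (?y z) \<partial>gam)"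
    by (intro mult_left_mono) auto
  moreover have "fisher (mehler \<alpha> \<beta> h) (mehler_grad \<alpha> \<beta> h) x = \<alpha>\<^sup>2 * ((G \<bullet> C G) / H)"
    by (simp add: fisher_def mehler_grad_eq[OF ab a h d ig] mehler_def G_def[symmetric] H_def[symmetric]
        C.scaleR power2_eq_square)
  ultimately show ?thesis by simp
qed

text \<open>The smoothed functions satisfy the inequality, smoothing does not increase the mean Fisher
  integrand because \<open>gam\<close> is invariant, and as \<open>\<alpha>\<close> tends to \<open>1\<close> the entropies converge.\<close>

lemma log_sobolev_bounded:
  assumes a: "0 < a" and h: "\<And>x. a \<le> h x" "\<And>x. h x \<le> b"
    and d: "\<And>x. GDERIV h x :> g x" and i: "integrable gam (fisher h g)"
  shows "Ent gam h \<le> 1/2 * (\<integral>z. fisher h g z \<partial>gam)"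
proof -
  have hc: "continuous_on UNIV h" by (rule gderiv_continuous_on[OF d])
  then have [measurable]: "h \<in> borel_measurable borel" by (rule borel_measurable_continuous_onI)
  define \<alpha> where "\<alpha> n = 1 - inverse (real (Suc n) + 1)" for n
  define \<beta> where "\<beta> n = sqrt (1 - (\<alpha> n)\<^sup>2)" for n
  have \<alpha>: "0 < \<alpha> n" "\<alpha> n < 1" for n by (auto simp: \<alpha>_def field_simps)
  have \<alpha>2: "(\<alpha> n)\<^sup>2 < 1" for n using \<alpha>[of n] by (simp add: power_less_one_iff abs_square_less_1)
  have \<beta>: "0 < \<beta> n" "(\<alpha> n)\<^sup>2 + (\<beta> n)\<^sup>2 = 1" for n using \<alpha>2[of n] by (simp_all add: \<beta>_def)
  have \<alpha>lim: "\<alpha> \<longlonglongrightarrow> 1"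
  proof -
    have "(\<lambda>n. 1 - inverse (real (Suc (Suc n)))) \<longlonglongrightarrow> 1 - 0"
      by (rule tendsto_diff[OF tendsto_const LIMSEQ_Suc[OF LIMSEQ_inverse_real_of_nat]])
    then show ?thesis by (simp add: \<alpha>_def[abs_def] add.commute)
  qed
  have \<beta>lim: "\<beta> \<longlonglongrightarrow> 0"
  proof -
    have "(\<lambda>n. sqrt (1 - (\<alpha> n)\<^sup>2)) \<longlonglongrightarrow> sqrt (1 - 1\<^sup>2)" by (intro tendsto_intros \<alpha>lim)
    then show ?thesis by (simp add: \<beta>_def[abs_def])
  qed
  define S where "S n = mehler (\<alpha> n) (\<beta> n) h" for n
  have regular: "\<exists>L. regular a b L (S n) (mehler_grad (\<alpha> n) (\<beta> n) h)" for n
    unfolding S_def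
    by (rule mehler_regular[OF less_imp_le[OF \<alpha>(1)[of n]] \<beta>(1)[of n] a h]) auto
  have bound: "Ent gam (S n) \<le> 1/2 * (\<integral>z. fisher h g z \<partial>gam)" for n
  proof -
    from regular obtain L where L: "regular a b L (S n) (mehler_grad (\<alpha> n) (\<beta> n) h)" ..
    have b0: "\<beta> n \<noteq> 0" using \<beta>(1)[of n] by simp
    note rot = integral_rotation[OF \<beta>(2) b0 i]
    have "Ent gam (S n) \<le> 1/2 * (\<integral>x. fisher (S n) (mehler_grad (\<alpha> n) (\<beta> n) h) x \<partial>gam)"
      by (rule log_sobolev_regular[OF L])
    also have "(\<integral>x. fisher (S n) (mehler_grad (\<alpha> n) (\<beta> n) h) x \<partial>gam)
        \<le> (\<integral>x. (\<alpha> n)\<^sup>2 * (\<integral>z. fisher h g (\<alpha> n *\<^sub>R x + \<beta> n *\<^sub>R z) \<partial>gam) \<partial>gam)"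
    proof (rule integral_mono_AE)
      show "integrable gam (fisher (S n) (mehler_grad (\<alpha> n) (\<beta> n) h))"
        using fisher_integrable[OF L, of 0 1] by simp
      show "integrable gam (\<lambda>x. (\<alpha> n)\<^sup>2 * (\<integral>z. fisher h g (\<alpha> n *\<^sub>R x + \<beta> n *\<^sub>R z) \<partial>gam))"
        by (intro integrable_mult_right rot(3))
      from rot(2) show "AE x in gam. fisher (S n) (mehler_grad (\<alpha> n) (\<beta> n) h) x
          \<le> (\<alpha> n)\<^sup>2 * (\<integral>z. fisher h g (\<alpha> n *\<^sub>R x + \<beta> n *\<^sub>R z) \<partial>gam)"
        unfolding S_def by eventually_elim (rule fisher_mehler_le[OF \<beta>(1) a h d])
    qed
    also have "\<dots> = (\<alpha> n)\<^sup>2 * (\<integral>z. fisher h g z \<partial>gam)" by (simp add: rot(1))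
    also have "\<dots> \<le> 1 * (\<integral>z. fisher h g z \<partial>gam)"
    proof (rule mult_right_mono)
      have "0 \<le> fisher h g z" for z
        using nonneg_C[of "g z"] a h(1)[of z] by (simp add: fisher_def)
      then show "0 \<le> (\<integral>z. fisher h g z \<partial>gam)" by simp
    qed (use \<alpha>2[of n] in simp)
    finally show ?thesis by simp
  qed
  have lim: "(\<lambda>n. S n x) \<longlonglongrightarrow> h x" for x
  proof -
    have "(\<lambda>n. \<integral>z. h (\<alpha> n *\<^sub>R x + \<beta> n *\<^sub>R z) \<partial>gam) \<longlonglongrightarrow> (\<integral>z. h x \<partial>gam)"
    proof (rule integral_dominated_convergence[where w="\<lambda>_. b"])
      show "AE z in gam. (\<lambda>n. h (\<alpha> n *\<^sub>R x + \<beta> n *\<^sub>R z)) \<longlonglongrightarrow> h x"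
      proof (rule AE_I2)
        fix z
        have "(\<lambda>n. \<alpha> n *\<^sub>R x + \<beta> n *\<^sub>R z) \<longlonglongrightarrow> 1 *\<^sub>R x + 0 *\<^sub>R z"
          by (intro tendsto_intros \<alpha>lim \<beta>lim)
        from continuous_on_tendsto_compose[OF hc this]
        show "(\<lambda>n. h (\<alpha> n *\<^sub>R x + \<beta> n *\<^sub>R z)) \<longlonglongrightarrow> h x" by simp
      qed
      show "AE z in gam. norm (h (\<alpha> n *\<^sub>R x + \<beta> n *\<^sub>R z)) \<le> b" for n
      proof (rule AE_I2)
        show "norm (h y) \<le> b" for y using h[of y] a by simp
      qed
    qed auto
    then show ?thesis using prob_space by (simp add: S_def mehler_def)
  qed
  have "(\<lambda>n. Ent gam (S n)) \<longlonglongrightarrow> Ent gam h"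
  proof (rule Ent_tendsto[where a=a and b=b])
    fix n
    from regular obtain L where L: "regular a b L (S n) (mehler_grad (\<alpha> n) (\<beta> n) h)" ..
    then show "S n \<in> borel_measurable gam" using regular_measurable(1)[OF L] by simp
    show "a \<le> S n x" "S n x \<le> b" for x using L by (auto simp: regular_def)
  qed (use a lim in auto)
  then show ?thesis by (rule LIMSEQ_le_const2) (use bound in auto)
qed

end

section \<open>Truncation and the general logarithmic Sobolev inequality\<close>

text \<open>\<open>psi (h x)\<close> integrates to the entropy of \<open>h\<close> when \<open>h\<close> has mean \<open>1\<close>; unlike \<open>h x * ln (h x)\<close> it is
  nonnegative, as needed for Fatou's lemma.\<close>

definition psi :: "real \<Rightarrow> real" where "psi u = u * ln u - u + 1"

lemma psi_nonneg: "0 \<le> u \<Longrightarrow> 0 \<le> psi u"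
proof (cases "u = 0")
  case False
  assume "0 \<le> u"
  then have u: "u > 0" using False by simp
  then have "ln (1 / u) \<le> 1 / u - 1" by (intro ln_le_minus_one) simp
  then have "u * ln (1 / u) \<le> u * (1 / u - 1)" using u by (intro mult_left_mono) auto
  then show ?thesis using u by (simp add: psi_def ln_div algebra_simps)
qed (simp add: psi_def)

lemma psi_measurable [measurable]: "psi \<in> borel_measurable borel"
  unfolding psi_def[abs_def] by measurable

text \<open>With \<open>k = n + 1\<close>, the quotient \<open>u / (1 + u / k)\<close> is the parallel sum \<open>u k / (u + k)\<close>, bounded by
  \<open>k\<close>, and the summand \<open>1 / k\<close> keeps the function away from \<open>0\<close>.\<close>

definition trunc :: "nat \<Rightarrow> real \<Rightarrow> real" where
  "trunc n u = u / (1 + u / real (Suc n)) + 1 / real (Suc n)"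

lemma trunc_bounds:
  assumes "0 \<le> u"
  shows "1 / real (Suc n) \<le> trunc n u" "trunc n u \<le> real (Suc n) + 1 / real (Suc n)" "trunc n u \<le> u + 1"
proof -
  have d: "1 + u / real (Suc n) \<ge> 1" using assms by simp
  show "1 / real (Suc n) \<le> trunc n u" using assms d by (simp add: trunc_def)
  have "u \<le> real (Suc n) * (1 + u / real (Suc n))" by (simp add: field_simps)
  then have "u / (1 + u / real (Suc n)) \<le> real (Suc n)" using d by (simp add: pos_divide_le_eq)
  then show "trunc n u \<le> real (Suc n) + 1 / real (Suc n)" by (simp add: trunc_def)
  have "u / (1 + u / real (Suc n)) \<le> u / 1" by (rule frac_le) (use assms d in auto)
  moreover have "1 / real (Suc n) \<le> 1" by simp
  ultimately show "trunc n u \<le> u + 1" unfolding trunc_def by linarith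
qed

lemma trunc_deriv:
  assumes "0 \<le> u"
  shows "(trunc n has_real_derivative 1 / (1 + u / real (Suc n))\<^sup>2) (at u)"
proof -
  have d: "1 + u / real (Suc n) > 0" using assms by (simp add: add_pos_nonneg)
  have "((\<lambda>u. u / (1 + u / real (Suc n)) + 1 / real (Suc n)) has_real_derivative
     (1 * (1 + u / real (Suc n)) - u * (0 + 1 / real (Suc n))) / ((1 + u / real (Suc n)) * (1 + u / real (Suc n))) + 0) (at u)"
    using d by (intro DERIV_add DERIV_divide DERIV_cdivide DERIV_const DERIV_ident) auto
  then show ?thesis using d by (simp add: trunc_def[abs_def] power2_eq_square)
qed

text \<open>By the chain rule this is what prevents truncation from increasing the Fisher integrand.\<close>

lemma trunc_deriv_le:
  assumes "0 < u"
  shows "(1 / (1 + u / real (Suc n))\<^sup>2)\<^sup>2 / trunc n u \<le> 1 / u"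
proof -
  define e where "e = 1 + u / real (Suc n)"
  have e: "e \<ge> 1" using assms by (simp add: e_def)
  have t: "u / e \<le> trunc n u" by (simp add: trunc_def e_def)
  have ue: "0 < u / e" using assms e by simp
  have "(1 / e\<^sup>2)\<^sup>2 / trunc n u \<le> (1 / e\<^sup>2)\<^sup>2 / (u / e)"
    by (rule frac_le[OF _ order_refl ue t]) simp
  also have "\<dots> = (1 / e ^ 3) / u"
    using e assms by (simp add: field_simps power2_eq_square power3_eq_cube)
  also have "\<dots> \<le> 1 / u"
    using e assms by (intro divide_right_mono) (auto simp: one_le_power)
  finally show ?thesis by (simp add: e_def)
qed

lemma trunc_tendsto: "(\<lambda>n. trunc n u) \<longlonglongrightarrow> u"
proof -
  have "(\<lambda>n. u / (1 + u * inverse (real (Suc n))) + inverse (real (Suc n))) \<longlonglongrightarrow> u / (1 + u * 0) + 0"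
    by (intro tendsto_add tendsto_divide tendsto_mult tendsto_const LIMSEQ_inverse_real_of_nat) simp
  then show ?thesis by (simp add: trunc_def divide_inverse)
qed

lemma psi_trunc_tendsto:
  assumes "0 \<le> u"
  shows "(\<lambda>n. psi (trunc n u)) \<longlonglongrightarrow> psi u"
proof (cases "u = 0")
  case True
  have "(\<lambda>n. ln (real (Suc n)) / real (Suc n)) \<longlonglongrightarrow> 0"
    using LIMSEQ_Suc[OF lim_ln_over_n] by simp
  moreover have "trunc n 0 * ln (trunc n 0) = - (ln (real (Suc n)) / real (Suc n))" for n
    by (simp add: trunc_def ln_div)
  ultimately have "(\<lambda>n. trunc n 0 * ln (trunc n 0)) \<longlonglongrightarrow> - 0"
    using tendsto_minus by fastforce
  then have "(\<lambda>n. trunc n 0 * ln (trunc n 0) - trunc n 0 + 1) \<longlonglongrightarrow> - 0 - 0 + 1"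
    by (intro tendsto_add tendsto_diff trunc_tendsto tendsto_const)
  then show ?thesis using True by (simp add: psi_def)
next
  case False
  then show ?thesis unfolding psi_def by (intro tendsto_intros trunc_tendsto)
qed

context centered_gaussian begin

text \<open>Truncation makes \<open>h\<close> bounded above and away from \<open>0\<close> without increasing the Fisher integrand. The
  truncated functions have means \<open>m n\<close> tending to \<open>1\<close>, which accounts for the extra \<open>psi (m n)\<close>, and
  Fatou's lemma recovers \<open>h\<close>.\<close>

lemma log_sobolev:
  assumes h: "\<And>x. 0 \<le> h x" and d: "\<And>x. GDERIV h x :> g x"
    and ih: "integrable gam h" and h1: "(\<integral>x. h x \<partial>gam) = 1"
    and i: "integrable gam (fisher h g)"
  shows "(\<integral>\<^sup>+x. ennreal (psi (h x)) \<partial>gam) \<le> ennreal (1/2 * (\<integral>z. fisher h g z \<partial>gam))"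
proof -
  have [measurable]: "h \<in> borel_measurable borel"
    by (intro borel_measurable_continuous_onI gderiv_continuous_on[OF d])
  have [measurable]: "g \<in> borel_measurable borel" by (rule gderiv_measurable[OF d])
  let ?I = "1/2 * (\<integral>z. fisher h g z \<partial>gam)"
  define H where "H n x = trunc n (h x)" for n x
  define G where "G n x = (1 / (1 + h x / real (Suc n))\<^sup>2) *\<^sub>R g x" for n x
  define m where "m n = (\<integral>x. H n x \<partial>gam)" for n
  have dH: "GDERIV (H n) x :> G n x" for n x
    unfolding H_def[abs_def] G_def by (rule GDERIV_DERIV_compose[OF d trunc_deriv[OF h]])
  have [measurable]: "H n \<in> borel_measurable borel" for n
    by (intro borel_measurable_continuous_onI gderiv_continuous_on[OF dH])
  have [measurable]: "G n \<in> borel_measurable borel" for n by (rule gderiv_measurable[OF dH])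
  have a: "0 < 1 / real (Suc n)" for n by simp
  have Hb: "1 / real (Suc n) \<le> H n x" "H n x \<le> real (Suc n) + 1 / real (Suc n)" "H n x \<le> h x + 1" for n x
    unfolding H_def by (rule trunc_bounds[OF h])+
  have Hp: "H n x > 0" for n x using Hb(1)[of n x] a[of n] by linarith
  have f0: "0 \<le> fisher h g x" for x using nonneg_C[of "g x"] h[of x] by (simp add: fisher_def)
  have fle: "fisher (H n) (G n) x \<le> fisher h g x" for n x
  proof (cases "h x = 0")
    case True
    have "g x = 0" by (rule gderiv_at_zero_of_nonneg[OF h d True])
    then show ?thesis by (simp add: fisher_def G_def C.zero)
  next
    case False
    then have hx: "h x > 0" using h[of x] by simp
    have "fisher (H n) (G n) x = (1 / (1 + h x / real (Suc n))\<^sup>2)\<^sup>2 / trunc n (h x) * (g x \<bullet> C (g x))"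
      unfolding fisher_def G_def C.scaleR H_def by (simp add: power2_eq_square)
    also have "\<dots> \<le> 1 / h x * (g x \<bullet> C (g x))"
      by (intro mult_right_mono trunc_deriv_le[OF hx] nonneg_C)
    finally show ?thesis by (simp add: fisher_def)
  qed
  have fH0: "0 \<le> fisher (H n) (G n) x" for n x
    using nonneg_C[of "G n x"] Hp[of n x] by (simp add: fisher_def)
  have iH: "integrable gam (fisher (H n) (G n))" for n
  proof (rule Bochner_Integration.integrable_bound[OF i])
    show "AE x in gam. norm (fisher (H n) (G n) x) \<le> norm (fisher h g x)"
      using fle fH0 f0 by simp
  qed (use fisher_measurable in simp)
  have psiH: "integrable gam (\<lambda>x. psi (H n x))"
    "(\<integral>x. psi (H n x) \<partial>gam) = Ent gam (H n) + psi (m n)" for n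
  proof -
    have i1: "integrable gam (H n)" by (rule expectation_between(1)[OF _ Hb(1,2)]) simp
    have i2: "integrable gam (\<lambda>x. H n x * ln (H n x))"
      by (rule integrable_mult_ln[OF _ a Hb(1,2)]) simp
    show "integrable gam (\<lambda>x. psi (H n x))" unfolding psi_def using i1 i2 by simp
    show "(\<integral>x. psi (H n x) \<partial>gam) = Ent gam (H n) + psi (m n)"
      unfolding psi_def Ent_def m_def using i1 i2 prob_space by simp
  qed
  have mlim: "m \<longlonglongrightarrow> 1"
    unfolding m_def[abs_def] h1[symmetric]
  proof (rule integral_dominated_convergence[where w="\<lambda>x. h x + 1"])
    show "AE x in gam. (\<lambda>n. H n x) \<longlonglongrightarrow> h x" unfolding H_def using trunc_tendsto by simp
    show "AE x in gam. norm (H n x) \<le> h x + 1" for n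
      using Hb(3) less_imp_le[OF Hp] by simp
  qed (use ih in auto)
  have bound: "(\<integral>\<^sup>+x. ennreal (psi (H n x)) \<partial>gam) \<le> ennreal (?I + psi (m n))" for n
  proof -
    have "(\<integral>\<^sup>+x. ennreal (psi (H n x)) \<partial>gam) = ennreal (\<integral>x. psi (H n x) \<partial>gam)"
      by (rule nn_integral_eq_integral[OF psiH(1)]) (use psi_nonneg less_imp_le[OF Hp] in auto)
    also have "\<dots> \<le> ennreal (?I + psi (m n))"
    proof (rule ennreal_leI)
      have "Ent gam (H n) \<le> 1/2 * (\<integral>z. fisher (H n) (G n) z \<partial>gam)"
        by (rule log_sobolev_bounded[OF a Hb(1,2) dH iH])
      also have "\<dots> \<le> ?I" by (intro mult_left_mono integral_mono iH i fle) simp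
      finally show "(\<integral>x. psi (H n x) \<partial>gam) \<le> ?I + psi (m n)" by (simp add: psiH(2))
    qed
    finally show ?thesis .
  qed
  have "(\<integral>\<^sup>+x. ennreal (psi (h x)) \<partial>gam) = (\<integral>\<^sup>+x. liminf (\<lambda>n. ennreal (psi (H n x))) \<partial>gam)"
  proof (rule nn_integral_cong)
    fix x
    have "(\<lambda>n. ennreal (psi (H n x))) \<longlonglongrightarrow> ennreal (psi (h x))"
      unfolding H_def by (intro tendsto_ennrealI psi_trunc_tendsto h)
    then show "ennreal (psi (h x)) = liminf (\<lambda>n. ennreal (psi (H n x)))"
      by (rule lim_imp_Liminf[symmetric, rotated]) simp
  qed
  also have "\<dots> \<le> liminf (\<lambda>n. \<integral>\<^sup>+x. ennreal (psi (H n x)) \<partial>gam)"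
    by (rule nn_integral_liminf) measurable
  also have "\<dots> \<le> liminf (\<lambda>n. ennreal (?I + psi (m n)))"
    by (intro Liminf_mono always_eventually allI bound)
  also have "\<dots> = ennreal ?I"
  proof (rule lim_imp_Liminf)
    have "(\<lambda>n. ?I + psi (m n)) \<longlonglongrightarrow> ?I + psi 1"
      unfolding psi_def by (intro tendsto_intros mlim) simp
    then show "(\<lambda>n. ennreal (?I + psi (m n))) \<longlonglongrightarrow> ennreal ?I"
      by (intro tendsto_ennrealI) (simp add: psi_def)
  qed simp
  finally show ?thesis .
qed

end

section \<open>Scores, relative entropy and total variation\<close>

lemma norm_square_eq_sum: "(norm (x :: 'a::euclidean_space))\<^sup>2 = (\<Sum>b\<in>Basis. (x \<bullet> b) * (x \<bullet> b))"
  unfolding power2_norm_eq_inner by (rule euclidean_inner)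

lemma integrable_weighted_inner:
  fixes u v :: "'b \<Rightarrow> 'a::euclidean_space"
  assumes "\<And>x. 0 \<le> f x" "integrable M (\<lambda>x. f x * (norm (u x))\<^sup>2)" "integrable M (\<lambda>x. f x * (norm (v x))\<^sup>2)"
    and [measurable]: "f \<in> borel_measurable M" "u \<in> borel_measurable M" "v \<in> borel_measurable M"
  shows "integrable M (\<lambda>x. f x * ((u x \<bullet> p) * (v x \<bullet> q)))"
proof (rule Bochner_Integration.integrable_bound)
  let ?K = "norm p * norm q"
  show "integrable M (\<lambda>x. ?K * (f x * (norm (u x))\<^sup>2 + f x * (norm (v x))\<^sup>2))"
    using assms by simp
  have "\<bar>f x * ((u x \<bullet> p) * (v x \<bullet> q))\<bar> \<le> ?K * (f x * (norm (u x))\<^sup>2 + f x * (norm (v x))\<^sup>2)" for x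
  proof -
    have "\<bar>u x \<bullet> p\<bar> * \<bar>v x \<bullet> q\<bar> \<le> (norm (u x) * norm p) * (norm (v x) * norm q)"
      by (intro mult_mono Cauchy_Schwarz_ineq2) auto
    also have "\<dots> = ?K * (norm (u x) * norm (v x))" by simp
    also have "\<dots> \<le> ?K * ((norm (u x))\<^sup>2 + (norm (v x))\<^sup>2)"
    proof (rule mult_left_mono)
      have "2 * (norm (u x) * norm (v x)) \<le> (norm (u x))\<^sup>2 + (norm (v x))\<^sup>2"
        using sum_squares_bound[of "norm (u x)" "norm (v x)"] by simp
      moreover have "0 \<le> norm (u x) * norm (v x)" by simp
      ultimately show "norm (u x) * norm (v x) \<le> (norm (u x))\<^sup>2 + (norm (v x))\<^sup>2" by linarith
    qed simp
    finally have "f x * (\<bar>u x \<bullet> p\<bar> * \<bar>v x \<bullet> q\<bar>) \<le> f x * (?K * ((norm (u x))\<^sup>2 + (norm (v x))\<^sup>2))"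
      using assms(1) by (intro mult_left_mono) auto
    then show ?thesis using assms(1)[of x] by (simp add: abs_mult algebra_simps)
  qed
  then show "AE x in M. norm (f x * ((u x \<bullet> p) * (v x \<bullet> q)))
      \<le> norm (?K * (f x * (norm (u x))\<^sup>2 + f x * (norm (v x))\<^sup>2))"
    by (auto intro!: AE_I2 order_trans[OF _ abs_ge_self])
qed measurable

subsection \<open>Densities with finite Fisher information\<close>

locale finite_fisher_density =
  fixes f :: "'a::euclidean_space \<Rightarrow> real" and s :: "'a \<Rightarrow> 'a"
  assumes f_nonneg: "0 \<le> f x"
    and gderiv_f: "GDERIV f x :> f x *\<^sub>R s x"
    and measurable_s [measurable]: "s \<in> borel_measurable borel"
    and integrable_f: "integrable lborel f" and integral_f: "(\<integral>x. f x \<partial>lborel) = 1"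
    and integrable_x: "integrable lborel (\<lambda>x. f x * (norm x)\<^sup>2)"
    and integrable_s: "integrable lborel (\<lambda>x. f x * (norm (s x))\<^sup>2)"
begin

lemma measurable_f [measurable]: "f \<in> borel_measurable borel"
  by (intro borel_measurable_continuous_onI gderiv_continuous_on[OF gderiv_f])

lemma integrable_score_inner:
  "integrable lborel (\<lambda>x. f x * ((s x \<bullet> u) * (x \<bullet> v)))"
  by (rule integrable_weighted_inner[where u=s and v="\<lambda>x. x"])
     (simp_all add: f_nonneg integrable_s integrable_x)

text \<open>The score is characterised by integration by parts; here the test function is linear.\<close>

lemma expectation_score_inner: "(\<integral>x. f x * ((s x \<bullet> u) * (x \<bullet> v)) \<partial>lborel) = - (u \<bullet> v)"
proof -
  let ?g' = "\<lambda>x. (x \<bullet> v) *\<^sub>R (f x *\<^sub>R s x) + f x *\<^sub>R v"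
  have d: "GDERIV (\<lambda>x. (x \<bullet> v) * f x) x :> ?g' x" for x
  proof (rule GDERIV_mult[OF _ gderiv_f])
    show "GDERIV (\<lambda>x. x \<bullet> v) x :> v"
      unfolding gderiv_def by (intro bounded_linear_imp_has_derivative bounded_linear_inner_left)
  qed
  have eq: "?g' x \<bullet> u = f x * ((s x \<bullet> u) * (x \<bullet> v)) + f x * (u \<bullet> v)" for x
    by (simp add: inner_add_left inner_commute[of v u])
  have i2: "integrable lborel (\<lambda>x. f x * (u \<bullet> v))" using integrable_f by simp
  have "integrable lborel (\<lambda>x. (x \<bullet> v) * f x)"
  proof (rule Bochner_Integration.integrable_bound)
    show "integrable lborel (\<lambda>x. norm v * (f x + f x * (norm x)\<^sup>2))"
      using integrable_f integrable_x by simp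
    have "\<bar>(x \<bullet> v) * f x\<bar> \<le> norm v * (f x + f x * (norm x)\<^sup>2)" for x
    proof -
      have "norm x \<le> 1 + (norm x)\<^sup>2"
        using zero_le_power2[of "norm x - 1/2"] by (simp add: power2_eq_square algebra_simps)
      then have "norm x * norm v \<le> (1 + (norm x)\<^sup>2) * norm v" by (intro mult_right_mono) auto
      then have "\<bar>x \<bullet> v\<bar> \<le> (1 + (norm x)\<^sup>2) * norm v" using Cauchy_Schwarz_ineq2[of x v] by linarith
      then have "\<bar>x \<bullet> v\<bar> * f x \<le> ((1 + (norm x)\<^sup>2) * norm v) * f x"
        using f_nonneg by (intro mult_right_mono) auto
      then show ?thesis using f_nonneg[of x] by (simp add: abs_mult algebra_simps)
    qed
    then show "AE x in lborel. norm ((x \<bullet> v) * f x) \<le> norm (norm v * (f x + f x * (norm x)\<^sup>2))"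
      by (auto intro!: AE_I2 order_trans[OF _ abs_ge_self])
  qed measurable
  then have "(\<integral>x. ?g' x \<bullet> u \<partial>lborel) = 0"
    by (rule integral_directional_derivative_eq_0[OF d])
       (unfold eq, intro Bochner_Integration.integrable_add integrable_score_inner i2)
  then show ?thesis
    unfolding eq Bochner_Integration.integral_add[OF integrable_score_inner i2]
    by (simp add: integral_f)
qed

end

locale density_vs_gaussian = centered_gaussian A C c + finite_fisher_density f s
  for A C :: "'a::euclidean_space \<Rightarrow> 'a" and c f s +
  assumes covariance_f: "(\<integral>x. f x * ((x \<bullet> u) * (x \<bullet> v)) \<partial>lborel) = u \<bullet> C v"
begin

text \<open>The score paired with \<open>A x\<close> has mean \<open>- tr A\<close> by integration by parts, and \<open>\<bar>A x\<bar>\<^sup>2\<close> has mean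
  \<open>tr (A C A) = tr A\<close>; here \<open>tr A\<close> is written as a sum over the basis.\<close>

lemma integrable_relative_score:
  "integrable lborel (\<lambda>x. f x * (norm (s x + A x))\<^sup>2)"
  "(\<integral>x. f x * (norm (s x + A x))\<^sup>2 \<partial>lborel)
    = (\<integral>x. f x * (norm (s x))\<^sup>2 \<partial>lborel) - (\<Sum>b\<in>Basis. b \<bullet> A b)"
proof -
  have eq: "f x * (norm (s x + A x))\<^sup>2 = f x * (norm (s x))\<^sup>2
     + (\<Sum>b\<in>Basis. 2 * (f x * ((s x \<bullet> b) * (x \<bullet> A b))) + f x * ((x \<bullet> A b) * (x \<bullet> A b)))" for x
  proof -
    have "(norm (s x + A x))\<^sup>2
      = (\<Sum>b\<in>Basis. (s x \<bullet> b) * (s x \<bullet> b) + (2 * ((s x \<bullet> b) * (x \<bullet> A b)) + (x \<bullet> A b) * (x \<bullet> A b)))"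
      unfolding norm_square_eq_sum by (simp add: inner_add_left symmetric_A algebra_simps)
    then have "f x * (norm (s x + A x))\<^sup>2 = (\<Sum>b\<in>Basis. f x * ((s x \<bullet> b) * (s x \<bullet> b)
        + (2 * ((s x \<bullet> b) * (x \<bullet> A b)) + (x \<bullet> A b) * (x \<bullet> A b))))"
      by (simp only: sum_distrib_left)
    also have "\<dots> = (\<Sum>b\<in>Basis. f x * ((s x \<bullet> b) * (s x \<bullet> b))
        + (2 * (f x * ((s x \<bullet> b) * (x \<bullet> A b))) + f x * ((x \<bullet> A b) * (x \<bullet> A b))))"
      by (rule sum.cong) (simp_all add: algebra_simps)
    finally show ?thesis
      by (simp only: sum.distrib norm_square_eq_sum[of "s x"] sum_distrib_left)
  qed
  have i1: "integrable lborel (\<lambda>x. f x * ((x \<bullet> u) * (x \<bullet> v)))" for u v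
    by (rule integrable_weighted_inner[where u="\<lambda>x. x" and v="\<lambda>x. x"])
       (simp_all add: f_nonneg integrable_x)
  show "integrable lborel (\<lambda>x. f x * (norm (s x + A x))\<^sup>2)"
    unfolding eq using integrable_s i1 integrable_score_inner by simp
  show "(\<integral>x. f x * (norm (s x + A x))\<^sup>2 \<partial>lborel)
    = (\<integral>x. f x * (norm (s x))\<^sup>2 \<partial>lborel) - (\<Sum>b\<in>Basis. b \<bullet> A b)"
    unfolding eq using integrable_s i1 integrable_score_inner
    by (simp add: expectation_score_inner covariance_f symmetric_A sum_negf)
qed

text \<open>The density \<open>f / dens\<close> with respect to the Gaussian has score \<open>s x + A x\<close>, and its Fisher
  information is measured by the covariance form \<open>C\<close>.\<close>

lemma entropy_le_relative_score:
  "(\<integral>\<^sup>+x. ennreal (dens x * psi (f x / dens x)) \<partial>lborel)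
    \<le> ennreal (1/2 * (\<integral>x. f x * ((s x + A x) \<bullet> C (s x + A x)) \<partial>lborel))"
proof -
  define h where "h x = f x / dens x" for x
  define g where "g x = h x *\<^sub>R (s x + A x)" for x
  have [measurable]: "h \<in> borel_measurable borel" "g \<in> borel_measurable borel"
    unfolding g_def[abs_def] h_def[abs_def] by measurable
  have h0: "0 \<le> h x" for x by (simp add: h_def f_nonneg)
  have fh: "dens x * h x = f x" for x using dens_pos[of x] by (simp add: h_def)
  have d: "GDERIV h x :> g x" for x
  proof -
    have "GDERIV (\<lambda>x. inverse (dens x)) x :> - (inverse (dens x))\<^sup>2 *\<^sub>R (- (dens x *\<^sub>R A x))"
      using dens_pos[of x] by (intro GDERIV_inverse gderiv_dens) simp
    from GDERIV_mult[OF gderiv_f this]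
    have "GDERIV h x :> f x *\<^sub>R (- (inverse (dens x))\<^sup>2 *\<^sub>R (- (dens x *\<^sub>R A x)))
        + inverse (dens x) *\<^sub>R (f x *\<^sub>R s x)"
      by (simp add: h_def[abs_def] divide_inverse)
    also have "f x *\<^sub>R (- (inverse (dens x))\<^sup>2 *\<^sub>R (- (dens x *\<^sub>R A x)))
        + inverse (dens x) *\<^sub>R (f x *\<^sub>R s x) = g x"
      using dens_pos[of x]
      by (simp add: g_def h_def scaleR_add_right divide_inverse power2_eq_square mult.commute)
    finally show ?thesis .
  qed
  have ih: "integrable gam h" "(\<integral>x. h x \<partial>gam) = 1"
    by (simp_all add: integrable_gam integral_gam fh integrable_f integral_f)
  have fisher_eq: "dens x * fisher h g x = f x * ((s x + A x) \<bullet> C (s x + A x))" for x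
  proof (cases "h x = 0")
    case True
    then show ?thesis using fh[of x] by (simp add: fisher_def g_def C.zero)
  next
    case False
    then have "fisher h g x = h x * ((s x + A x) \<bullet> C (s x + A x))"
      by (simp add: fisher_def g_def C.scaleR)
    then show ?thesis by (simp add: fh[symmetric])
  qed
  obtain B where B: "B > 0" "\<And>v. norm (C v) \<le> B * norm v" by (rule norm_C_bound) (rule that)
  have iF: "integrable lborel (\<lambda>x. dens x * fisher h g x)"
  proof (rule Bochner_Integration.integrable_bound)
    show "integrable lborel (\<lambda>x. B * (f x * (norm (s x + A x))\<^sup>2))"
      by (intro integrable_mult_right integrable_relative_score)
    have "\<bar>f x * (v \<bullet> C v)\<bar> \<le> B * (f x * (norm v)\<^sup>2)" for v x
    proof -
      have "\<bar>v \<bullet> C v\<bar> \<le> norm v * (B * norm v)"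
        using Cauchy_Schwarz_ineq2[of v "C v"] B(2)[of v]
        by (meson mult_left_mono norm_ge_zero order_trans)
      then have "f x * \<bar>v \<bullet> C v\<bar> \<le> f x * (norm v * (B * norm v))"
        using f_nonneg by (intro mult_left_mono)
      then show ?thesis using f_nonneg[of x] by (simp add: abs_mult power2_eq_square ac_simps)
    qed
    then show "AE x in lborel. norm (dens x * fisher h g x) \<le> norm (B * (f x * (norm (s x + A x))\<^sup>2))"
      unfolding fisher_eq by (auto intro!: AE_I2 order_trans[OF _ abs_ge_self])
  qed (use fisher_measurable[of h g] in simp)
  have i: "integrable gam (fisher h g)"
    using iF by (simp add: integrable_gam fisher_measurable)
  have "(\<integral>\<^sup>+x. ennreal (dens x * psi (f x / dens x)) \<partial>lborel) = (\<integral>\<^sup>+x. ennreal (psi (h x)) \<partial>gam)"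
    by (simp add: nn_integral_gam h_def[symmetric] ennreal_mult')
  also have "\<dots> \<le> ennreal (1/2 * (\<integral>x. fisher h g x \<partial>gam))"
    by (rule log_sobolev[OF h0 d ih i])
  also have "(\<integral>x. fisher h g x \<partial>gam) = (\<integral>x. f x * ((s x + A x) \<bullet> C (s x + A x)) \<partial>lborel)"
    by (simp add: integral_gam fisher_measurable fisher_eq)
  finally show ?thesis .
qed

end

subsection \<open>Relative entropy and total variation\<close>

lemma ln_ge_ratio:
  fixes u :: real
  shows "1 \<le> u \<Longrightarrow> 2 * (u - 1) \<le> (u + 1) * ln u"
    and "0 < u \<Longrightarrow> u \<le> 1 \<Longrightarrow> (u + 1) * ln u \<le> 2 * (u - 1)"
proof -
  define k where "k u = ln u - 2 * (u - 1) / (u + 1)" for u :: real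
  have d: "(k has_real_derivative ((t - 1)\<^sup>2 / (t * (t + 1)\<^sup>2))) (at t)" if "0 < t" for t
  proof -
    have "(k has_real_derivative (1 / t - (2 * (t + 1) - 2 * (t - 1)) / ((t + 1) * (t + 1)))) (at t)"
      unfolding k_def[abs_def] using that by (auto intro!: derivative_eq_intros)
    also have "1 / t - (2 * (t + 1) - 2 * (t - 1)) / ((t + 1) * (t + 1)) = (t - 1)\<^sup>2 / (t * (t + 1)\<^sup>2)"
      using that by (simp add: divide_simps power2_eq_square) algebra
    finally show ?thesis .
  qed
  have mono: "k x \<le> k y" if "0 < x" "x \<le> y" for x y
    using that by (intro DERIV_nonneg_imp_nondecreasing[of x y k]) (auto intro!: exI d divide_nonneg_nonneg)
  have k1: "k 1 = 0" by (simp add: k_def)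
  show "2 * (u - 1) \<le> (u + 1) * ln u" if "1 \<le> u"
    using mono[of 1 u] that by (simp add: k1) (simp add: k_def field_simps)
  show "(u + 1) * ln u \<le> 2 * (u - 1)" if "0 < u" "u \<le> 1"
    using mono[of u 1] that by (simp add: k1) (simp add: k_def field_simps)
qed

text \<open>The difference of the two sides vanishes at \<open>1\<close> and has derivative \<open>4 ((u + 1) ln u - 2 (u - 1))\<close>,
  which has the sign of \<open>u - 1\<close>. The weight \<open>(2 u + 4) / 3\<close> integrates to \<open>2\<close> when \<open>u\<close> is a ratio of
  densities; this yields the sharp constant in Pinsker's inequality.\<close>

lemma psi_quadratic_lower_bound:
  assumes "0 \<le> u"
  shows "3 * (u - 1)\<^sup>2 \<le> (2 * u + 4) * psi u"
proof (cases "u = 0")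
  case False
  then have u: "0 < u" using assms by simp
  define G where "G u = (2 * u + 4) * psi u - 3 * (u - 1)\<^sup>2" for u
  have d: "(G has_real_derivative (4 * ((t + 1) * ln t - 2 * (t - 1)))) (at t)" if "0 < t" for t
    unfolding G_def[abs_def] psi_def using that
    by (auto intro!: derivative_eq_intros simp: algebra_simps)
  have G1: "G 1 = 0" by (simp add: G_def psi_def)
  have "0 \<le> G u"
  proof (cases "1 \<le> u")
    case True
    have "G 1 \<le> G u"
    proof (rule DERIV_nonneg_imp_nondecreasing[OF True], intro exI conjI)
      fix t :: real assume t: "1 \<le> t"
      show "(G has_real_derivative (4 * ((t + 1) * ln t - 2 * (t - 1)))) (at t)"
        using t by (intro d) simp
      show "0 \<le> 4 * ((t + 1) * ln t - 2 * (t - 1))" using ln_ge_ratio(1)[OF t] by simp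
    qed
    then show ?thesis by (simp add: G1)
  next
    case False
    then have u1: "u \<le> 1" by simp
    have "G 1 \<le> G u"
    proof (rule DERIV_nonpos_imp_nonincreasing[OF u1], intro exI conjI)
      fix t :: real assume t: "u \<le> t" "t \<le> 1"
      show "(G has_real_derivative (4 * ((t + 1) * ln t - 2 * (t - 1)))) (at t)"
        using t u by (intro d) simp
      show "4 * ((t + 1) * ln t - 2 * (t - 1)) \<le> 0" using ln_ge_ratio(2)[of t] t u by simp
    qed
    then show ?thesis by (simp add: G1)
  qed
  then show ?thesis by (simp add: G_def)
qed (simp add: psi_def)

locale two_densities =
  fixes f \<phi> :: "real^'n \<Rightarrow> real"
  assumes f0: "0 \<le> f x" and \<phi>0: "0 < \<phi> x"
    and f1: "integrable lborel f" "(\<integral>x. f x \<partial>lborel) = 1"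
    and \<phi>1: "integrable lborel \<phi>" "(\<integral>x. \<phi> x \<partial>lborel) = 1"
begin

lemma measurable_densities [measurable]: "f \<in> borel_measurable borel" "\<phi> \<in> borel_measurable borel"
  using borel_measurable_integrable[OF f1(1)] borel_measurable_integrable[OF \<phi>1(1)] by simp_all

lemma psi_eq: "\<phi> x * psi (f x / \<phi> x) = f x * ln (f x / \<phi> x) - f x + \<phi> x"
  using \<phi>0[of x] by (simp add: psi_def algebra_simps)

lemma psi_eq_nonneg: "0 \<le> \<phi> x * psi (f x / \<phi> x)"
  using f0[of x] \<phi>0[of x] psi_nonneg[of "f x / \<phi> x"] by simp

text \<open>Since \<open>f\<close> and \<open>\<phi>\<close> have the same mass, the nonnegative integrand \<open>\<phi> psi (f / \<phi>)\<close> has the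
  same integral as \<open>f ln (f / \<phi>)\<close>.\<close>

lemma relative_entropy_eq:
  "relative_entropy f \<phi> = enn2ereal (\<integral>\<^sup>+x. ennreal (\<phi> x * psi (f x / \<phi> x)) \<partial>lborel)"
proof -
  define k where "k x = f x * ln (f x / \<phi> x)" for x
  define P where "P x = \<phi> x * psi (f x / \<phi> x)" for x
  have [measurable]: "k \<in> borel_measurable borel" "P \<in> borel_measurable borel"
    unfolding k_def[abs_def] P_def[abs_def] by measurable
  have P: "P x = k x - f x + \<phi> x" "0 \<le> P x" for x
    using psi_eq[of x] psi_eq_nonneg[of x] by (simp_all add: P_def k_def)
  have R: "relative_entropy f \<phi> = enn2ereal (\<integral>\<^sup>+x. ennreal (k x) \<partial>lborel) - enn2ereal (\<integral>\<^sup>+x. ennreal (- k x) \<partial>lborel)"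
    by (simp add: relative_entropy_def k_def)
  have one: "(\<integral>\<^sup>+x. ennreal (\<phi> x) \<partial>lborel) = 1"
    using nn_integral_eq_integral[OF \<phi>1(1)] less_imp_le[OF \<phi>0] by (simp add: \<phi>1(2))
  have "(\<integral>\<^sup>+x. ennreal (- k x) \<partial>lborel) \<le> (\<integral>\<^sup>+x. ennreal (\<phi> x) \<partial>lborel)"
  proof (intro nn_integral_mono ennreal_leI)
    show "- k x \<le> \<phi> x" for x using P[of x] f0[of x] by linarith
  qed
  then have neg: "(\<integral>\<^sup>+x. ennreal (- k x) \<partial>lborel) < \<infinity>"
    unfolding one by (auto intro: le_less_trans)
  show ?thesis
  proof (cases "(\<integral>\<^sup>+x. ennreal (P x) \<partial>lborel) = \<infinity>")
    case True
    have "(\<integral>\<^sup>+x. ennreal (P x) \<partial>lborel) \<le> (\<integral>\<^sup>+x. ennreal (k x) + ennreal (\<phi> x) \<partial>lborel)"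
    proof (rule nn_integral_mono)
      fix x
      have "P x \<le> max 0 (k x) + \<phi> x" using P(1)[of x] f0[of x] by simp
      then have "ennreal (P x) \<le> ennreal (max 0 (k x) + \<phi> x)" by (rule ennreal_leI)
      also have "\<dots> = ennreal (max 0 (k x)) + ennreal (\<phi> x)"
        using less_imp_le[OF \<phi>0] by (intro ennreal_plus) auto
      also have "ennreal (max 0 (k x)) = ennreal (k x)" by (simp add: max_def ennreal_neg)
      finally show "ennreal (P x) \<le> ennreal (k x) + ennreal (\<phi> x)" .
    qed
    also have "\<dots> = (\<integral>\<^sup>+x. ennreal (k x) \<partial>lborel) + 1"
      by (simp add: nn_integral_add one)
    finally have "(\<integral>\<^sup>+x. ennreal (k x) \<partial>lborel) = \<infinity>" using True by (simp add: top_unique)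
    moreover obtain r where "(\<integral>\<^sup>+x. ennreal (- k x) \<partial>lborel) = ennreal r" "r \<ge> 0"
      using neg by (cases "\<integral>\<^sup>+x. ennreal (- k x) \<partial>lborel") auto
    ultimately show ?thesis
      using True by (simp add: R P_def[symmetric] enn2ereal_ennreal)
  next
    case False
    then have iP: "integrable lborel P"
      using P(2) by (intro integrableI_nonneg) (auto simp: less_top)
    have ik: "integrable lborel k"
    proof -
      have "integrable lborel (\<lambda>x. P x + f x - \<phi> x)" using iP f1 \<phi>1 by simp
      then show ?thesis by (simp add: P(1))
    qed
    have "(\<integral>x. P x \<partial>lborel) = (\<integral>x. k x \<partial>lborel)"
      unfolding P(1) using ik f1 \<phi>1 by simp
    also have "\<dots> = enn2real (\<integral>\<^sup>+x. ennreal (k x) \<partial>lborel) - enn2real (\<integral>\<^sup>+x. ennreal (- k x) \<partial>lborel)"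
      by (rule real_lebesgue_integral_def[OF ik])
    finally have e: "(\<integral>x. P x \<partial>lborel)
       = enn2real (\<integral>\<^sup>+x. ennreal (k x) \<partial>lborel) - enn2real (\<integral>\<^sup>+x. ennreal (- k x) \<partial>lborel)" .
    have "(\<integral>\<^sup>+x. ennreal (k x) \<partial>lborel) < \<infinity>"
    proof -
      have "(\<integral>\<^sup>+x. ennreal (k x) \<partial>lborel) \<le> (\<integral>\<^sup>+x. ennreal (norm (k x)) \<partial>lborel)"
        by (intro nn_integral_mono ennreal_leI) simp
      also have "\<dots> < \<infinity>" using ik by (simp add: integrable_iff_bounded)
      finally show ?thesis .
    qed
    then obtain r where r: "(\<integral>\<^sup>+x. ennreal (k x) \<partial>lborel) = ennreal r" "r \<ge> 0"
      by (cases "\<integral>\<^sup>+x. ennreal (k x) \<partial>lborel") auto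
    obtain r' where r': "(\<integral>\<^sup>+x. ennreal (- k x) \<partial>lborel) = ennreal r'" "r' \<ge> 0"
      using neg by (cases "\<integral>\<^sup>+x. ennreal (- k x) \<partial>lborel") auto
    have iP0: "0 \<le> (\<integral>x. P x \<partial>lborel)" using P(2) by simp
    have "(\<integral>\<^sup>+x. ennreal (P x) \<partial>lborel) = ennreal (\<integral>x. P x \<partial>lborel)"
      by (rule nn_integral_eq_integral[OF iP]) (use P(2) in auto)
    then show ?thesis
      using r r' e iP0 by (simp add: R P_def[symmetric] enn2ereal_ennreal)
  qed
qed

text \<open>Pinsker's inequality: by the quadratic lower bound on \<open>psi\<close> and the arithmetic-geometric
  inequality with a free parameter \<open>t\<close>, the \<open>L\<^sup>1\<close> distance \<open>N\<close> satisfies \<open>N \<le> t + D / (2 t)\<close>; then \<open>t = N / 2\<close>.\<close>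

lemma pinsker:
  "ereal ((\<integral>x. \<bar>f x - \<phi> x\<bar> \<partial>lborel)\<^sup>2) \<le> 2 * relative_entropy f \<phi>"
proof -
  define P where "P x = \<phi> x * psi (f x / \<phi> x)" for x
  have [measurable]: "P \<in> borel_measurable borel" unfolding P_def[abs_def] by measurable
  have P0: "0 \<le> P x" for x using psi_eq_nonneg by (simp add: P_def)
  define N where "N = (\<integral>x. \<bar>f x - \<phi> x\<bar> \<partial>lborel)"
  show ?thesis
  proof (cases "(\<integral>\<^sup>+x. ennreal (P x) \<partial>lborel) = \<infinity>")
    case True
    then show ?thesis by (simp add: relative_entropy_eq P_def[symmetric])
  next
    case False
    then have iP: "integrable lborel P"
      using P0 by (intro integrableI_nonneg) (auto simp: less_top)
    define D where "D = (\<integral>x. P x \<partial>lborel)"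
    have D0: "0 \<le> D" using P0 by (simp add: D_def)
    have "(\<integral>\<^sup>+x. ennreal (P x) \<partial>lborel) = ennreal D"
      unfolding D_def by (rule nn_integral_eq_integral[OF iP]) (use P0 in auto)
    then have RD: "relative_entropy f \<phi> = ereal D"
      using D0 by (simp add: relative_entropy_eq P_def[symmetric] enn2ereal_ennreal)
    have N0: "0 \<le> N" by (simp add: N_def)
    have bound: "N \<le> t + D / (2 * t)" if t: "0 < t" for t
    proof -
      have pw: "\<bar>f x - \<phi> x\<bar> \<le> t / 2 * ((2 * f x + 4 * \<phi> x) / 3) + P x / (2 * t)" for x
      proof -
        define u where "u = f x / \<phi> x"
        have u: "0 \<le> u" using f0[of x] \<phi>0[of x] by (simp add: u_def)
        define X where "X = (2 * u + 4) / 3"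
        have X: "0 < X" using u by (simp add: X_def)
        have Y: "0 \<le> psi u" by (rule psi_nonneg[OF u])
        have "(u - 1)\<^sup>2 \<le> X * psi u"
          using psi_quadratic_lower_bound[OF u] by (simp add: X_def)
        also have "\<dots> = (t * X) * (psi u / t)" using t by simp
        also have "\<dots> \<le> ((t * X + psi u / t) / 2)\<^sup>2"
          using zero_le_power2[of "t * X - psi u / t"] by (simp add: power2_eq_square algebra_simps)
        finally have "\<bar>u - 1\<bar> \<le> (t * X + psi u / t) / 2"
          using t X Y by (intro power2_le_imp_le[of "\<bar>u - 1\<bar>"]) auto
        then have "\<phi> x * \<bar>u - 1\<bar> \<le> \<phi> x * ((t * X + psi u / t) / 2)"
          using less_imp_le[OF \<phi>0] by (intro mult_left_mono)
        moreover have "\<phi> x * \<bar>u - 1\<bar> = \<bar>f x - \<phi> x\<bar>"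
        proof -
          have "\<phi> x * \<bar>u - 1\<bar> = \<bar>\<phi> x * (u - 1)\<bar>" using \<phi>0[of x] by (simp add: abs_mult)
          also have "\<phi> x * (u - 1) = f x - \<phi> x" using \<phi>0[of x] by (simp add: u_def field_simps)
          finally show ?thesis .
        qed
        moreover have "\<phi> x * ((t * X + psi u / t) / 2) = t / 2 * ((2 * (\<phi> x * u) + 4 * \<phi> x) / 3) + (\<phi> x * psi u) / (2 * t)"
          using t by (simp add: X_def field_simps)
        moreover have "\<phi> x * u = f x" using \<phi>0[of x] by (simp add: u_def)
        ultimately show ?thesis by (simp add: P_def u_def)
      qed
      have "N \<le> (\<integral>x. t / 2 * ((2 * f x + 4 * \<phi> x) / 3) + P x / (2 * t) \<partial>lborel)"
        unfolding N_def using f1 \<phi>1 iP by (intro integral_mono pw) auto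
      also have "\<dots> = t + D / (2 * t)"
        using f1 \<phi>1 iP by (simp add: D_def)
      finally show ?thesis .
    qed
    have "N\<^sup>2 \<le> 2 * D"
    proof (cases "N = 0")
      case False
      then have Np: "0 < N" using N0 by simp
      have "N \<le> N / 2 + D / N" using bound[of "N / 2"] Np by simp
      then have "N / 2 \<le> D / N" by linarith
      then show ?thesis using Np by (simp add: field_simps power2_eq_square)
    qed (use D0 in simp)
    then show ?thesis by (simp add: RD N_def)
  qed
qed

text \<open>The set \<open>{x. \<phi> x < f x}\<close> attains the supremum; any other set does no better because \<open>f - \<phi>\<close>
  has integral \<open>0\<close>.\<close>

lemma d_TV_eq:
  fixes M :: "'a measure" and X Y :: "'a \<Rightarrow> real^'n"
  assumes "prob_space M"
    and X: "distributed M lborel X (\<lambda>x. ennreal (f x))"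
    and Y: "distributed M lborel Y (\<lambda>x. ennreal (\<phi> x))"
  shows "d_TV M X Y = (\<integral>x. \<bar>f x - \<phi> x\<bar> \<partial>lborel) / 2"
proof -
  interpret prob_space M by fact
  define N where "N = (\<integral>x. \<bar>f x - \<phi> x\<bar> \<partial>lborel)"
  have meas: "measure M {\<omega>\<in>space M. V \<omega> \<in> S} = (\<integral>x. v x * indicator S x \<partial>lborel)"
    if V: "distributed M lborel V (\<lambda>x. ennreal (v x))" and v: "\<And>x. 0 \<le> v x" and S[measurable]: "S \<in> sets borel"
    for V :: "'a \<Rightarrow> real^'n" and v S
  proof -
    have [measurable]: "V \<in> borel_measurable M"
      using distributed_measurable[OF V] by simp
    have "(\<integral>x. v x * indicator S x \<partial>lborel) = (\<integral>\<omega>. indicator S (V \<omega>) \<partial>M)"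
      by (rule distributed_integral[OF V]) (use v in auto)
    also have "\<dots> = (\<integral>\<omega>. indicator {\<omega>\<in>space M. V \<omega> \<in> S} \<omega> \<partial>M)"
      by (rule Bochner_Integration.integral_cong) (auto split: split_indicator)
    also have "\<dots> = measure M {\<omega>\<in>space M. V \<omega> \<in> S}"
      by (simp add: Int_absorb1)
    finally show ?thesis ..
  qed
  have i: "integrable lborel (\<lambda>x. f x - \<phi> x)" using f1 \<phi>1 by simp
  have iS: "integrable lborel (\<lambda>x. v x * indicator S x)"
    if "integrable lborel v" "S \<in> sets borel" for v :: "real^'n \<Rightarrow> real" and S
    using integrable_real_mult_indicator[of S lborel v] that by simp
  have z: "(\<integral>x. f x - \<phi> x \<partial>lborel) = 0" using f1 \<phi>1 by simp
  \<comment> \<open>Subtracting half the integral of \<open>f - \<phi>\<close>, which is \<open>0\<close>, replaces the indicator of \<open>S\<close> by a sign.\<close>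
  have diff: "measure M {\<omega>\<in>space M. X \<omega> \<in> S} - measure M {\<omega>\<in>space M. Y \<omega> \<in> S}
      = (\<integral>x. (f x - \<phi> x) * (2 * indicator S x - 1) \<partial>lborel) / 2"
    if S: "S \<in> sets borel" for S
  proof -
    have "measure M {\<omega>\<in>space M. X \<omega> \<in> S} - measure M {\<omega>\<in>space M. Y \<omega> \<in> S}
      = (\<integral>x. (f x - \<phi> x) * indicator S x \<partial>lborel)"
      unfolding meas[OF X f0 S] meas[OF Y less_imp_le[OF \<phi>0] S] left_diff_distrib
      by (rule Bochner_Integration.integral_diff[symmetric]) (intro iS f1 \<phi>1 S)+
    moreover have "(\<integral>x. (f x - \<phi> x) * (2 * indicator S x - 1) \<partial>lborel)
       = (\<integral>x. 2 * ((f x - \<phi> x) * indicator S x) - (f x - \<phi> x) \<partial>lborel)"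
      by (rule Bochner_Integration.integral_cong) (auto simp: algebra_simps)
    moreover have "\<dots> = 2 * (\<integral>x. (f x - \<phi> x) * indicator S x \<partial>lborel) - 0"
      unfolding z[symmetric] using iS[OF i S] i
      by (subst Bochner_Integration.integral_diff) auto
    ultimately show ?thesis by simp
  qed
  have sgn: "\<bar>2 * indicator S x - 1\<bar> = (1::real)" for S and x :: "real^'n"
    by (simp split: split_indicator)
  show ?thesis
    unfolding d_TV_def N_def[symmetric]
  proof (rule cSup_eq_maximum)
    let ?S = "{x. \<phi> x < f x}"
    have S: "?S \<in> sets borel" by measurable
    have "(\<integral>x. (f x - \<phi> x) * (2 * indicator ?S x - 1) \<partial>lborel) = N"
      unfolding N_def by (rule Bochner_Integration.integral_cong) (auto split: split_indicator)
    then have "N / 2 = \<bar>measure M {\<omega>\<in>space M. X \<omega> \<in> ?S} - measure M {\<omega>\<in>space M. Y \<omega> \<in> ?S}\<bar>"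
      unfolding diff[OF S] by (simp add: N_def)
    then show "N / 2 \<in> (\<lambda>A. \<bar>measure M {\<omega>\<in>space M. X \<omega> \<in> A} - measure M {\<omega>\<in>space M. Y \<omega> \<in> A}\<bar>) ` sets borel"
      using S by (rule image_eqI)
  next
    fix y assume "y \<in> (\<lambda>A. \<bar>measure M {\<omega>\<in>space M. X \<omega> \<in> A} - measure M {\<omega>\<in>space M. Y \<omega> \<in> A}\<bar>) ` sets borel"
    then obtain S where S: "S \<in> sets borel"
      and y: "y = \<bar>measure M {\<omega>\<in>space M. X \<omega> \<in> S} - measure M {\<omega>\<in>space M. Y \<omega> \<in> S}\<bar>" by auto
    have "\<bar>\<integral>x. (f x - \<phi> x) * (2 * indicator S x - 1) \<partial>lborel\<bar>
       \<le> (\<integral>x. \<bar>(f x - \<phi> x) * (2 * indicator S x - 1)\<bar> \<partial>lborel)"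
      by (rule integral_abs_bound)
    also have "\<dots> = N" by (simp add: N_def abs_mult sgn)
    finally show "y \<le> N / 2" unfolding y diff[OF S] by simp
  qed
qed

end

section \<open>Covariance matrices and the entropy bound\<close>

lemma matrix_inv_left:
  fixes C :: "real^'n^'n"
  assumes "invertible C"
  shows "matrix_inv C ** C = mat 1" and matrix_inv_right: "C ** matrix_inv C = mat 1"
  using someI_ex[OF assms[unfolded invertible_def]] unfolding matrix_inv_def by auto

lemma second_moment_form:
  fixes X :: "'a \<Rightarrow> real^'n"
  assumes "square_integrable M X"
  shows "u \<bullet> (second_moment_matrix M X *v v) = (\<integral>\<omega>. (X \<omega> \<bullet> u) * (X \<omega> \<bullet> v) \<partial>M)"
proof -
  note i = second_moment_integrable[OF assms]
  have "(X \<omega> \<bullet> u) * (X \<omega> \<bullet> v) = (\<Sum>i\<in>UNIV. \<Sum>j\<in>UNIV. (u $ i * v $ j) * (X \<omega> $ i * X \<omega> $ j))" for \<omega>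
    by (simp add: inner_vec_def sum_product algebra_simps)
  then have "(\<integral>\<omega>. (X \<omega> \<bullet> u) * (X \<omega> \<bullet> v) \<partial>M)
      = (\<Sum>i\<in>UNIV. \<Sum>j\<in>UNIV. (u $ i * v $ j) * (\<integral>\<omega>. X \<omega> $ i * X \<omega> $ j \<partial>M))"
    using i by simp
  also have "\<dots> = u \<bullet> (second_moment_matrix M X *v v)"
    by (simp add: inner_vec_def matrix_vector_mult_def second_moment_matrix_def sum_distrib_left algebra_simps)
  finally show ?thesis ..
qed

lemma square_integrable_distributed:
  fixes w :: "real^'n \<Rightarrow> real^'n"
  assumes X: "distributed M lborel X (\<lambda>x. ennreal (f x))" and "\<And>x. 0 \<le> f x"
    and [measurable]: "w \<in> borel_measurable borel"
  shows "square_integrable M (\<lambda>\<omega>. w (X \<omega>)) \<longleftrightarrow> integrable lborel (\<lambda>x. f x * (norm (w x))\<^sup>2)"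
    and "(\<integral>\<omega>. (norm (w (X \<omega>)))\<^sup>2 \<partial>M) = (\<integral>x. f x * (norm (w x))\<^sup>2 \<partial>lborel)"
proof -
  have [measurable]: "X \<in> borel_measurable M" using distributed_measurable[OF X] by simp
  show "square_integrable M (\<lambda>\<omega>. w (X \<omega>)) \<longleftrightarrow> integrable lborel (\<lambda>x. f x * (norm (w x))\<^sup>2)"
    using distributed_integrable[OF X, of "\<lambda>x. (norm (w x))\<^sup>2"] assms(2)
    by (simp add: square_integrable_def)
  show "(\<integral>\<omega>. (norm (w (X \<omega>)))\<^sup>2 \<partial>M) = (\<integral>x. f x * (norm (w x))\<^sup>2 \<partial>lborel)"
    using distributed_integral[OF X, of "\<lambda>x. (norm (w x))\<^sup>2"] assms(2) by simp
qed

lemma density_integral_1: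
  fixes f :: "real^'n \<Rightarrow> real"
  assumes "prob_space M" and X: "distributed M lborel X (\<lambda>x. ennreal (f x))" and "\<And>x. 0 \<le> f x"
  shows "integrable lborel f" "(\<integral>x. f x \<partial>lborel) = 1"
proof -
  interpret prob_space M by fact
  show "integrable lborel f"
    using distributed_integrable[OF X, of "\<lambda>_. 1"] assms(3) by simp
  show "(\<integral>x. f x \<partial>lborel) = 1"
    using distributed_integral[OF X, of "\<lambda>_. 1"] assms(3) prob_space by simp
qed

text \<open>Where \<open>f x = 0\<close> both sides are \<open>0\<close>, because \<open>1 / 0 = 0\<close>.\<close>

lemma score_eq:
  assumes "f x \<ge> 0" and d: "GDERIV f x :> D"
  shows "score f x = (1 / f x) *\<^sub>R D"
proof (cases "f x > 0")
  case True
  then have l: "GDERIV (\<lambda>y. ln (f y)) x :> (1 / f x) *\<^sub>R D"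
    by (intro GDERIV_DERIV_compose[OF d] DERIV_ln_divide)
  then have "(THE D. GDERIV (\<lambda>y. ln (f y)) x :> D) = (1 / f x) *\<^sub>R D"
    by (rule the_equality) (rule gderiv_unique[OF _ l])
  then show ?thesis using True by (simp add: score_def)
next
  case False
  then have "f x = 0" using assms by simp
  then show ?thesis by (simp add: score_def)
qed

text \<open>The normalising constant cannot be negative or zero, since a density integrates to \<open>1\<close>.\<close>

lemma gaussian_density_pos:
  fixes C :: "real^'n^'n"
  assumes "prob_space M" and Z: "centered_gaussian_vector M C Z"
  shows "0 < gaussian_density C x"
proof -
  interpret prob_space M by fact
  have D: "distributed M lborel Z (\<lambda>x. ennreal (gaussian_density C x))"
    using Z by (simp add: centered_gaussian_vector_def)
  have "sqrt ((2 * pi) ^ CARD('n) * det C) > 0"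
  proof (rule ccontr)
    assume "\<not> sqrt ((2 * pi) ^ CARD('n) * det C) > 0"
    then have "gaussian_density C x \<le> 0" for x
      unfolding gaussian_density_def by (intro divide_nonneg_nonpos) auto
    then have "(\<lambda>x. ennreal (gaussian_density C x)) = (\<lambda>_. 0)" by (simp add: fun_eq_iff ennreal_neg)
    then have "distr M lborel Z = density lborel (\<lambda>_. 0)"
      using distributed_distr_eq_density[OF D] by simp
    then have "emeasure (distr M lborel Z) UNIV = 0" by (simp add: emeasure_density)
    moreover have "emeasure (distr M lborel Z) UNIV = 1"
      using distributed_measurable[OF D] emeasure_space_1 by (simp add: emeasure_distr)
    ultimately show False by simp
  qed
  then show ?thesis by (simp add: gaussian_density_def)
qed

text \<open>A covariance matrix is positive semidefinite; it is definite when invertible, because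
  \<open>E (X \<bullet> x)\<^sup>2 = 0\<close> forces \<open>X \<bullet> x = 0\<close> almost surely and thereby \<open>C x = 0\<close>.\<close>

lemma centered_gaussian_of_covariance:
  fixes X :: "'a \<Rightarrow> real^'n"
  assumes M: "prob_space M" and X: "square_integrable M X" and C: "C = second_moment_matrix M X"
    and inv: "invertible C" and Z: "centered_gaussian_vector M C Z"
    and c: "c = 1 / sqrt ((2 * pi) ^ CARD('n) * det C)"
  shows "centered_gaussian ((*v) (matrix_inv C)) ((*v) C) c"
proof -
  let ?A = "matrix_inv C"
  have AC: "?A *v (C *v x) = x" and CA: "C *v (?A *v x) = x" for x
    by (simp_all add: matrix_vector_mul_assoc matrix_inv_left[OF inv] matrix_inv_right[OF inv])
  note form = second_moment_form[OF X, folded C]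
  have symC: "(C *v x) \<bullet> y = x \<bullet> (C *v y)" for x y
    by (subst inner_commute) (simp add: form mult.commute)
  have posC: "0 < x \<bullet> (C *v x)" if "x \<noteq> 0" for x
  proof (rule ccontr)
    assume "\<not> 0 < x \<bullet> (C *v x)"
    then have le: "(\<integral>\<omega>. (X \<omega> \<bullet> x) * (X \<omega> \<bullet> x) \<partial>M) \<le> 0" by (simp add: form)
    have sq: "integrable M (\<lambda>\<omega>. (X \<omega> \<bullet> x) * (X \<omega> \<bullet> x))"
      using integrable_weighted_inner[where f="\<lambda>_. 1" and u=X and v=X and M=M and p=x and q=x] X
      by (simp add: square_integrable_def)
    have "0 \<le> (\<integral>\<omega>. (X \<omega> \<bullet> x) * (X \<omega> \<bullet> x) \<partial>M)" by simp
    with le have "(\<integral>\<omega>. (X \<omega> \<bullet> x) * (X \<omega> \<bullet> x) \<partial>M) = 0" by simp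
    then have ae: "AE \<omega> in M. X \<omega> \<bullet> x = 0"
      using integral_nonneg_eq_0_iff_AE[OF sq] by auto
    have "y \<bullet> (C *v x) = 0" for y
    proof -
      have "(\<integral>\<omega>. (X \<omega> \<bullet> y) * (X \<omega> \<bullet> x) \<partial>M) = (\<integral>\<omega>. 0 \<partial>M)"
        using ae X by (intro integral_cong_AE) (auto simp: square_integrable_def)
      then show ?thesis by (simp add: form)
    qed
    then have "C *v x = 0" by (metis inner_eq_zero_iff)
    then have "x = 0" using AC[of x] by simp
    with that show False by simp
  qed
  have gd: "c * exp (- (x \<bullet> (?A *v x)) / 2) = gaussian_density C x" for x
    unfolding c gaussian_density_def by simp
  have D: "distributed M lborel Z (\<lambda>x. ennreal (gaussian_density C x))"
    using Z by (simp add: centered_gaussian_vector_def)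
  note g1 = density_integral_1[OF M D less_imp_le[OF gaussian_density_pos[OF M Z]]]
  show ?thesis
  proof (rule centered_gaussian.intro)
    show "linear ((*v) ?A)" by (rule matrix_vector_mul_linear)
    show "(?A *v x) \<bullet> y = x \<bullet> (?A *v y)" for x y
      by (metis CA symC)
    show "0 < x \<bullet> (?A *v x)" if "x \<noteq> 0" for x
    proof -
      have "?A *v x \<noteq> 0" using CA[of x] that by auto
      from posC[OF this] show ?thesis by (simp add: CA inner_commute)
    qed
  qed (simp_all only: AC CA gd g1)
qed

theorem proposition1p4p6:
  fixes M :: "'a measure"
    and F Z :: "'a \<Rightarrow> real^'n"
    and f :: "real^'n \<Rightarrow> real"
    and C :: "real^'n^'n"
  assumes "prob_space M"
    and "square_integrable M F"
    and "(LINT \<omega>|M. F \<omega>) = 0"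
    and "C = covariance_matrix M F"
    and "invertible C"
    and "\<And>x. f x \<ge> 0"
    and "\<And>x. f differentiable (at x)"
    and "distributed M lborel F (\<lambda>x. ennreal (f x))"
    and "centered_gaussian_vector M C Z"
    and "prob_space.indep_var M borel F borel Z"
  shows "relative_entropy f (gaussian_density C)
           \<le> ereal (onorm ((*v) C)) * (ereal (1/2) * trace_Cinv_Jst M F f) \<and>
         ereal (onorm ((*v) C)) * (ereal (1/2) * trace_Cinv_Jst M F f)
           = ereal (onorm ((*v) C)) *
               (ereal (1/2) * (trace_J M F f - trace_J M Z (gaussian_density C))) \<and>
         (LINT x|lborel. \<bar>f x - gaussian_density C x\<bar>)\<^sup>2 = 4 * (d_TV M F Z)\<^sup>2 \<and>
         ereal (4 * (d_TV M F Z)\<^sup>2) \<le> 2 * relative_entropy f (gaussian_density C) \<and>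
         2 * relative_entropy f (gaussian_density C)
           \<le> ereal (onorm ((*v) C)) * trace_Cinv_Jst M F f"
proof -
  interpret M: prob_space M by fact
  have C: "C = second_moment_matrix M F"
    using assms(3,4) by (simp add: covariance_matrix_def)
  let ?A = "matrix_inv C" and ?\<phi> = "gaussian_density C" and ?s = "score f"
  define c where "c = 1 / sqrt ((2 * pi) ^ CARD('n) * det C)"
  interpret G: centered_gaussian "(*v) ?A" "(*v) C" c
    by (rule centered_gaussian_of_covariance[OF assms(1,2) C assms(5,9) c_def])
  have dens: "G.dens = ?\<phi>"
    by (rule ext, subst G.dens_def) (simp add: c_def gaussian_density_def)
  have \<phi>pos: "0 < ?\<phi> x" for x by (simp add: dens[symmetric])
  have DF: "distributed M lborel F (\<lambda>x. ennreal (f x))"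
    and DZ: "distributed M lborel Z (\<lambda>x. ennreal (?\<phi> x))"
    using assms(8,9) by (simp_all add: centered_gaussian_vector_def)
  note f1 = density_integral_1[OF assms(1) DF assms(6)]
  interpret D: two_densities f ?\<phi>
    by unfold_locales (use assms(6) \<phi>pos f1 G.integrable_dens G.integral_dens in \<open>simp_all add: dens\<close>)
  from gderiv_exists[OF assms(7)] obtain f' where f': "\<And>x. GDERIV f x :> f' x" by metis
  have s_eq: "?s x = (1 / f x) *\<^sub>R f' x" for x by (rule score_eq[OF assms(6) f'])
  have fs: "f x *\<^sub>R ?s x = f' x" for x
    using gderiv_at_zero_of_nonneg[OF assms(6) f', of x] by (cases "f x = 0") (simp_all add: s_eq)
  have [measurable]: "f' \<in> borel_measurable borel" by (rule gderiv_measurable[OF f'])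
  have s_meas[measurable]: "?s \<in> borel_measurable borel"
    unfolding s_eq[abs_def] by measurable
  have C0: "0 < onorm ((*v) C)"
  proof -
    obtain b :: "real^'n" where b: "b \<in> Basis" by (meson nonempty_Basis ex_in_conv)
    then have "C *v b \<noteq> 0" using G.A_C[of b] by (metis matrix_vector_mult_0_right nonzero_Basis)
    then show ?thesis using G.C_bounded_linear by (auto simp: onorm_pos_lt)
  qed
  define T where "T = (\<Sum>b\<in>Basis. b \<bullet> (?A *v b))"
  have trace_Z: "trace_J M Z ?\<phi> = ereal T"
  proof -
    have sZ: "score ?\<phi> x = - (?A *v x)" for x
      using score_eq[of ?\<phi> x, OF less_imp_le[OF \<phi>pos]] G.gderiv_dens[of x] \<phi>pos[of x]
      by (simp add: dens less_imp_neq)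
    have eq: "?\<phi> x * (norm (score ?\<phi> x))\<^sup>2 = (\<Sum>b\<in>Basis. ?\<phi> x * ((x \<bullet> (?A *v b)) * (x \<bullet> (?A *v b))))" for x
      unfolding sZ norm_minus_cancel norm_square_eq_sum G.symmetric_A by (rule sum_distrib_left)
    have i: "integrable lborel (\<lambda>x. ?\<phi> x * ((x \<bullet> u) * (x \<bullet> v)))" for u v
      using G.integrable_second_moment[of u v] by (simp add: G.integrable_gam dens)
    have v: "(\<integral>x. ?\<phi> x * ((x \<bullet> u) * (x \<bullet> v)) \<partial>lborel) = u \<bullet> (C *v v)" for u v
      using G.second_moment[of u v] by (simp add: G.integral_gam dens)
    have "score ?\<phi> \<in> borel_measurable borel" unfolding sZ[abs_def] by measurable
    note sq = square_integrable_distributed[OF DZ less_imp_le[OF \<phi>pos] this]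
    have si: "square_integrable M (\<lambda>\<omega>. score ?\<phi> (Z \<omega>))" unfolding sq eq using i by simp
    show ?thesis
      unfolding trace_J_def fisher_matrix_def using si
      by (simp add: trace_second_moment_matrix sq(2) eq i v T_def inner_commute)
  qed
  have TV: "(LINT x|lborel. \<bar>f x - ?\<phi> x\<bar>)\<^sup>2 = 4 * (d_TV M F Z)\<^sup>2"
    by (simp add: D.d_TV_eq[OF assms(1) DF DZ] power_divide)
  have pinsker: "ereal (4 * (d_TV M F Z)\<^sup>2) \<le> 2 * relative_entropy f ?\<phi>"
    using D.pinsker by (simp add: TV)
  show ?thesis
  proof (cases "square_integrable M (\<lambda>\<omega>. ?s (F \<omega>))")
    case False
    \<comment> \<open>The Fisher information of \<open>F\<close> is infinite while that of \<open>Z\<close> is finite.\<close>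
    then have "trace_J M F f = \<infinity>" "trace_Cinv_Jst M F f = \<infinity>"
      by (simp_all add: trace_J_def trace_Cinv_Jst_def)
    then show ?thesis using C0 TV pinsker by (simp add: trace_Z)
  next
    case True
    note sqF = square_integrable_distributed[OF DF assms(6)]
    have iS: "integrable lborel (\<lambda>x. f x * (norm (?s x))\<^sup>2)" using True by (simp add: sqF(1)[OF s_meas])
    have ix: "integrable lborel (\<lambda>x. f x * (norm x)\<^sup>2)"
      using assms(2) sqF(1)[of "\<lambda>x. x"] by simp
    interpret V: density_vs_gaussian "(*v) ?A" "(*v) C" c f ?s
    proof unfold_locales
      show "GDERIV f x :> f x *\<^sub>R ?s x" for x by (simp add: fs f')
      show "(\<integral>x. f x * ((x \<bullet> u) * (x \<bullet> v)) \<partial>lborel) = u \<bullet> (C *v v)" for u v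
        using second_moment_form[OF assms(2), of u v, folded C]
          distributed_integral[OF DF, of "\<lambda>x. (x \<bullet> u) * (x \<bullet> v)"] assms(6) by simp
    qed (use assms(6) f1 iS ix in simp_all)
    define R where "R = (\<integral>x. f x * (norm (?s x + ?A *v x))\<^sup>2 \<partial>lborel)"
    define J where "J = (\<integral>x. f x * (norm (?s x))\<^sup>2 \<partial>lborel)"
    have RJ: "R = J - T" unfolding R_def J_def T_def by (rule V.integrable_relative_score(2))
    have R0: "0 \<le> R" unfolding R_def using assms(6) by simp
    have tJ: "trace_J M F f = ereal J"
      using True by (simp add: trace_J_def fisher_matrix_def trace_second_moment_matrix sqF(2)[OF s_meas] J_def)
    have tR: "trace_Cinv_Jst M F f = ereal R"
    proof -
      have m: "(\<lambda>x. ?s x + ?A *v x) \<in> borel_measurable borel" by measurable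
      have "square_integrable M (\<lambda>\<omega>. ?s (F \<omega>) + ?A *v F \<omega>)"
        unfolding sqF(1)[OF m] by (rule V.integrable_relative_score(1))
      moreover have "?A ** (C ** S) = S" for S :: "real^'n^'n"
        by (simp add: matrix_mul_assoc matrix_inv_left[OF assms(5)])
      ultimately show ?thesis
        using True unfolding trace_Cinv_Jst_def standardised_fisher_matrix_def assms(4)[symmetric]
        by (simp add: trace_second_moment_matrix sqF(2)[OF m] R_def)
    qed
    have "(\<integral>x. f x * ((?s x + ?A *v x) \<bullet> (C *v (?s x + ?A *v x))) \<partial>lborel)
        \<le> (\<integral>x. onorm ((*v) C) * (f x * (norm (?s x + ?A *v x))\<^sup>2) \<partial>lborel)"
    proof (rule integral_mono')
      show "integrable lborel (\<lambda>x. onorm ((*v) C) * (f x * (norm (?s x + ?A *v x))\<^sup>2))"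
        by (intro integrable_mult_right V.integrable_relative_score(1))
      fix x
      let ?v = "?s x + ?A *v x"
      have "?v \<bullet> (C *v ?v) \<le> norm ?v * norm (C *v ?v)" by (rule norm_cauchy_schwarz)
      also have "\<dots> \<le> norm ?v * (onorm ((*v) C) * norm ?v)"
        by (intro mult_left_mono onorm[OF G.C_bounded_linear]) simp
      finally have "f x * (?v \<bullet> (C *v ?v)) \<le> f x * (norm ?v * (onorm ((*v) C) * norm ?v))"
        using assms(6) by (rule mult_left_mono)
      then show "f x * (?v \<bullet> (C *v ?v)) \<le> onorm ((*v) C) * (f x * (norm ?v)\<^sup>2)"
        by (simp add: power2_eq_square ac_simps)
      show "0 \<le> onorm ((*v) C) * (f x * (norm ?v)\<^sup>2)" using C0 assms(6)[of x] by simp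
    qed
    also have "\<dots> = onorm ((*v) C) * R" by (simp add: R_def)
    finally have le: "1/2 * (\<integral>x. f x * ((?s x + ?A *v x) \<bullet> (C *v (?s x + ?A *v x))) \<partial>lborel)
        \<le> onorm ((*v) C) * (1/2 * R)" by simp
    have "relative_entropy f ?\<phi> \<le> enn2ereal (ennreal (onorm ((*v) C) * (1/2 * R)))"
      unfolding D.relative_entropy_eq less_eq_ennreal.rep_eq[symmetric]
      by (rule order_trans[OF V.entropy_le_relative_score[unfolded dens] ennreal_leI[OF le]])
    then have main: "relative_entropy f ?\<phi> \<le> ereal (onorm ((*v) C) * (1/2 * R))"
      using C0 R0 by (simp add: enn2ereal_ennreal)
    have "2 * relative_entropy f ?\<phi> \<le> 2 * ereal (onorm ((*v) C) * (1/2 * R))"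
      by (rule ereal_mult_left_mono[OF main]) simp
    then have main2: "2 * relative_entropy f ?\<phi> \<le> ereal (onorm ((*v) C) * R)"
      by simp
    show ?thesis
      unfolding tJ tR trace_Z using main main2 TV pinsker RJ by simp
  qed
qed

end
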